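(* Let $\theta$ be a nonconstant inner function on $\mathbb{D}^2$ having no (nonconstant inner) factor depending only on $z$, let $\mathcal{K}_\theta=H^2(\mathbb{D}^2)\ominus\theta H^2(\mathbb{D}^2)$ and $S_z=P_{\mathcal{K}_\theta}T_z|_{\mathcal{K}_\theta}$. Then $$\sigma_p(S_z)=\emptyset,\qquad \mathbb{T}\subseteq\sigma_e(S_z).$$ Moreover, if $\theta$ is a rational inner function, then $$\sigma_p(S_z^* )=\pi_1(Z_\theta\cap\mathbb{D}^2)^*,$$ $$\sigma_e(S_z)=\mathbb{T}\cup\pi_1\big(Z_\theta\cap(\mathbb{D}\times\mathbb{T})\big)=\pi_1(Z_\theta\cap\partial\mathbb{D}^2),$$ and for $\lambda\in\sigma(S_z)\setminus\sigma_e(S_z)$ the operator $(S_z-\lambda)^*$ is Fredholm with index $$\mathrm{ind}\big((S_z-\lambda)^*\big)=Z_\theta(\lambda),$$ where $Z_\theta(\lambda)$ denotes the number of zeros of $\theta(\lambda,\cdot)$ in $\mathbb{D}$.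
   Context: $H^2(\mathbb{D}^2)$ is the Hardy space over the bidisk, with coordinates $(z,w)$; $T_z$ is multiplication by $z$; $P_{\mathcal{K}}$ is the orthogonal projection onto $\mathcal{K}$; $\mathbb{T}$ is the unit circle; $\partial\mathbb{D}^2$ is the topological boundary of $\mathbb{D}^2$ in $\mathbb{C}^2$; $\pi_1(z,w)=z$; for $A\subset\mathbb{C}$, $A^*=\{\bar\lambda:\lambda\in A\}$. $\sigma,\sigma_p$ denote spectrum and point spectrum, and $\sigma_e(T)$ is the set of $\lambda$ for which $T-\lambda$ is not Fredholm; $\mathrm{ind}(T)=\dim\mathrm{Ker}\,T-\dim\mathrm{Ker}\,T^*$. An inner function on $\mathbb{D}^2$ is $\theta\in H^2(\mathbb{D}^2)$ with $|\theta|=1$ a.e. on $\mathbb{T}^2$; it is rational inner if it is also rational. For rational inner $\theta=q/p$ with $p,q$ coprime polynomials, $Z_\theta$ denotes the zero set of $q$ in $\mathbb{C}^2$. Zeros are counted with multiplicity. *)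

theory Defs
  imports
    "HOL-Complex_Analysis.Complex_Analysis"
    "HOL-Computational_Algebra.Computational_Algebra"
    "HOL-Library.Function_Algebras"
begin

abbreviation unit_disc :: "complex set" ("\<D>") where
  "\<D> \<equiv> ball 0 1"

abbreviation unit_circle :: "complex set" ("\<T>") where
  "\<T> \<equiv> sphere 0 1"

abbreviation bidisc :: "(complex \<times> complex) set" ("\<D>\<^sup>2") where
  "\<D>\<^sup>2 \<equiv> \<D> \<times> \<D>"

type_synonym cfun2 = "complex \<times> complex \<Rightarrow> complex"

definition cscale :: "complex \<Rightarrow> cfun2 \<Rightarrow> cfun2" where
  "cscale c f = (\<lambda>x. c * f x)"

interpretation cfun2: vector_space cscale
  by unfold_locales (auto simp: cscale_def fun_eq_iff algebra_simps)


section \<open>The Hardy space over the bidisc\<close>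

text \<open>Elements of the Hardy space are functions on the bidisc; being total functions in HOL, they are
  extended by zero, so that equality in the space is equality of functions.\<close>

definition taylor_rep :: "(nat \<times> nat \<Rightarrow> complex) \<Rightarrow> cfun2 \<Rightarrow> bool" where
  "taylor_rep a f \<longleftrightarrow>
     (\<lambda>k. (cmod (a k))\<^sup>2) summable_on UNIV \<and>
     (\<forall>z w. (z, w) \<in> \<D>\<^sup>2 \<longrightarrow> ((\<lambda>(m, n). a (m, n) * z ^ m * w ^ n) has_sum f (z, w)) UNIV) \<and>
     (\<forall>x. x \<notin> \<D>\<^sup>2 \<longrightarrow> f x = 0)"

definition H2 :: "cfun2 set" where
  "H2 = {f. \<exists>a. taylor_rep a f}"

definition taylor_coeff :: "cfun2 \<Rightarrow> nat \<times> nat \<Rightarrow> complex" where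
  "taylor_coeff f = (THE a. taylor_rep a f)"

definition h2_inner :: "cfun2 \<Rightarrow> cfun2 \<Rightarrow> complex" where
  "h2_inner f g = (\<Sum>\<^sub>\<infinity>k. taylor_coeff f k * cnj (taylor_coeff g k))"

definition h2_norm :: "cfun2 \<Rightarrow> real" where
  "h2_norm f = sqrt (Re (h2_inner f f))"

definition mult_z :: "cfun2 \<Rightarrow> cfun2" where
  "mult_z f = (\<lambda>(z, w). z * f (z, w))"

definition proj :: "cfun2 set \<Rightarrow> cfun2 \<Rightarrow> cfun2" where
  "proj K f = (THE g. g \<in> K \<and> (\<forall>h\<in>K. h2_inner (f - g) h = 0))"


section \<open>Inner functions\<close>

text \<open>The values on the torus are the radial limits, which exist almost everywhere for every function
  in the Hardy space. By periodicity, almost everywhere on the torus amounts to almost everywhere in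
  the plane of the two angles.\<close>

definition inner_function :: "cfun2 \<Rightarrow> bool" where
  "inner_function \<theta> \<longleftrightarrow> \<theta> \<in> H2 \<and>
     (AE (s, t) in (lborel :: (real \<times> real) measure).
        \<exists>l. ((\<lambda>r. \<theta> (of_real r * cis s, of_real r * cis t)) \<longlongrightarrow> l) (at_left 1) \<and> cmod l = 1)"

text \<open>The cofactor is only required to lie in the Hardy space; it is then automatically inner.\<close>

definition has_inner_factor_in_z :: "cfun2 \<Rightarrow> bool" where
  "has_inner_factor_in_z \<theta> \<longleftrightarrow>
     (\<exists>\<phi> \<psi>. inner_function \<phi> \<and> \<not> \<phi> constant_on \<D>\<^sup>2 \<and>
            (\<exists>h. \<forall>z\<in>\<D>. \<forall>w\<in>\<D>. \<phi> (z, w) = h z) \<and>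
            \<psi> \<in> H2 \<and> \<theta> = \<phi> * \<psi>)"

text \<open>A polynomial in \<open>z\<close> and \<open>w\<close> is a polynomial in \<open>w\<close> with coefficients in \<open>\<complex>[z]\<close>.\<close>

definition poly2 :: "complex poly poly \<Rightarrow> cfun2" where
  "poly2 q = (\<lambda>(z, w). poly (poly q [:w:]) z)"

definition zero_set :: "complex poly poly \<Rightarrow> (complex \<times> complex) set" where
  "zero_set q = {x. poly2 q x = 0}"

text \<open>\<open>\<theta> = q / p\<close> in lowest terms, with the denominator cleared; that \<open>p\<close> has no zero in the bidisc is
  a consequence and not part of the definition.\<close>

definition reduced_fraction :: "cfun2 \<Rightarrow> complex poly poly \<Rightarrow> complex poly poly \<Rightarrow> bool" where
  "reduced_fraction \<theta> q p \<longleftrightarrow> p \<noteq> 0 \<and> coprime q p \<and> (\<forall>x\<in>\<D>\<^sup>2. poly2 p x * \<theta> x = poly2 q x)"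


section \<open>Operators on a closed subspace \<open>K\<close> of the Hardy space\<close>

text \<open>An operator on \<open>K\<close> is given by a function whose values outside \<open>K\<close> are irrelevant.\<close>

definition adj :: "cfun2 set \<Rightarrow> (cfun2 \<Rightarrow> cfun2) \<Rightarrow> cfun2 \<Rightarrow> cfun2" where
  "adj K A g = (THE h. h \<in> K \<and> (\<forall>f\<in>K. h2_inner (A f) g = h2_inner f h))"

definition minus_scalar :: "(cfun2 \<Rightarrow> cfun2) \<Rightarrow> complex \<Rightarrow> cfun2 \<Rightarrow> cfun2" where
  "minus_scalar A c = (\<lambda>f. A f - cscale c f)"

definition Ker :: "cfun2 set \<Rightarrow> (cfun2 \<Rightarrow> cfun2) \<Rightarrow> cfun2 set" where
  "Ker K A = {f \<in> K. A f = 0}"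

definition finite_dim :: "cfun2 set \<Rightarrow> bool" where
  "finite_dim V \<longleftrightarrow> (\<exists>B. finite B \<and> V \<subseteq> cfun2.span B)"

definition h2_closed_in :: "cfun2 set \<Rightarrow> cfun2 set \<Rightarrow> bool" where
  "h2_closed_in K R \<longleftrightarrow> R \<subseteq> K \<and>
     (\<forall>u g. (\<forall>n::nat. u n \<in> R) \<and> g \<in> K \<and> (\<lambda>n. h2_norm (u n - g)) \<longlonglongrightarrow> 0 \<longrightarrow> g \<in> R)"

definition fredholm :: "cfun2 set \<Rightarrow> (cfun2 \<Rightarrow> cfun2) \<Rightarrow> bool" where
  "fredholm K A \<longleftrightarrow>
     h2_closed_in K (A ` K) \<and> finite_dim (Ker K A) \<and> finite_dim (Ker K (adj K A))"

definition index :: "cfun2 set \<Rightarrow> (cfun2 \<Rightarrow> cfun2) \<Rightarrow> int" where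
  "index K A = int (cfun2.dim (Ker K A)) - int (cfun2.dim (Ker K (adj K A)))"

definition invertible_on :: "cfun2 set \<Rightarrow> (cfun2 \<Rightarrow> cfun2) \<Rightarrow> bool" where
  "invertible_on K A \<longleftrightarrow>
     (\<exists>R C. \<forall>f\<in>K. R f \<in> K \<and> h2_norm (R f) \<le> C * h2_norm f \<and> R (A f) = f \<and> A (R f) = f)"

definition spectrum :: "cfun2 set \<Rightarrow> (cfun2 \<Rightarrow> cfun2) \<Rightarrow> complex set" where
  "spectrum K A = {c. \<not> invertible_on K (minus_scalar A c)}"

definition point_spectrum :: "cfun2 set \<Rightarrow> (cfun2 \<Rightarrow> cfun2) \<Rightarrow> complex set" where
  "point_spectrum K A = {c. \<exists>f\<in>K. f \<noteq> 0 \<and> A f = cscale c f}"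

definition essential_spectrum :: "cfun2 set \<Rightarrow> (cfun2 \<Rightarrow> cfun2) \<Rightarrow> complex set" where
  "essential_spectrum K A = {c. \<not> fredholm K (minus_scalar A c)}"


section \<open>The model space and the compressed shift\<close>

definition model_space :: "cfun2 \<Rightarrow> cfun2 set" ("\<K>") where
  "\<K> \<theta> = {f \<in> H2. \<forall>g\<in>H2. h2_inner f (\<theta> * g) = 0}"

definition S_z :: "cfun2 \<Rightarrow> cfun2 \<Rightarrow> cfun2" where
  "S_z \<theta> f = proj (\<K> \<theta>) (mult_z f)"

text \<open>The count \<open>slice_zero_count\<close> includes multiplicities; it is meaningful only if
  \<open>slice_zeros\<close> is finite, which in particular means that the slice does not vanish identically.\<close>

definition slice_zeros :: "cfun2 \<Rightarrow> complex \<Rightarrow> complex set" where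
  "slice_zeros \<theta> c = {w \<in> \<D>. \<theta> (c, w) = 0}"

definition slice_zero_count :: "cfun2 \<Rightarrow> complex \<Rightarrow> int" where
  "slice_zero_count \<theta> c = (\<Sum>w\<in>slice_zeros \<theta> c. zorder (\<lambda>w. \<theta> (c, w)) w)"

end

theory Submission
  imports Defs "HOL-Computational_Algebra.Field_as_Ring"
begin

text \<open>
  Multiplication by \<open>\<theta>\<close> is an isometry \<open>M\<close> of the Hardy space: the dilates of \<open>\<theta>\<close> converge in mean
  square on the torus, and by Fatou's lemma their squared moduli converge in mean to \<open>1\<close>. Hence
  \<open>\<K> \<theta>\<close> is the kernel of \<open>M\<^sup>*\<close>, and the adjoint of \<open>S_z\<close> is the backward shift \<open>B\<close> in \<open>z\<close>.

  An eigenvector of \<open>B\<close> for \<open>cnj c\<close> is \<open>g(w) / (1 - cnj c * z)\<close>, and it is orthogonal to everything that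
  vanishes on the slice \<open>z = c\<close>. So inside the disc all questions concern multiplication by
  \<open>\<theta>(c, \<cdot>)\<close> on the Hardy space of the disc. For rational \<open>\<theta> = q / p\<close> the denominator has no zero in
  \<open>\<D> \<times> closure \<D>\<close> (Hurwitz, since the common zeros of \<open>q\<close> and \<open>p\<close> have finitely many \<open>w\<close>-coordinates), so only \<open>q(c, \<cdot>)\<close>
  matters: the kernel of the adjoint consists of the square-summable linear recurrent sequences whose
  characteristic polynomial is the conjugate of \<open>q(c, \<cdot>)\<close>. Roots outside the open disc contribute nothing, and the
  roots inside give a space of dimension equal to their number. A root on the circle destroys closedness
  of the range.

  On the circle, a closed range of \<open>S_z - c\<close> would make the adjoint bounded below. Testing
  this on the projections of reproducing kernels gives \<open>1 - \<bar>\<theta>(\<lambda>, 0)\<bar>\<^sup>2 \<le> C (1 - \<bar>\<lambda>\<bar>\<^sup>2)\<close> for \<open>\<lambda>\<close> near \<open>c\<close>; then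
  all higher Taylor coefficients of \<open>\<theta>(\<lambda>, \<cdot>)\<close> tend to \<open>0\<close> at an arc, so they vanish and \<open>\<theta>\<close> depends only
  on \<open>z\<close>.
\<close>

text \<open>The Hilbert space is a type of square-summable coefficient families, and the functions
  of the statement are its image under the injective map \<open>fn\<close>. An identity between
  operators can therefore be checked on coefficients, pointwise on the bidisc, or by testing inner
  products. The obstacle inside the disc is the range of \<open>S_z\<close> minus c. It is rephrased
  as membership in (z - c) H^2 + \<theta> H^2, a question about one slice. Division of that slice by
  its inner roots leaves a polynomial remainder, and a kernel vector of the adjoint with the same
  leading coefficients detects it. On the circle, the lower bound for the adjoint comes from a
  gliding hump: pairings of size 3^-n are played against defects of size 4^-n. The description of
  the essential spectrum through the topological boundary also needs a fact without operators:
  \<open>q\<close> has a zero over every point of the circle. It rests on the maximum principle for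
  p/q on slices. The absence of an inner factor in z enters as two facts: no slice of \<theta>
  vanishes identically, since otherwise a Blaschke factor splits off, and \<theta> depends on w,
  since otherwise \<theta> is such a factor itself.\<close>

section \<open>Square-summable coefficient families as a complex Hilbert space\<close>

typedef hardy = "{a :: nat \<times> nat \<Rightarrow> complex. (\<lambda>k. (cmod (a k))\<^sup>2) summable_on UNIV}"
  morphisms coef Hardy
  by (rule exI[of _ "\<lambda>_. 0"]) simp

setup_lifting type_definition_hardy

lemma coef_summable: "(\<lambda>k. (cmod (coef x k))\<^sup>2) summable_on UNIV"
  using coef[of x] by simp

lemma hardy_eqI: "(\<And>m n. coef x (m, n) = coef y (m, n)) \<Longrightarrow> x = y"
  by (metis coef_inject ext surj_pair)

lemma square_summable_add:
  fixes a b :: "'i \<Rightarrow> complex"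
  assumes "(\<lambda>k. (cmod (a k))\<^sup>2) summable_on A" "(\<lambda>k. (cmod (b k))\<^sup>2) summable_on A"
  shows "(\<lambda>k. (cmod (a k + b k))\<^sup>2) summable_on A"
proof (rule summable_on_comparison_test)
  show "(\<lambda>k. 2 * (cmod (a k))\<^sup>2 + 2 * (cmod (b k))\<^sup>2) summable_on A"
    by (intro summable_on_add summable_on_cmult_right assms)
  fix k
  have "(cmod (a k + b k))\<^sup>2 \<le> (cmod (a k) + cmod (b k))\<^sup>2"
    by (intro power_mono norm_triangle_ineq) auto
  also have "\<dots> \<le> 2 * (cmod (a k))\<^sup>2 + 2 * (cmod (b k))\<^sup>2"
    using sum_squares_bound[of "cmod (a k)" "cmod (b k)"] by (simp add: power2_sum)
  finally show "(cmod (a k + b k))\<^sup>2 \<le> 2 * (cmod (a k))\<^sup>2 + 2 * (cmod (b k))\<^sup>2" .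
qed auto

lemma square_summable_cmult:
  fixes a :: "'i \<Rightarrow> complex"
  assumes "(\<lambda>k. (cmod (a k))\<^sup>2) summable_on A"
  shows "(\<lambda>k. (cmod (c * a k))\<^sup>2) summable_on A"
  using summable_on_cmult_right[OF assms, of "(cmod c)\<^sup>2"]
  by (simp add: norm_mult power_mult_distrib)

instantiation hardy :: ab_group_add
begin

lift_definition zero_hardy :: hardy is "\<lambda>_. 0" by simp

lift_definition plus_hardy :: "hardy \<Rightarrow> hardy \<Rightarrow> hardy" is "\<lambda>a b k. a k + b k"
  by (rule square_summable_add)

lift_definition uminus_hardy :: "hardy \<Rightarrow> hardy" is "\<lambda>a k. - a k" by simp

lift_definition minus_hardy :: "hardy \<Rightarrow> hardy \<Rightarrow> hardy" is "\<lambda>a b k. a k - b k"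
  using square_summable_add[where b = "\<lambda>k. - _ k"] by simp

instance by standard (transfer; force)+

end

text \<open>The class \<open>real_inner\<close> carries real scalars; complex multiples are this
  separate operation, tied to \<open>scaleR\<close> by \<open>cs_scaleR\<close>.\<close>

lift_definition cs :: "complex \<Rightarrow> hardy \<Rightarrow> hardy" is "\<lambda>c a k. c * a k"
  by (rule square_summable_cmult)

lemma coef_simps [simp]:
  "coef 0 k = 0" "coef (x + y) k = coef x k + coef y k" "coef (- x) k = - coef x k"
  "coef (x - y) k = coef x k - coef y k" "coef (cs c x) k = c * coef x k"
  by (transfer; simp)+

text \<open>Linear on the left. Its real part becomes the \<open>inner\<close> of the type class, so
  norms and limits are inherited, while orthogonality and adjoints are stated with
  \<open>hinner\<close>.\<close>

lift_definition hinner :: "hardy \<Rightarrow> hardy \<Rightarrow> complex" is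
  "\<lambda>a b. (\<Sum>\<^sub>\<infinity>k. a k * cnj (b k))" .

lemma abs_summable_cinner:
  fixes a b :: "'i \<Rightarrow> complex"
  assumes "(\<lambda>k. (cmod (a k))\<^sup>2) summable_on A" "(\<lambda>k. (cmod (b k))\<^sup>2) summable_on A"
  shows "(\<lambda>k. norm (a k * cnj (b k))) summable_on A"
proof (rule summable_on_comparison_test)
  show "(\<lambda>k. (cmod (a k))\<^sup>2 + (cmod (b k))\<^sup>2) summable_on A"
    by (intro summable_on_add assms)
  fix k show "norm (a k * cnj (b k)) \<le> (cmod (a k))\<^sup>2 + (cmod (b k))\<^sup>2"
  proof -
    have "0 \<le> cmod (a k) * cmod (b k)" by simp
    then show ?thesis
      using sum_squares_bound[of "cmod (a k)" "cmod (b k)"]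
      unfolding norm_mult complex_mod_cnj by linarith
  qed
qed auto

lemma hinner_abs_summable: "(\<lambda>k. norm (coef x k * cnj (coef y k))) summable_on UNIV"
  by (intro abs_summable_cinner coef_summable)

lemma hinner_has_sum: "((\<lambda>k. coef x k * cnj (coef y k)) has_sum hinner x y) UNIV"
  unfolding hinner.rep_eq
  using abs_summable_summable[OF hinner_abs_summable[of x y]] by (rule has_sum_infsum)

lemma hinner_self_has_sum: "((\<lambda>k. (cmod (coef x k))\<^sup>2) has_sum Re (hinner x x)) UNIV"
  using has_sum_Re[OF hinner_has_sum[of x x]] by (simp add: complex_norm_square[symmetric] cmod_power2 power2_eq_square)

lemma hinner_commute: "hinner x y = cnj (hinner y x)"
  unfolding hinner.rep_eq infsum_cnj[symmetric] by (rule infsum_cong) (simp add: mult.commute)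

lemma hinner_add_left: "hinner (x + y) z = hinner x z + hinner y z"
  by (rule has_sum_unique[OF hinner_has_sum])
    (use has_sum_add[OF hinner_has_sum[of x z] hinner_has_sum[of y z]] in \<open>simp add: algebra_simps\<close>)

lemma hinner_cs_left [simp]: "hinner (cs c x) y = c * hinner x y"
  by (rule has_sum_unique[OF hinner_has_sum])
    (use has_sum_cmult_right[OF hinner_has_sum[of x y], of c] in \<open>simp add: mult.assoc\<close>)

instantiation hardy :: real_inner
begin

definition scaleR_hardy :: "real \<Rightarrow> hardy \<Rightarrow> hardy" where
  "scaleR_hardy r x = cs (of_real r) x"

definition inner_hardy :: "hardy \<Rightarrow> hardy \<Rightarrow> real" where
  "inner_hardy x y = Re (hinner x y)"

definition norm_hardy :: "hardy \<Rightarrow> real" where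
  "norm_hardy x = sqrt (inner x x)"

definition dist_hardy :: "hardy \<Rightarrow> hardy \<Rightarrow> real" where
  "dist_hardy x y = norm (x - y)"

definition sgn_hardy :: "hardy \<Rightarrow> hardy" where
  "sgn_hardy x = scaleR (inverse (norm x)) x"

definition uniformity_hardy :: "(hardy \<times> hardy) filter" where
  "uniformity_hardy = (INF e\<in>{0<..}. principal {(x, y). dist x y < e})"

definition open_hardy :: "hardy set \<Rightarrow> bool" where
  "open_hardy U = (\<forall>x\<in>U. eventually (\<lambda>(x', y). x' = x \<longrightarrow> y \<in> U) uniformity)"

instance
proof
  fix x y z :: hardy and r s :: real
  show "dist x y = norm (x - y)" by (rule dist_hardy_def)
  show "sgn x = scaleR (inverse (norm x)) x" by (rule sgn_hardy_def)
  show "r *\<^sub>R (x + y) = r *\<^sub>R x + r *\<^sub>R y" "(r + s) *\<^sub>R x = r *\<^sub>R x + s *\<^sub>R x"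
    "r *\<^sub>R s *\<^sub>R x = (r * s) *\<^sub>R x" "1 *\<^sub>R x = x"
    by (rule hardy_eqI; simp add: scaleR_hardy_def algebra_simps)+
  show "inner x y = inner y x" unfolding inner_hardy_def by (subst hinner_commute) simp
  show "inner (x + y) z = inner x z + inner y z" by (simp add: inner_hardy_def hinner_add_left)
  show "inner (r *\<^sub>R x) y = r * inner x y" by (simp add: inner_hardy_def scaleR_hardy_def)
  have *: "0 \<le> Re (hinner x x)" by (rule has_sum_nonneg[OF hinner_self_has_sum]) auto
  then show "0 \<le> inner x x" by (simp add: inner_hardy_def)
  have "x = 0" if "Re (hinner x x) = 0"
  proof (rule hardy_eqI)
    fix m n
    have "(cmod (coef x (m, n)))\<^sup>2 = 0"
      by (rule nonneg_has_sum_le_0D[OF hinner_self_has_sum[of x], of "(m, n)"]) (use that in auto)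
    then show "coef x (m, n) = coef 0 (m, n)" by simp
  qed
  moreover have "hinner 0 0 = 0" using hinner_cs_left[of 0 0 0] hinner_add_left[of 0 0 0] by simp
  ultimately show "(inner x x = 0) = (x = 0)" by (auto simp: inner_hardy_def)
  show "norm x = sqrt (inner x x)" by (rule norm_hardy_def)
qed (rule uniformity_hardy_def open_hardy_def)+

end

lemma hinner_self: "hinner x x = of_real ((norm x)\<^sup>2)"
proof -
  have "Im (hinner x x) = 0" using hinner_commute[of x x] by (simp add: complex_eq_iff)
  moreover have "Re (hinner x x) = (norm x)\<^sup>2"
    by (simp add: power2_norm_eq_inner inner_hardy_def)
  ultimately show ?thesis by (simp add: complex_eq_iff)
qed

lemma norm_has_sum: "((\<lambda>k. (cmod (coef x k))\<^sup>2) has_sum (norm x)\<^sup>2) UNIV"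
  using hinner_self_has_sum[of x] by (simp add: hinner_self)

lemma cmod_coef_le: "cmod (coef x k) \<le> norm x"
proof -
  have "(cmod (coef x k))\<^sup>2 \<le> (norm x)\<^sup>2"
    using finite_sum_le_has_sum[OF norm_has_sum[of x], of "{k}"] by simp
  then show ?thesis by (simp add: power2_le_iff_abs_le)
qed

lemma cs_scaleR: "cs (of_real r) x = r *\<^sub>R x" by (simp add: scaleR_hardy_def)

lemma cs_simps [simp]:
  "cs c (x + y) = cs c x + cs c y" "cs c (x - y) = cs c x - cs c y" "cs c (- x) = - cs c x"
  "cs c 0 = 0" "cs 0 x = 0" "cs 1 x = x" "cs c (cs d x) = cs (c * d) x" "cs (- c) x = - cs c x"
  by (rule hardy_eqI; simp add: algebra_simps)+

lemma cs_diff_left: "cs (c - d) x = cs c x - cs d x"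
  by (rule hardy_eqI) (simp add: algebra_simps)

lemma cs_eq_0_iff [simp]: "cs c x = 0 \<longleftrightarrow> c = 0 \<or> x = 0"
proof (cases "c = 0")
  case False
  then have "x = 0" if "cs c x = 0" using that cs_simps(7)[of "inverse c" c x] by simp
  then show ?thesis by auto
qed auto

lemma hinner_simps [simp]:
  "hinner 0 y = 0" "hinner y 0 = 0" "hinner (- x) y = - hinner x y" "hinner x (- y) = - hinner x y"
  "hinner x (cs c y) = cnj c * hinner x y"
  "hinner (r *\<^sub>R x) y = of_real r * hinner x y" "hinner x (r *\<^sub>R y) = of_real r * hinner x y"
proof -
  show l: "hinner 0 y = 0" and m: "hinner (- x) y = - hinner x y" for x y
    using hinner_cs_left[of 0 0 y] hinner_cs_left[of "-1" x y] by simp_all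
  show "hinner y 0 = 0" using hinner_commute[of y 0] by (simp add: l)
  show "hinner x (- y) = - hinner x y" by (subst (1 2) hinner_commute) (simp add: m)
  show r: "hinner x (cs c y) = cnj c * hinner x y" for c by (subst (1 2) hinner_commute) simp
  show "hinner (r *\<^sub>R x) y = of_real r * hinner x y" "hinner x (r *\<^sub>R y) = of_real r * hinner x y"
    by (simp_all add: r flip: cs_scaleR)
qed

lemma hinner_add_right: "hinner x (y + z) = hinner x y + hinner x z"
  by (subst (1 2 3) hinner_commute) (simp add: hinner_add_left)

lemma hinner_diff_left: "hinner (x - y) z = hinner x z - hinner y z"
  using hinner_add_left[of x "- y" z] by simp

lemma hinner_diff_right: "hinner z (x - y) = hinner z x - hinner z y"
  using hinner_add_right[of z x "- y"] by simp

lemmas hinner_algebra = hinner_add_left hinner_add_right hinner_diff_left hinner_diff_right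

lemma norm_cs [simp]: "norm (cs c x) = cmod c * norm x"
proof -
  have "(norm (cs c x))\<^sup>2 = (cmod c * norm x)\<^sup>2"
    by (rule has_sum_unique[OF norm_has_sum])
      (use has_sum_cmult_right[OF norm_has_sum[of x], of "(cmod c)\<^sup>2"] in
        \<open>simp add: norm_mult power_mult_distrib\<close>)
  then show ?thesis by (simp add: power2_eq_iff_nonneg)
qed

text \<open>Rotating \<open>x\<close> by the unimodular \<open>u\<close> makes the inner product
  real and reduces the claim to the real Cauchy-Schwarz inequality.\<close>

lemma hinner_bound: "cmod (hinner x y) \<le> norm x * norm y"
proof (cases "hinner x y = 0")
  case False
  define u where "u = cnj (hinner x y) / of_real (cmod (hinner x y))"
  have u: "cmod u = 1" using False by (simp add: u_def norm_divide)
  have "u * hinner x y = of_real (cmod (hinner x y))"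
    using False by (simp add: u_def field_simps complex_norm_square[symmetric] power2_eq_square)
  then have "cmod (hinner x y) = inner (cs u x) y" by (simp add: inner_hardy_def)
  also have "\<dots> \<le> norm (cs u x) * norm y" by (rule norm_cauchy_schwarz)
  finally show ?thesis by (simp add: u)
qed auto

text \<open>Bilinearity is meant over the reals, where conjugate-linearity in the second argument is
  linearity; the gain is continuity of \<open>hinner\<close>.\<close>

lemma bounded_bilinear_hinner: "bounded_bilinear hinner"
proof
  show "\<exists>K. \<forall>a b. cmod (hinner a b) \<le> norm a * norm b * K"
    by (rule exI[of _ 1]) (simp add: hinner_bound)
qed (simp_all add: hinner_algebra scaleR_conv_of_real)

lemmas tendsto_hinner = bounded_bilinear.tendsto[OF bounded_bilinear_hinner]

lemma hinner_eqI: "(\<And>z. hinner x z = hinner y z) \<Longrightarrow> x = y"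
proof -
  assume *: "\<And>z. hinner x z = hinner y z"
  have "hinner (x - y) (x - y) = 0" using * by (simp add: hinner_algebra)
  then show ?thesis by (simp add: hinner_self)
qed

text \<open>Riesz-Fischer: each coordinate is bounded by the norm and so converges, and the Cauchy
  estimate survives the limit on every finite set of indices, hence for the full norm.\<close>

instance hardy :: complete_space
proof
  fix X :: "nat \<Rightarrow> hardy"
  assume X: "Cauchy X"
  have "Cauchy (\<lambda>i. coef (X i) k)" for k
  proof (rule metric_CauchyI)
    fix e :: real assume "e > 0"
    then obtain N where N: "\<And>m n. m \<ge> N \<Longrightarrow> n \<ge> N \<Longrightarrow> dist (X m) (X n) < e"
      using metric_CauchyD[OF X] by blast
    have "dist (coef (X m) k) (coef (X n) k) < e" if "m \<ge> N" "n \<ge> N" for m n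
      using cmod_coef_le[of "X m - X n" k] N[OF that] by (simp add: dist_norm)
    then show "\<exists>N. \<forall>m\<ge>N. \<forall>n\<ge>N. dist (coef (X m) k) (coef (X n) k) < e" by blast
  qed
  then have "\<exists>l. (\<lambda>i. coef (X i) k) \<longlonglongrightarrow> l" for k by (simp add: Cauchy_convergent_iff convergent_def)
  then obtain a where a: "\<And>k. (\<lambda>i. coef (X i) k) \<longlonglongrightarrow> a k" by metis
  have tail: "\<exists>N. \<forall>i\<ge>N. \<forall>F. finite F \<longrightarrow> (\<Sum>k\<in>F. (cmod (coef (X i) k - a k))\<^sup>2) \<le> e\<^sup>2" if e: "e > 0" for e :: real
  proof -
    obtain N where N: "\<And>m n. m \<ge> N \<Longrightarrow> n \<ge> N \<Longrightarrow> dist (X m) (X n) < e"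
      using metric_CauchyD[OF X e] by blast
    have "(\<Sum>k\<in>F. (cmod (coef (X i) k - a k))\<^sup>2) \<le> e\<^sup>2" if "i \<ge> N" "finite F" for i F
    proof (rule tendsto_upperbound)
      show "(\<lambda>j. \<Sum>k\<in>F. (cmod (coef (X i) k - coef (X j) k))\<^sup>2) \<longlonglongrightarrow> (\<Sum>k\<in>F. (cmod (coef (X i) k - a k))\<^sup>2)"
        by (intro tendsto_intros a)
      have "(\<Sum>k\<in>F. (cmod (coef (X i) k - coef (X j) k))\<^sup>2) \<le> e\<^sup>2" if "j \<ge> N" for j
      proof -
        have "(\<Sum>k\<in>F. (cmod (coef (X i) k - coef (X j) k))\<^sup>2) \<le> (norm (X i - X j))\<^sup>2"
          using finite_sum_le_has_sum[OF norm_has_sum[of "X i - X j"] \<open>finite F\<close>] by simp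
        also have "\<dots> \<le> e\<^sup>2"
          using N[OF \<open>i \<ge> N\<close> that] by (intro power_mono) (auto simp: dist_norm)
        finally show ?thesis .
      qed
      then show "\<forall>\<^sub>F j in sequentially. (\<Sum>k\<in>F. (cmod (coef (X i) k - coef (X j) k))\<^sup>2) \<le> e\<^sup>2"
        unfolding eventually_sequentially by blast
    qed simp
    then show ?thesis by blast
  qed
  obtain N where N: "\<And>F. finite F \<Longrightarrow> (\<Sum>k\<in>F. (cmod (coef (X N) k - a k))\<^sup>2) \<le> 1"
    using tail[of 1] by auto
  have "(\<lambda>k. (cmod (coef (X N) k - a k))\<^sup>2) summable_on UNIV"
    by (intro nonneg_bdd_above_summable_on bdd_aboveI2[where M = 1]) (auto intro: N)
  from square_summable_add[OF coef_summable[of "X N"] square_summable_cmult[OF this, of "-1"]]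
  have "(\<lambda>k. (cmod (a k))\<^sup>2) summable_on UNIV" by simp
  then have ca: "coef (Hardy a) = a" by (simp add: Hardy_inverse)
  have "X \<longlonglongrightarrow> Hardy a"
  proof (rule metric_LIMSEQ_I)
    fix e :: real assume "e > 0"
    then obtain N where N: "\<And>i F. i \<ge> N \<Longrightarrow> finite F \<Longrightarrow> (\<Sum>k\<in>F. (cmod (coef (X i) k - a k))\<^sup>2) \<le> (e / 2)\<^sup>2"
      using tail[of "e / 2"] by auto
    have "dist (X i) (Hardy a) < e" if "i \<ge> N" for i
    proof -
      have "(norm (X i - Hardy a))\<^sup>2 \<le> (e / 2)\<^sup>2"
        by (rule has_sum_le_finite_sums[OF norm_has_sum]) (use N[OF that] in \<open>simp add: ca\<close>)
      then have "norm (X i - Hardy a) \<le> e / 2"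
        using \<open>e > 0\<close> by (simp add: power2_le_iff_abs_le)
      then show ?thesis using \<open>e > 0\<close> by (simp add: dist_norm)
    qed
    then show "\<exists>N. \<forall>i\<ge>N. dist (X i) (Hardy a) < e" by blast
  qed
  then show "convergent X" by (rule convergentI)
qed

section \<open>Forward and backward shifts\<close>

lemma has_sum_shift:
  fixes f :: "nat \<times> nat \<Rightarrow> 'a :: {comm_monoid_add, topological_space}"
  assumes "(f has_sum s) UNIV"
  shows "((\<lambda>k. if fst e \<le> fst k \<and> snd e \<le> snd k then f (fst k - fst e, snd k - snd e) else 0) has_sum s) UNIV"
proof -
  define h where "h = (\<lambda>k :: nat \<times> nat. (fst k + fst e, snd k + snd e))"
  define g where "g = (\<lambda>k. if fst e \<le> fst k \<and> snd e \<le> snd k then f (fst k - fst e, snd k - snd e) else 0)"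
  have "inj h" by (auto simp: inj_on_def h_def prod_eq_iff)
  moreover have "g \<circ> h = f" by (auto simp: fun_eq_iff g_def h_def)
  ultimately have "(g has_sum s) (range h)" using assms by (simp add: has_sum_reindex)
  moreover have "g k = 0" if "k \<notin> range h" for k
  proof (rule ccontr)
    assume "g k \<noteq> 0"
    then have "k = h (fst k - fst e, snd k - snd e)"
      by (auto simp: g_def h_def prod_eq_iff split: if_splits)
    with that show False by blast
  qed
  ultimately show ?thesis
    unfolding g_def[symmetric] by (subst has_sum_cong_neutral[where S = UNIV and T = "range h" and g = g]) auto
qed

text \<open>Multiplication by z^i w^j for \<open>e = (i, j)\<close>; \<open>backshift e\<close> is
  its adjoint, by \<open>hinner_shift\<close>.\<close>

lift_definition shift :: "nat \<times> nat \<Rightarrow> hardy \<Rightarrow> hardy" is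
  "\<lambda>e a k. if fst e \<le> fst k \<and> snd e \<le> snd k then a (fst k - fst e, snd k - snd e) else 0"
proof -
  fix e :: "nat \<times> nat" and a :: "nat \<times> nat \<Rightarrow> complex"
  assume "(\<lambda>k. (cmod (a k))\<^sup>2) summable_on UNIV"
  then obtain s where "((\<lambda>k. (cmod (a k))\<^sup>2) has_sum s) UNIV" by (auto simp: summable_on_def)
  from has_sum_shift[OF this, of e] show "(\<lambda>k. (cmod (if fst e \<le> fst k \<and> snd e \<le> snd k
      then a (fst k - fst e, snd k - snd e) else 0))\<^sup>2) summable_on UNIV"
    by (auto simp: summable_on_def if_distrib[of "\<lambda>x. (cmod x)\<^sup>2"] cong: if_cong)
qed

lift_definition backshift :: "nat \<times> nat \<Rightarrow> hardy \<Rightarrow> hardy" is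
  "\<lambda>e a k. a (fst k + fst e, snd k + snd e)"
proof -
  fix e :: "nat \<times> nat" and a :: "nat \<times> nat \<Rightarrow> complex"
  assume *: "(\<lambda>k. (cmod (a k))\<^sup>2) summable_on UNIV"
  have "inj (\<lambda>k :: nat \<times> nat. (fst k + fst e, snd k + snd e))"
    by (auto simp: inj_on_def prod_eq_iff)
  from summable_on_reindex[OF this, of "\<lambda>k. (cmod (a k))\<^sup>2"] summable_on_subset_banach[OF *]
  show "(\<lambda>k. (cmod (a (fst k + fst e, snd k + snd e)))\<^sup>2) summable_on UNIV"
    by (simp add: o_def)
qed

lemma coef_shift: "coef (shift (i, j) x) (m, n) = (if i \<le> m \<and> j \<le> n then coef x (m - i, n - j) else 0)"
  by transfer simp

lemma coef_backshift [simp]: "coef (backshift (i, j) x) (m, n) = coef x (m + i, n + j)"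
  by transfer simp

lemma hinner_shift: "hinner (shift e x) y = hinner x (backshift e y)"
proof -
  have "((\<lambda>k. coef (shift e x) k * cnj (coef y k)) has_sum hinner x (backshift e y)) UNIV"
    using has_sum_shift[OF hinner_has_sum[of x "backshift e y"], of e]
    by (rule back_subst[of "\<lambda>f. (f has_sum _) _"]) (auto simp: fun_eq_iff shift.rep_eq backshift.rep_eq)
  then show ?thesis using hinner_has_sum has_sum_unique by blast
qed

lemma hinner_backshift: "hinner (backshift e x) y = hinner x (shift e y)"
  by (subst (1 2) hinner_commute) (simp add: hinner_shift)

lemma backshift_shift [simp]: "backshift e (shift e x) = x"
  by (cases e) (auto intro!: hardy_eqI simp: coef_shift)

lemma hinner_shift_shift [simp]: "hinner (shift e x) (shift e y) = hinner x y"
  by (simp add: hinner_shift)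

lemma norm_shift [simp]: "norm (shift e x) = norm x"
  by (simp add: norm_eq_sqrt_inner inner_hardy_def)

lemma shift_linear [simp]:
  "shift e (x + y) = shift e x + shift e y" "shift e (x - y) = shift e x - shift e y" "shift e (cs c x) = cs c (shift e x)"
  "shift e 0 = 0"
  by (cases e; rule hardy_eqI; simp add: coef_shift)+

lemma backshift_linear [simp]:
  "backshift e (x + y) = backshift e x + backshift e y" "backshift e (x - y) = backshift e x - backshift e y" "backshift e (cs c x) = cs c (backshift e x)"
  "backshift e 0 = 0"
  by (cases e; rule hardy_eqI; simp)+

lemma norm_backshift: "norm (backshift e x) \<le> norm x"
proof -
  have "(norm (backshift e x))\<^sup>2 = cmod (hinner (backshift e x) (backshift e x))" unfolding hinner_self norm_of_real by simp
  also have "\<dots> = cmod (hinner x (shift e (backshift e x)))" by (simp add: hinner_backshift)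
  also have "\<dots> \<le> norm x * norm (backshift e x)" using hinner_bound[of x "shift e (backshift e x)"] by simp
  finally show ?thesis by (cases "norm (backshift e x) = 0") (auto simp: power2_eq_square)
qed

abbreviation Z :: "hardy \<Rightarrow> hardy" where "Z \<equiv> shift (Suc 0, 0)"
abbreviation W :: "hardy \<Rightarrow> hardy" where "W \<equiv> shift (0, Suc 0)"
abbreviation Bz :: "hardy \<Rightarrow> hardy" where "Bz \<equiv> backshift (Suc 0, 0)"
abbreviation Bw :: "hardy \<Rightarrow> hardy" where "Bw \<equiv> backshift (0, Suc 0)"

lemma shift_commute: "Bz (shift (0, j) x) = shift (0, j) (Bz x)" "Bw (shift (i, 0) x) = shift (i, 0) (Bw x)"
  "Bz (Bw x) = Bw (Bz x)" "Z (W x) = W (Z x)"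
  by (auto intro!: hardy_eqI simp: coef_shift)

section \<open>Evaluation on the bidisc\<close>

text \<open>The Szego kernel at (z, w): pairing with it evaluates there. If one of the moduli is at
  least 1 the family is not square summable and \<open>Hardy\<close> gives no information, so the
  lemmas assume both moduli below 1.\<close>

definition ker :: "complex \<Rightarrow> complex \<Rightarrow> hardy" where
  "ker z w = Hardy (\<lambda>(m, n). cnj z ^ m * cnj w ^ n)"

lemma has_sum_geometric_square:
  assumes "cmod z < 1" "cmod w < 1"
  shows "((\<lambda>(m, n). (cmod (cnj z ^ m * cnj w ^ n))\<^sup>2) has_sum 1 / ((1 - (cmod z)\<^sup>2) * (1 - (cmod w)\<^sup>2))) UNIV"
proof -
  have geo: "((\<lambda>n. (cmod (cnj u ^ n))\<^sup>2) has_sum 1 / (1 - (cmod u)\<^sup>2)) UNIV" if "cmod u < 1" for u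
  proof -
    have "(cmod u)\<^sup>2 < 1" using that by (simp add: power_less_one_iff abs_square_less_1)
    from geometric_sums[of "(cmod u)\<^sup>2"] this
    have "(\<lambda>n. ((cmod u)\<^sup>2) ^ n) sums (1 / (1 - (cmod u)\<^sup>2))" by simp
    from sums_nonneg_imp_has_sum[OF this] show ?thesis
      by (simp add: norm_power power_mult[symmetric] mult.commute)
  qed
  have inner: "((\<lambda>n. (\<lambda>(m, n). (cmod (cnj z ^ m * cnj w ^ n))\<^sup>2) (m, n)) has_sum
      (cmod (cnj z ^ m))\<^sup>2 * (1 / (1 - (cmod w)\<^sup>2))) UNIV" for m
    using has_sum_cmult_right[OF geo[OF assms(2)], of "(cmod (cnj z ^ m))\<^sup>2"]
    by (simp add: norm_mult power_mult_distrib)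
  have outer: "((\<lambda>m. (cmod (cnj z ^ m))\<^sup>2 * (1 / (1 - (cmod w)\<^sup>2))) has_sum
      1 / (1 - (cmod z)\<^sup>2) * (1 / (1 - (cmod w)\<^sup>2))) UNIV"
    by (rule has_sum_cmult_left[OF geo[OF assms(1)]])
  have "((\<lambda>(m, n). (cmod (cnj z ^ m * cnj w ^ n))\<^sup>2) has_sum
      1 / (1 - (cmod z)\<^sup>2) * (1 / (1 - (cmod w)\<^sup>2))) (UNIV \<times> UNIV)"
    using outer
    by (intro has_sum_SigmaI[OF inner outer] summable_on_SigmaI[OF inner]) (auto simp: summable_on_def)
  then show ?thesis by simp
qed

lemma coef_ker [simp]:
  assumes "cmod z < 1" "cmod w < 1"
  shows "coef (ker z w) (m, n) = cnj z ^ m * cnj w ^ n"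
proof -
  have "(\<lambda>(m, n). (cmod (cnj z ^ m * cnj w ^ n))\<^sup>2) summable_on UNIV"
    using has_sum_geometric_square[OF assms] by (auto simp: summable_on_def)
  then have "(\<lambda>k. (cmod ((\<lambda>(m, n). cnj z ^ m * cnj w ^ n) k))\<^sup>2) summable_on UNIV"
    by (simp add: case_prod_unfold)
  then show ?thesis by (simp add: ker_def Hardy_inverse)
qed

lemma coef_ker':
  assumes "cmod z < 1" "cmod w < 1"
  shows "coef (ker z w) k = cnj z ^ fst k * cnj w ^ snd k"
  using coef_ker[OF assms, of "fst k" "snd k"] by simp

lemma norm_ker:
  assumes "cmod z < 1" "cmod w < 1"
  shows "(norm (ker z w))\<^sup>2 = 1 / ((1 - (cmod z)\<^sup>2) * (1 - (cmod w)\<^sup>2))"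
  using has_sum_unique[OF norm_has_sum[of "ker z w"]] has_sum_geometric_square[OF assms]
  by (simp add: case_prod_unfold coef_ker'[OF assms])

definition fn :: "hardy \<Rightarrow> cfun2" where
  "fn x = (\<lambda>(z, w). if cmod z < 1 \<and> cmod w < 1 then hinner x (ker z w) else 0)"

lemma fn_outside: "p \<notin> \<D>\<^sup>2 \<Longrightarrow> fn x p = 0"
  by (auto simp: fn_def split: prod.splits)

lemma fn_has_sum:
  assumes "cmod z < 1" "cmod w < 1"
  shows "((\<lambda>(m, n). coef x (m, n) * z ^ m * w ^ n) has_sum fn x (z, w)) UNIV"
  using hinner_has_sum[of x "ker z w"] assms
  by (simp add: fn_def case_prod_unfold mult.assoc coef_ker'[OF assms])

lemma fn_linear: "fn (x + y) = fn x + fn y" "fn (x - y) = fn x - fn y" "fn (cs c x) = cscale c (fn x)"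
  "fn 0 = 0"
  by (auto simp: fn_def fun_eq_iff hinner_algebra cscale_def zero_fun_def)

lemma fn_apply [simp]: "fn (x + y) p = fn x p + fn y p" "fn (x - y) p = fn x p - fn y p"
  "fn (cs c x) p = c * fn x p" "fn 0 p = 0"
  by (simp_all add: fn_linear cscale_def)

lemma backshift_ker:
  assumes "cmod z < 1" "cmod w < 1"
  shows "backshift (i, j) (ker z w) = cs (cnj z ^ i * cnj w ^ j) (ker z w)"
  by (rule hardy_eqI) (simp add: assms power_add)

lemma fn_shift: "fn (shift (i, j) x) (z, w) = z ^ i * w ^ j * fn x (z, w)"
  by (simp add: fn_def hinner_shift backshift_ker)

lemma fn_bound:
  assumes "cmod z < 1" "cmod w < 1"
  shows "cmod (fn x (z, w)) \<le> norm x * norm (ker z w)"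
  using hinner_bound[of x "ker z w"] assms by (simp add: fn_def)

text \<open>The coefficient of w^n when \<open>fn x\<close> is expanded in powers of w, as a
  function of z. Written as an inner product so that Hilbert space estimates apply to it.\<close>

definition zcoef :: "hardy \<Rightarrow> nat \<Rightarrow> complex \<Rightarrow> complex" where
  "zcoef x n z = hinner x (shift (0, n) (ker z 0))"

lemma zcoef_has_sum:
  assumes "cmod z < 1"
  shows "((\<lambda>m. coef x (m, n) * z ^ m) has_sum zcoef x n z) UNIV"
proof -
  have "((\<lambda>k. coef x k * cnj (coef (shift (0, n) (ker z 0)) k)) has_sum zcoef x n z) (range (\<lambda>m. (m, n)))"
    using hinner_has_sum[of x "shift (0, n) (ker z 0)"] assms unfolding zcoef_def
    by (subst has_sum_cong_neutral[where T = UNIV]) (auto simp: coef_shift power_0_left split: if_splits)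
  then show ?thesis
    using assms by (subst (asm) has_sum_reindex) (auto simp: inj_on_def o_def coef_shift)
qed

lemma fn_has_sum_zcoef:
  assumes "cmod z < 1" "cmod w < 1"
  shows "((\<lambda>n. zcoef x n z * w ^ n) has_sum fn x (z, w)) UNIV"
proof -
  have "((\<lambda>(n, m). coef x (m, n) * z ^ m * w ^ n) has_sum fn x (z, w)) (UNIV \<times> UNIV)"
    using fn_has_sum[OF assms, of x] has_sum_swap[of "\<lambda>(m, n). coef x (m, n) * z ^ m * w ^ n" UNIV UNIV "fn x (z, w)"]
    by simp
  then show ?thesis
    by (rule has_sum_SigmaD) (use has_sum_cmult_left[OF zcoef_has_sum[OF assms(1)]] in simp)
qed

lemma powser_eq_0D:
  fixes c :: "nat \<Rightarrow> complex"
  assumes "\<And>w. cmod w < 1 \<Longrightarrow> (\<lambda>n. c n * w ^ n) sums 0"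
  shows "c n = 0"
proof -
  have "conv_radius c \<ge> 1"
  proof (rule conv_radius_geI_ex)
    fix r :: real assume "0 < r" "ereal r < 1"
    then show "\<exists>z. norm z = r \<and> summable (\<lambda>n. c n * z ^ n)"
      using assms[of "of_real r"] by (intro exI[of _ "of_real r"]) (auto simp: sums_iff)
  qed
  then have r: "fps_conv_radius (Abs_fps c) > 0"
    by (auto simp: fps_conv_radius_def intro: less_le_trans[of 0 1])
  have "Abs_fps c = 0"
  proof (rule eval_fps_eqD)
    show "\<forall>\<^sub>F z in nhds 0. eval_fps (Abs_fps c) z = eval_fps 0 z"
      using eventually_nhds_in_open[of "ball 0 1" "0 :: complex"]
      by (rule eventually_mono) (use assms in \<open>auto simp: eval_fps_def sums_iff\<close>)
  qed (use r in auto)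
  then show ?thesis by (metis fps_nth_Abs_fps fps_zero_nth)
qed

lemma zcoef_eq_0D:
  assumes "\<And>z. cmod z < 1 \<Longrightarrow> zcoef x n z = 0"
  shows "coef x (m, n) = 0"
proof (rule powser_eq_0D[of "\<lambda>m. coef x (m, n)"])
  fix z :: complex assume "cmod z < 1"
  then show "(\<lambda>m. coef x (m, n) * z ^ m) sums 0"
    using has_sum_imp_sums[OF zcoef_has_sum[of z x n]] assms by simp
qed

text \<open>Uniqueness of power series, used in w for fixed z and then in z for the coefficient
  functions.\<close>

lemma fn_eq_0D:
  assumes "\<And>z w. cmod z < 1 \<Longrightarrow> cmod w < 1 \<Longrightarrow> fn x (z, w) = 0"
  shows "x = 0"
proof (rule hardy_eqI)
  fix m n
  have "zcoef x n z = 0" if "cmod z < 1" for z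
  proof (rule powser_eq_0D[of "\<lambda>n. zcoef x n z"])
    fix w :: complex assume "cmod w < 1"
    then show "(\<lambda>n. zcoef x n z * w ^ n) sums 0"
      using has_sum_imp_sums[OF fn_has_sum_zcoef[OF that, of w x]] assms[OF that] by simp
  qed
  then show "coef x (m, n) = coef 0 (m, n)" using zcoef_eq_0D by simp
qed

lemma fn_eqI:
  assumes "\<And>z w. cmod z < 1 \<Longrightarrow> cmod w < 1 \<Longrightarrow> fn x (z, w) = fn y (z, w)"
  shows "x = y"
  using fn_eq_0D[of "x - y"] assms by simp

lemma inj_fn: "inj fn"
  by (rule injI) (auto intro: fn_eqI)

lemma fn_eq_iff [simp]: "fn x = fn y \<longleftrightarrow> x = y"
  using inj_fn by (auto simp: inj_eq)

lemma holomorphic_zcoef: "zcoef x n holomorphic_on \<D>"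
  by (rule power_series_holomorphic[of 0 1 "\<lambda>m. coef x (m, n)"]) (simp add: has_sum_imp_sums zcoef_has_sum)

lemma holomorphic_fn:
  assumes "cmod z < 1"
  shows "(\<lambda>w. fn x (z, w)) holomorphic_on \<D>"
  by (rule power_series_holomorphic[of 0 1 "\<lambda>n. zcoef x n z"])
    (simp add: has_sum_imp_sums fn_has_sum_zcoef assms)

lemma taylor_rep_fn: "taylor_rep (coef x) (fn x)"
  unfolding taylor_rep_def using coef_summable[of x] fn_has_sum[of _ _ x] fn_outside[of _ x] by auto

lemma taylor_repD:
  assumes "taylor_rep a f"
  shows "f = fn (Hardy a)" "a = coef (Hardy a)"
proof -
  show a: "a = coef (Hardy a)" using assms by (simp add: taylor_rep_def Hardy_inverse)
  show "f = fn (Hardy a)"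
  proof
    fix p
    show "f p = fn (Hardy a) p"
    proof (cases "p \<in> \<D>\<^sup>2")
      case True
      then obtain z w where p: "p = (z, w)" "cmod z < 1" "cmod w < 1" by auto
      then have "((\<lambda>(m, n). a (m, n) * z ^ m * w ^ n) has_sum f (z, w)) UNIV"
        using assms by (auto simp: taylor_rep_def)
      moreover have "((\<lambda>(m, n). a (m, n) * z ^ m * w ^ n) has_sum fn (Hardy a) (z, w)) UNIV"
        using fn_has_sum[OF p(2,3), of "Hardy a"] unfolding a[symmetric] .
      ultimately show ?thesis unfolding p(1) by (rule has_sum_unique)
    next
      case False
      then show ?thesis using assms fn_outside[OF False] unfolding taylor_rep_def by metis
    qed
  qed
qed

lemma H2_eq: "H2 = range fn"
  using taylor_rep_fn taylor_repD(1) by (force simp: H2_def)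

lemma taylor_coeff_fn [simp]: "taylor_coeff (fn x) = coef x"
  unfolding taylor_coeff_def
proof (rule the_equality)
  show "a = coef x" if "taylor_rep a (fn x)" for a
    using taylor_repD(1)[OF that] taylor_repD(2)[OF that, symmetric] by simp
qed (rule taylor_rep_fn)

lemma h2_inner_fn [simp]: "h2_inner (fn x) (fn y) = hinner x y"
  by (simp add: h2_inner_def hinner.rep_eq)

lemma h2_norm_fn [simp]: "h2_norm (fn x) = norm x"
  by (simp add: h2_norm_def hinner_self)

lemma mult_z_fn: "mult_z (fn x) = fn (Z x)"
  using fn_shift[of 1 0 x] by (auto simp: mult_z_def fun_eq_iff)

section \<open>Monomial expansions and dilations\<close>

definition one :: hardy where "one = ker 0 0"

lemma coef_one: "coef one (m, n) = (if m = 0 \<and> n = 0 then 1 else 0)"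
  by (simp add: one_def power_0_left)

lemma fn_one: "cmod z < 1 \<Longrightarrow> cmod w < 1 \<Longrightarrow> fn one (z, w) = 1"
proof -
  assume "cmod z < 1" "cmod w < 1"
  then have "fn one (z, w) = cnj (hinner (ker z w) (ker 0 0))"
    by (simp add: fn_def one_def hinner_commute[symmetric])
  also have "hinner (ker z w) (ker 0 0) = fn (ker z w) (0, 0)" by (simp add: fn_def)
  also have "\<dots> = zcoef (ker z w) 0 0"
    using has_sum_unique[OF fn_has_sum_zcoef[of 0 0 "ker z w"] has_sum_finite_neutralI[of "{0}"]]
    by (simp add: power_0_left)
  also have "\<dots> = coef (ker z w) (0, 0)"
    using has_sum_unique[OF zcoef_has_sum[of 0 "ker z w" 0] has_sum_finite_neutralI[of "{0}"]]
    by (simp add: power_0_left)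
  finally show ?thesis using \<open>cmod z < 1\<close> \<open>cmod w < 1\<close> by simp
qed

text \<open>A polynomial with coefficients \<open>c\<close> on \<open>F\<close>, multiplied by
  \<open>x\<close>. For \<open>x = one\<close> these are the dense polynomials; for inner
  \<open>x\<close> they are the images of polynomials under multiplication.\<close>

definition lincomb :: "(nat \<times> nat) set \<Rightarrow> (nat \<times> nat \<Rightarrow> complex) \<Rightarrow> hardy \<Rightarrow> hardy" where
  "lincomb F c x = (\<Sum>k\<in>F. cs (c k) (shift k x))"

lemma norm_lincomb:
  assumes "finite F" "\<And>i j. hinner (shift i x) (shift j x) = (if i = j then 1 else 0)"
  shows "(norm (lincomb F c x))\<^sup>2 = (\<Sum>k\<in>F. (cmod (c k))\<^sup>2)"
proof -
  have l: "hinner (\<Sum>k\<in>F. v k) y = (\<Sum>k\<in>F. hinner (v k) y)"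
    and r: "hinner y (\<Sum>k\<in>F. v k) = (\<Sum>k\<in>F. hinner y (v k))" for v y
    using assms(1) by (induction F) (auto simp: hinner_algebra)
  have "complex_of_real ((norm (lincomb F c x))\<^sup>2) = (\<Sum>i\<in>F. \<Sum>j\<in>F. cnj (c i) * (c j * (if j = i then 1 else 0)))"
    unfolding hinner_self[symmetric] lincomb_def l r by (simp add: assms(2))
  also have "\<dots> = (\<Sum>i\<in>F. c i * cnj (c i))"
    using assms(1) by (intro sum.cong refl) (simp add: if_distrib cong: if_cong)
  also have "\<dots> = complex_of_real (\<Sum>k\<in>F. (cmod (c k))\<^sup>2)"
    by (simp add: complex_norm_square del: of_real_power)
  finally show ?thesis using of_real_eq_iff by blast
qed

lemma hinner_shift_one: "hinner (shift i one) (shift j one) = (if i = j then 1 else 0)"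
proof -
  have "hinner (shift i one) (shift j one) = (\<Sum>\<^sub>\<infinity>k. if k = i then (if i = j then 1 else 0) else 0)"
    unfolding hinner.rep_eq
    by (intro infsum_cong) (cases i; cases j; auto simp: coef_shift coef_one split: if_splits)
  also have "\<dots> = (if i = j then 1 else 0)"
    by (rule infsumI, rule has_sum_finite_neutralI[of "{i}"]) auto
  finally show ?thesis .
qed

lemma coef_shift_one: "coef (shift j one) k = (if j = k then 1 else 0)"
  by (cases j; cases k) (auto simp: coef_shift coef_one)

lemma coef_lincomb_one: "finite F \<Longrightarrow> coef (lincomb F c one) k = (if k \<in> F then c k else 0)"
proof -
  assume F: "finite F"
  have "coef (lincomb F c one) k = (\<Sum>j\<in>F. c j * coef (shift j one) k)"
    unfolding lincomb_def using F by (induction F) auto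
  also have "\<dots> = (\<Sum>j\<in>F. if j = k then c k else 0)"
    by (intro sum.cong refl) (auto simp: coef_shift_one)
  finally show ?thesis using F by simp
qed

definition box :: "nat \<Rightarrow> (nat \<times> nat) set" where "box N = {..<N} \<times> {..<N}"

lemma finite_box [simp]: "finite (box N)" by (simp add: box_def)

lemma box_mono: "M \<le> N \<Longrightarrow> box M \<subseteq> box N" by (auto simp: box_def)

text \<open>Squares exhaust the index set, so unconditional sums become limits of sequences, as
  dominated convergence requires.\<close>

lemma filterlim_box: "filterlim box (finite_subsets_at_top UNIV) sequentially"
  unfolding filterlim_finite_subsets_at_top
proof safe
  fix F :: "(nat \<times> nat) set" assume "finite F"
  then have "finite (fst ` F \<union> snd ` F)" by simp
  then obtain N where "\<forall>i\<in>fst ` F \<union> snd ` F. i < N"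
    unfolding finite_nat_set_iff_bounded ..
  then have N: "i < N" if "i \<in> fst ` F \<union> snd ` F" for i using that by (rule bspec)
  have "F \<subseteq> box n" if "n \<ge> N" for n
  proof
    fix k assume "k \<in> F"
    then have "fst k < N" "snd k < N" using N by auto
    then show "k \<in> box n" using that by (auto simp: box_def mem_Times_iff)
  qed
  then show "\<forall>\<^sub>F n in sequentially. finite (box n) \<and> F \<subseteq> box n \<and> box n \<subseteq> UNIV"
    by (intro eventually_sequentiallyI[of N]) auto
qed

lemma has_sum_box: "(f has_sum s) UNIV \<Longrightarrow> (\<lambda>N. sum f (box N)) \<longlonglongrightarrow> s"
  unfolding has_sum_def by (rule filterlim_compose[OF _ filterlim_box])

lemma lincomb_one_tendsto: "(\<lambda>N. lincomb (box N) (coef x) one) \<longlonglongrightarrow> x"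
proof -
  have n: "(norm (lincomb (box N) (coef x) one - x))\<^sup>2 = (norm x)\<^sup>2 - (\<Sum>k\<in>box N. (cmod (coef x k))\<^sup>2)" for N
  proof -
    have "((\<lambda>k. (cmod (coef x k))\<^sup>2 + (if k \<in> box N then - (cmod (coef x k))\<^sup>2 else 0)) has_sum
        ((norm x)\<^sup>2 + (\<Sum>k\<in>box N. - (cmod (coef x k))\<^sup>2))) UNIV"
      by (intro has_sum_add norm_has_sum has_sum_finite_neutralI[of "box N"]) auto
    moreover have "(\<lambda>k. (cmod (coef x k))\<^sup>2 + (if k \<in> box N then - (cmod (coef x k))\<^sup>2 else 0)) =
        (\<lambda>k. (cmod (coef (lincomb (box N) (coef x) one - x) k))\<^sup>2)"
      by (auto simp: coef_lincomb_one fun_eq_iff)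
    ultimately have "((\<lambda>k. (cmod (coef (lincomb (box N) (coef x) one - x) k))\<^sup>2) has_sum
        ((norm x)\<^sup>2 - (\<Sum>k\<in>box N. (cmod (coef x k))\<^sup>2))) UNIV"
      by (simp add: sum_negf)
    from has_sum_unique[OF norm_has_sum this] show ?thesis .
  qed
  have "(\<lambda>N. (norm x)\<^sup>2 - (\<Sum>k\<in>box N. (cmod (coef x k))\<^sup>2)) \<longlonglongrightarrow> (norm x)\<^sup>2 - (norm x)\<^sup>2"
    by (intro tendsto_diff tendsto_const has_sum_box norm_has_sum)
  then have "(\<lambda>N. (norm (lincomb (box N) (coef x) one - x))\<^sup>2) \<longlonglongrightarrow> 0" unfolding n by simp
  then have "(\<lambda>N. norm (lincomb (box N) (coef x) one - x)) \<longlonglongrightarrow> 0"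
    using tendsto_real_sqrt by fastforce
  then show ?thesis by (simp add: tendsto_norm_zero_iff LIM_zero_iff)
qed

text \<open>The coefficients of f(r z, r w). Clamping \<open>r\<close> to [0, 1] keeps them square
  summable for every real \<open>r\<close>.\<close>

lift_definition dilate :: "real \<Rightarrow> hardy \<Rightarrow> hardy" is
  "\<lambda>r a k. of_real (max 0 (min 1 r) ^ (fst k + snd k)) * a k"
proof -
  fix r :: real and a :: "nat \<times> nat \<Rightarrow> complex"
  assume *: "(\<lambda>k. (cmod (a k))\<^sup>2) summable_on UNIV"
  show "(\<lambda>k. (cmod (of_real (max 0 (min 1 r) ^ (fst k + snd k)) * a k))\<^sup>2) summable_on UNIV"
    by (rule summable_on_comparison_test[OF *])
      (auto simp: norm_mult norm_power intro!: power_mono mult_left_le_one_le power_le_one)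
qed

lemma coef_dilate: "0 \<le> r \<Longrightarrow> r \<le> 1 \<Longrightarrow> coef (dilate r x) k = of_real r ^ (fst k + snd k) * coef x k"
  by (simp add: dilate.rep_eq max_def min_def)

lemma dilate_diff: "dilate r (x - y) = dilate r x - dilate r y"
  by transfer (simp add: fun_eq_iff algebra_simps)

lemma norm_dilate: "norm (dilate r x) \<le> norm x"
proof -
  have "(norm (dilate r x))\<^sup>2 \<le> (norm x)\<^sup>2"
    by (rule has_sum_mono[OF norm_has_sum norm_has_sum])
      (auto simp: dilate.rep_eq norm_mult norm_power intro!: power_mono mult_left_le_one_le power_le_one)
  then show ?thesis by (simp add: power2_le_iff_abs_le)
qed

text \<open>Radii tending to 1 from below; the offset 2 keeps \<open>rad 0\<close> positive.\<close>

definition rad :: "nat \<Rightarrow> real" where "rad n = 1 - 1 / real (n + 2)"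

lemma rad_bounds: "0 < rad n" "rad n < 1"
  by (auto simp: rad_def field_simps)

lemma rad_tendsto: "rad \<longlonglongrightarrow> 1"
proof -
  have "(\<lambda>n. 1 / real (n + 2)) \<longlonglongrightarrow> 0"
    using LIMSEQ_ignore_initial_segment[OF lim_1_over_n, of 2] by simp
  from tendsto_diff[OF tendsto_const[of 1] this] show ?thesis by (simp add: rad_def[abs_def])
qed

lemma dilate_lincomb_tendsto:
  assumes "finite F"
  shows "(\<lambda>n. dilate (rad n) (lincomb F c one)) \<longlonglongrightarrow> lincomb F c one"
proof -
  have "dilate (rad n) (lincomb F c one) = lincomb F (\<lambda>k. of_real (rad n) ^ (fst k + snd k) * c k) one" for n
    using assms rad_bounds[of n]
    by (intro hardy_eqI) (simp add: coef_dilate coef_lincomb_one)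
  moreover have "(\<lambda>n. lincomb F (\<lambda>k. of_real (rad n) ^ (fst k + snd k) * c k) one - lincomb F c one) \<longlonglongrightarrow> 0"
  proof -
    have d: "lincomb F a one - lincomb F b one = lincomb F (\<lambda>k. a k - b k) one" for a b
      using assms by (intro hardy_eqI) (simp add: coef_lincomb_one)
    have "(\<lambda>n. \<Sum>k\<in>F. (cmod (of_real (rad n) ^ (fst k + snd k) * c k - c k))\<^sup>2) \<longlonglongrightarrow>
        (\<Sum>k\<in>F. (cmod (of_real 1 ^ (fst k + snd k) * c k - c k))\<^sup>2)"
      by (intro tendsto_intros rad_tendsto)
    then have "(\<lambda>n. (norm (lincomb F (\<lambda>k. of_real (rad n) ^ (fst k + snd k) * c k) one - lincomb F c one))\<^sup>2) \<longlonglongrightarrow> 0"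
      unfolding d norm_lincomb[OF assms hinner_shift_one] by simp
    then have "(\<lambda>n. norm (lincomb F (\<lambda>k. of_real (rad n) ^ (fst k + snd k) * c k) one - lincomb F c one)) \<longlonglongrightarrow> 0"
      using tendsto_real_sqrt by fastforce
    then show ?thesis by (simp add: tendsto_norm_zero_iff)
  qed
  ultimately show ?thesis by (simp add: LIM_zero_iff)
qed

text \<open>Dilations are contractions, so convergence passes from the dense polynomials, where it
  is coefficientwise, to every element.\<close>

lemma dilate_tendsto: "(\<lambda>n. dilate (rad n) x) \<longlonglongrightarrow> x"
proof (rule metric_LIMSEQ_I)
  fix e :: real assume "e > 0"
  obtain N where N: "norm (lincomb (box N) (coef x) one - x) < e / 3"
    using metric_LIMSEQ_D[OF lincomb_one_tendsto[of x], of "e / 3"] \<open>e > 0\<close> by (auto simp: dist_norm)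
  define y where "y = lincomb (box N) (coef x) one"
  obtain n0 where n0: "\<And>n. n \<ge> n0 \<Longrightarrow> norm (dilate (rad n) y - y) < e / 3"
    using metric_LIMSEQ_D[OF dilate_lincomb_tendsto[OF finite_box, of N "coef x"], of "e / 3"] \<open>e > 0\<close>
    by (auto simp: dist_norm y_def)
  have "dist (dilate (rad n) x) x < e" if "n \<ge> n0" for n
  proof -
    have "dilate (rad n) x - x = (dilate (rad n) y - y) + (y - x) - dilate (rad n) (y - x)"
      by (simp add: dilate_diff)
    then have "norm (dilate (rad n) x - x) \<le> norm (dilate (rad n) y - y) + norm (y - x) + norm (dilate (rad n) (y - x))"
      by (metis norm_triangle_ineq norm_triangle_ineq4 add_right_mono order_trans)
    then show ?thesis
      using n0[OF that] N norm_dilate[of "rad n" "y - x"] by (simp add: y_def dist_norm)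
  qed
  then show "\<exists>n0. \<forall>n\<ge>n0. dist (dilate (rad n) x) x < e" by blast
qed

section \<open>The torus\<close>

text \<open>Normalised to mass 1, so that the characters are orthonormal.\<close>

definition ang :: "real measure" where
  "ang = density lborel (\<lambda>s. ennreal (indicator {0..2*pi} s / (2*pi)))"

lemma sets_ang [measurable_cong, simp]: "sets ang = sets borel" and space_ang [simp]: "space ang = UNIV"
  by (simp_all add: ang_def)

lemma integral_ang: "f \<in> borel_measurable borel \<Longrightarrow>
    integral\<^sup>L ang f = (LINT s|lborel. indicator {0..2*pi} s *\<^sub>R (f s / (2*pi)))" for f :: "real \<Rightarrow> complex"
  unfolding ang_def
  by (subst integral_density) (auto simp: scaleR_conv_of_real intro!: Bochner_Integration.integral_cong split: split_indicator)

lemma emeasure_ang: "emeasure ang UNIV = 1"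
proof -
  have "emeasure ang UNIV = (\<integral>\<^sup>+ s. ennreal (1 / (2*pi)) * indicator {0..2*pi} s \<partial>lborel)"
    unfolding ang_def by (subst emeasure_density) (auto intro!: nn_integral_cong split: split_indicator)
  also have "\<dots> = ennreal (1 / (2*pi)) * ennreal (2*pi)"
    by (subst nn_integral_cmult_indicator) auto
  also have "\<dots> = 1" by (subst ennreal_mult[symmetric]) auto
  finally show ?thesis .
qed

interpretation ang: finite_measure ang
  by (rule finite_measureI) (simp add: emeasure_ang)

lemma integral_ang_cis:
  "(LINT s|ang. cis (real m * s) * cnj (cis (real n * s))) = (if m = n then 1 else 0)"
proof -
  define d where "d = real m - real n"
  have e: "cis (real m * s) * cnj (cis (real n * s)) = exp (\<i> * d * s)" for s
    by (simp add: d_def cis_conv_exp exp_cnj exp_add[symmetric] algebra_simps flip: exp_minus)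
  show ?thesis
  proof (cases "m = n")
    case True
    have "measure ang UNIV = 1" by (simp add: measure_def emeasure_ang)
    then have "(LINT s|ang. exp (\<i> * d * s)) = 1" using True by (simp add: d_def)
    then show ?thesis using True unfolding e by simp
  next
    case False
    then have d: "d \<noteq> 0" by (simp add: d_def)
    define F where "F = (\<lambda>s::real. exp (\<i> * d * s) / (\<i> * d) / (2 * pi))"
    have "(LINT s|ang. exp (\<i> * d * s)) = (LINT s|lborel. indicator {0..2*pi} s *\<^sub>R (exp (\<i> * d * s) / (2*pi)))"
      by (subst integral_ang) (auto intro!: borel_measurable_continuous_onI continuous_intros)
    also have "\<dots> = F (2 * pi) - F 0"
    proof (rule integral_FTC_atLeastAtMost)
      fix x :: real
      have "((\<lambda>s. exp (\<i> * d * s) / (\<i> * d) / (2 * pi)) has_field_derivative (exp (\<i> * d * x) / (2*pi))) (at (complex_of_real x))"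
        using d by (auto intro!: derivative_eq_intros simp: field_simps)
      then show "(F has_vector_derivative exp (\<i> * d * x) / (2*pi)) (at x within {0..2*pi})"
        unfolding F_def by (rule has_vector_derivative_real_field)
    qed (auto intro!: continuous_intros)
    also have "\<dots> = 0"
    proof -
      have "exp (\<i> * d * complex_of_real (2 * pi)) = 1"
        unfolding e[symmetric] using cis_multiple_2pi[of "real m"] cis_multiple_2pi[of "real n"]
        by (simp add: mult.commute)
      then show ?thesis by (simp add: F_def)
    qed
    finally show ?thesis using False unfolding e by simp
  qed
qed

definition tor :: "(real \<times> real) measure" where "tor = ang \<Otimes>\<^sub>M ang"

lemma sets_tor [measurable_cong, simp]: "sets tor = sets borel" and space_tor [simp]: "space tor = UNIV"
proof -
  have "sets tor = sets (borel \<Otimes>\<^sub>M borel :: (real \<times> real) measure)"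
    unfolding tor_def by (rule sets_pair_measure_cong) simp_all
  then show "sets tor = sets borel" by (simp only: borel_prod)
  show "space tor = UNIV" by (simp add: tor_def space_pair_measure)
qed

interpretation tor: finite_measure tor
proof (rule finite_measureI)
  have "emeasure tor (UNIV \<times> UNIV) = 1"
    unfolding tor_def by (subst ang.emeasure_pair_measure_Times) (auto simp: emeasure_ang)
  then show "emeasure tor (space tor) \<noteq> \<infinity>" by simp
qed

lemma AE_densityI: "f \<in> borel_measurable M \<Longrightarrow> AE x in M. P x \<Longrightarrow> AE x in density M f. P x"
  by (subst AE_density) auto

text \<open>The torus measure has a density with respect to planar Lebesgue measure, so the almost
  everywhere hypothesis on inner functions passes to it.\<close>

lemma AE_tor:
  assumes "AE p in (lborel :: (real \<times> real) measure). P p"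
  shows "AE p in tor. P p"
proof -
  have tor: "tor = density (lborel \<Otimes>\<^sub>M lborel) (\<lambda>(x, y). ennreal (indicator {0..2*pi} x / (2*pi)) * ennreal (indicator {0..2*pi} y / (2*pi)))"
    unfolding tor_def ang_def
    by (intro pair_measure_density) (auto intro: sigma_finite_lborel ang.sigma_finite_measure_axioms[unfolded ang_def])
  show ?thesis
    unfolding tor
    by (rule AE_densityI) (use assms in \<open>measurable, simp only: lborel_prod\<close>)
qed

lemma measurable_cnj [measurable (raw)]:
  "f \<in> borel_measurable M \<Longrightarrow> (\<lambda>x. cnj (f x)) \<in> borel_measurable M"
  by (rule borel_measurable_continuous_on[of cnj]) (auto intro!: continuous_intros)

definition echar :: "nat \<times> nat \<Rightarrow> real \<times> real \<Rightarrow> complex" where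
  "echar k p = cis (real (fst k) * fst p) * cis (real (snd k) * snd p)"

lemma echar_power: "echar (m, n) p = cis (fst p) ^ m * cis (snd p) ^ n"
  by (simp add: echar_def Complex.DeMoivre)

lemma continuous_echar: "continuous_on UNIV (echar k)"
  unfolding echar_def by (intro continuous_intros continuous_on_cis)

lemma measurable_echar [measurable]: "echar k \<in> borel_measurable borel"
  by (rule borel_measurable_continuous_onI[OF continuous_echar])

lemma norm_echar [simp]: "cmod (echar k p) = 1"
  by (simp add: echar_def norm_mult)

lemma integral_echar: "(LINT p|tor. echar j p * cnj (echar k p)) = (if j = k then 1 else 0)"
proof -
  interpret pair_sigma_finite ang ang ..
  have "integrable tor (\<lambda>p. echar j p * cnj (echar k p))"
    by (rule tor.integrable_const_bound[where B = 1]) (auto simp: norm_mult)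
  then have "(LINT p|tor. echar j p * cnj (echar k p)) =
      (LINT s|ang. LINT u|ang. echar j (s, u) * cnj (echar k (s, u)))"
    unfolding tor_def by (rule integral_fst'[symmetric])
  also have "\<dots> = (LINT s|ang. LINT u|ang. (cis (real (fst j) * s) * cnj (cis (real (fst k) * s))) *
       (cis (real (snd j) * u) * cnj (cis (real (snd k) * u))))"
    by (simp add: echar_def algebra_simps)
  also have "\<dots> = (if j = k then 1 else 0)"
    by (simp only: integral_mult_right_zero integral_mult_left_zero integral_ang_cis) (simp add: prod_eq_iff)
  finally show ?thesis .
qed

definition torfn :: "hardy \<Rightarrow> real \<Rightarrow> real \<times> real \<Rightarrow> complex" where
  "torfn x r p = fn x (of_real r * cis (fst p), of_real r * cis (snd p))"

lemma torfn_has_sum: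
  assumes "0 \<le> r" "r < 1"
  shows "((\<lambda>k. coef (dilate r x) k * echar k p) has_sum torfn x r p) UNIV"
proof -
  have "((\<lambda>(m, n). coef x (m, n) * (of_real r * cis (fst p)) ^ m * (of_real r * cis (snd p)) ^ n) has_sum torfn x r p) UNIV"
    unfolding torfn_def by (rule fn_has_sum) (use assms in \<open>auto simp: norm_mult\<close>)
  also have "(\<lambda>(m, n). coef x (m, n) * (of_real r * cis (fst p)) ^ m * (of_real r * cis (snd p)) ^ n) =
      (\<lambda>k. coef (dilate r x) k * echar k p)"
    using assms by (auto simp: fun_eq_iff coef_dilate echar_power power_mult_distrib power_add)
  finally show ?thesis .
qed

text \<open>The kernel at (r, r) has coefficients r^(m+n), so this is the absolute convergence of an
  inner product.\<close>

lemma dilate_abs_summable: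
  assumes "0 \<le> r" "r < 1"
  shows "(\<lambda>k. cmod (coef (dilate r x) k)) summable_on UNIV"
proof -
  have "(\<lambda>k. norm (coef x k * cnj (coef (ker (of_real r) (of_real r)) k))) summable_on UNIV"
    by (rule hinner_abs_summable)
  then show ?thesis using assms
    by (simp add: coef_dilate coef_ker' norm_mult norm_power power_add mult.commute)
qed

lemma torfn_parseval:
  assumes "0 \<le> r" "r < 1" "0 \<le> r'" "r' < 1"
  shows "torfn x r \<in> borel_measurable borel"
    and "bounded (range (torfn x r))"
    and "(LINT p|tor. torfn x r p * cnj (torfn y r' p)) = hinner (dilate r x) (dilate r' y)"
proof -
  define s where "s = (\<lambda>x r N p. \<Sum>k\<in>box N. coef (dilate r x) k * echar k p)"
  define C where "C = (\<lambda>x r. \<Sum>\<^sub>\<infinity>k. cmod (coef (dilate r x) k))"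
  have lim: "(\<lambda>N. s x r N p) \<longlonglongrightarrow> torfn x r p" if "0 \<le> r" "r < 1" for x r p
    unfolding s_def by (rule has_sum_box[OF torfn_has_sum[OF that]])
  have meas: "s x r N \<in> borel_measurable borel" for x r N
    unfolding s_def by measurable
  have bnd: "cmod (s x r N p) \<le> C x r" if "0 \<le> r" "r < 1" for x r N p
  proof -
    have "cmod (s x r N p) \<le> (\<Sum>k\<in>box N. cmod (coef (dilate r x) k))"
      unfolding s_def by (rule order_trans[OF norm_sum]) (simp add: norm_mult)
    also have "\<dots> \<le> C x r"
      unfolding C_def by (rule finite_sum_le_infsum[OF dilate_abs_summable[OF that]]) auto
    finally show ?thesis .
  qed
  have m: "torfn x r \<in> borel_measurable borel" if "0 \<le> r" "r < 1" for x r
    by (rule borel_measurable_LIMSEQ_metric[OF meas lim[OF that]])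
  show "torfn x r \<in> borel_measurable borel" by (rule m[OF assms(1,2)])
  have b: "cmod (torfn x r p) \<le> C x r" if "0 \<le> r" "r < 1" for x r p
    by (rule tendsto_upperbound[OF tendsto_norm[OF lim[OF that]]]) (use bnd[OF that] in auto)
  then show "bounded (range (torfn x r))" unfolding bounded_iff using assms(1,2) by (intro exI[of _ "C x r"]) auto
  have "(\<lambda>N. LINT p|tor. s x r N p * cnj (s y r' N p)) \<longlonglongrightarrow> (LINT p|tor. torfn x r p * cnj (torfn y r' p))"
  proof (rule integral_dominated_convergence)
    show "integrable tor (\<lambda>_. C x r * C y r')" by simp
    show "AE p in tor. (\<lambda>N. s x r N p * cnj (s y r' N p)) \<longlonglongrightarrow> torfn x r p * cnj (torfn y r' p)"
      by (intro AE_I2 tendsto_intros lim assms)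
    fix N
    have "0 \<le> C x r" by (rule order_trans[OF norm_ge_zero bnd[OF assms(1,2), of x 0]])
    then show "AE p in tor. norm (s x r N p * cnj (s y r' N p)) \<le> C x r * C y r'"
      using bnd assms by (intro AE_I2) (auto simp: norm_mult intro!: mult_mono)
    show "(\<lambda>p. s x r N p * cnj (s y r' N p)) \<in> borel_measurable tor"
      using meas[of x r N] meas[of y r' N] by measurable
    show "(\<lambda>p. torfn x r p * cnj (torfn y r' p)) \<in> borel_measurable tor"
      using m[of r x] m[of r' y] assms by measurable
  qed
  moreover have "(LINT p|tor. s x r N p * cnj (s y r' N p)) = (\<Sum>k\<in>box N. coef (dilate r x) k * cnj (coef (dilate r' y) k))" for N
  proof -
    have int: "integrable tor (\<lambda>p. echar j p * cnj (echar k p))" for j k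
      by (rule tor.integrable_const_bound[where B = 1]) (auto simp: norm_mult)
    have "(LINT p|tor. s x r N p * cnj (s y r' N p)) =
        (LINT p|tor. (\<Sum>j\<in>box N. \<Sum>k\<in>box N. (coef (dilate r x) j * cnj (coef (dilate r' y) k)) * (echar j p * cnj (echar k p))))"
      unfolding s_def cnj_sum sum_product by (simp add: algebra_simps)
    also have "\<dots> = (\<Sum>j\<in>box N. \<Sum>k\<in>box N. (coef (dilate r x) j * cnj (coef (dilate r' y) k)) * (if j = k then 1 else 0))"
      using int by (simp add: integral_echar)
    also have "\<dots> = (\<Sum>k\<in>box N. coef (dilate r x) k * cnj (coef (dilate r' y) k))"
      by (intro sum.cong refl) (simp add: if_distrib cong: if_cong)
    finally show ?thesis .
  qed
  ultimately have "(\<lambda>N. \<Sum>k\<in>box N. coef (dilate r x) k * cnj (coef (dilate r' y) k)) \<longlonglongrightarrow> (LINT p|tor. torfn x r p * cnj (torfn y r' p))"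
    by simp
  then show "(LINT p|tor. torfn x r p * cnj (torfn y r' p)) = hinner (dilate r x) (dilate r' y)"
    by (rule LIMSEQ_unique[OF _ has_sum_box[OF hinner_has_sum]])
qed

lemma torfn_shift:
  assumes "0 \<le> r" "r < 1"
  shows "torfn (shift k x) r p = of_real r ^ (fst k + snd k) * (echar k p * torfn x r p)"
  using fn_shift[of "fst k" "snd k" x "of_real r * cis (fst p)" "of_real r * cis (snd p)"]
    echar_power[of "fst k" "snd k" p]
  by (simp add: torfn_def power_mult_distrib power_add)

lemma integrable_torfn:
  assumes "0 \<le> r" "r < 1" "0 \<le> r'" "r' < 1" "f \<in> borel_measurable borel" "\<And>p. cmod (f p) \<le> B"
  shows "integrable tor (\<lambda>p. f p * (torfn x r p * cnj (torfn y r' p)))"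
proof -
  obtain C where C: "cmod (torfn x r p) \<le> C" for p
    using torfn_parseval(2)[OF assms(1-4), of x] unfolding bounded_iff by blast
  obtain D where D: "cmod (torfn y r' p) \<le> D" for p
    using torfn_parseval(2)[OF assms(3,4,1,2), of y] unfolding bounded_iff by blast
  have nn: "0 \<le> B" "0 \<le> C" "0 \<le> D"
    using order_trans[OF norm_ge_zero assms(6)] order_trans[OF norm_ge_zero C] order_trans[OF norm_ge_zero D] by auto
  show ?thesis
  proof (rule tor.integrable_const_bound[where B = "B * (C * D)"])
    show "AE p in tor. cmod (f p * (torfn x r p * cnj (torfn y r' p))) \<le> B * (C * D)"
      using nn by (intro AE_I2) (auto simp: norm_mult intro!: mult_mono assms C D)
    show "(\<lambda>p. f p * (torfn x r p * cnj (torfn y r' p))) \<in> borel_measurable tor"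
      using torfn_parseval(1)[OF assms(1-4)] torfn_parseval(1)[OF assms(3,4,1,2)] assms(5) by measurable
  qed
qed

lemma integral_norm_torfn_square:
  assumes "0 \<le> r" "r < 1"
  shows "integrable tor (\<lambda>p. (cmod (torfn x r p))\<^sup>2)"
    and "(LINT p|tor. (cmod (torfn x r p))\<^sup>2) = (norm (dilate r x))\<^sup>2"
proof -
  have i: "integrable tor (\<lambda>p. torfn x r p * cnj (torfn x r p))"
    using integrable_torfn[OF assms assms, of "\<lambda>_. 1" 1 x x] by simp
  have c: "torfn x r p * cnj (torfn x r p) = of_real ((cmod (torfn x r p))\<^sup>2)" for p
    by (simp only: complex_norm_square)
  from i show int: "integrable tor (\<lambda>p. (cmod (torfn x r p))\<^sup>2)"
    unfolding c using integrable_Re by fastforce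
  have "complex_of_real (LINT p|tor. (cmod (torfn x r p))\<^sup>2) = of_real ((norm (dilate r x))\<^sup>2)"
    using torfn_parseval(3)[OF assms assms, of x x] unfolding c hinner_self
    by (simp only: integral_complex_of_real)
  then show "(LINT p|tor. (cmod (torfn x r p))\<^sup>2) = (norm (dilate r x))\<^sup>2" by (simp only: of_real_eq_iff)
qed

lemma integral_norm_torfn_diff_square:
  assumes "0 \<le> r" "r < 1" "0 \<le> r'" "r' < 1"
  shows "integrable tor (\<lambda>p. (cmod (torfn x r p - torfn x r' p))\<^sup>2)"
    and "(LINT p|tor. (cmod (torfn x r p - torfn x r' p))\<^sup>2) = (norm (dilate r x - dilate r' x))\<^sup>2"
proof -
  have i: "integrable tor (\<lambda>p. torfn x a p * cnj (torfn x b p))" if "0 \<le> a" "a < 1" "0 \<le> b" "b < 1" for a b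
    using integrable_torfn[OF that, of "\<lambda>_. 1" 1 x x] by simp
  have c: "of_real ((cmod (torfn x r p - torfn x r' p))\<^sup>2) =
     (torfn x r p * cnj (torfn x r p) - torfn x r p * cnj (torfn x r' p)) -
     (torfn x r' p * cnj (torfn x r p) - torfn x r' p * cnj (torfn x r' p))" for p
    unfolding complex_norm_square by (simp add: algebra_simps)
  have ic: "integrable tor (\<lambda>p. complex_of_real ((cmod (torfn x r p - torfn x r' p))\<^sup>2))"
    unfolding c by (intro Bochner_Integration.integrable_diff i assms)
  then show "integrable tor (\<lambda>p. (cmod (torfn x r p - torfn x r' p))\<^sup>2)"
    using integrable_Re by fastforce
  have "complex_of_real (LINT p|tor. (cmod (torfn x r p - torfn x r' p))\<^sup>2) =
      (LINT p|tor. complex_of_real ((cmod (torfn x r p - torfn x r' p))\<^sup>2))"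
    by (simp only: integral_complex_of_real)
  also have "\<dots> = hinner (dilate r x - dilate r' x) (dilate r x - dilate r' x)"
    unfolding c using i assms
    by (simp add: torfn_parseval(3) hinner_algebra)
  also have "\<dots> = of_real ((norm (dilate r x - dilate r' x))\<^sup>2)" by (rule hinner_self)
  finally show "(LINT p|tor. (cmod (torfn x r p - torfn x r' p))\<^sup>2) = (norm (dilate r x - dilate r' x))\<^sup>2"
    by (simp only: of_real_eq_iff)
qed

text \<open>Weighted AM-GM replaces the Cauchy-Schwarz inequality in the space of square-integrable functions.\<close>

lemma integral_torfn_square_diff_le:
  fixes t :: hardy
  assumes "e > 0"
  defines "F \<equiv> \<lambda>m. torfn t (rad m)"
  shows "(\<integral>\<^sup>+ p. ennreal \<bar>(cmod (F m p))\<^sup>2 - (cmod (F n p))\<^sup>2\<bar> \<partial>tor) \<le>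
    ennreal ((norm (dilate (rad m) t - dilate (rad n) t))\<^sup>2 / e + 4 * e * (norm t)\<^sup>2)"
proof -
  have r: "0 \<le> rad k" "rad k < 1" for k using rad_bounds[of k] by auto
  define g where "g = (\<lambda>p. (cmod (F m p - F n p))\<^sup>2 / e + 2 * e * ((cmod (F m p))\<^sup>2 + (cmod (F n p))\<^sup>2))"
  have int: "integrable tor g"
    unfolding g_def F_def
    by (intro Bochner_Integration.integrable_add integrable_mult_right integrable_divide
        integral_norm_torfn_square integral_norm_torfn_diff_square r)
  have "(\<integral>\<^sup>+ p. ennreal \<bar>(cmod (F m p))\<^sup>2 - (cmod (F n p))\<^sup>2\<bar> \<partial>tor) \<le> (\<integral>\<^sup>+ p. ennreal (g p) \<partial>tor)"
  proof (intro nn_integral_mono ennreal_leI)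
    fix p
    define a b d where "a = cmod (F m p)" and "b = cmod (F n p)" and "d = cmod (F m p - F n p)"
    have nn: "0 \<le> a" "0 \<le> b" "0 \<le> d" by (auto simp: a_def b_def d_def)
    have "\<bar>a - b\<bar> \<le> d" unfolding a_def b_def d_def by (rule norm_triangle_ineq3)
    have "\<bar>a\<^sup>2 - b\<^sup>2\<bar> = \<bar>a - b\<bar> * (a + b)"
      using nn by (simp add: power2_eq_square abs_mult square_diff_square_factored mult.commute)
    also have "\<dots> \<le> d * (a + b)" using \<open>\<bar>a - b\<bar> \<le> d\<close> nn by (intro mult_right_mono) auto
    also have "\<dots> \<le> d\<^sup>2 / e + e * (a + b)\<^sup>2"
    proof -
      \<comment> \<open>The square contains the cross term \<open>d * e * (a + b)\<close> twice with
        a minus sign; one copy is added back so that division by \<open>e\<close> leaves it exactly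
        once.\<close>
      have "0 \<le> (d - e * (a + b))\<^sup>2 + d * e * (a + b)" using nn assms(1) by auto
      then have "0 \<le> ((d - e * (a + b))\<^sup>2 + d * e * (a + b)) / e" using assms(1) by simp
      also have "\<dots> = d\<^sup>2 / e + e * (a + b)\<^sup>2 - d * (a + b)"
        using assms(1) by (simp add: field_simps power2_eq_square)
      finally show ?thesis by simp
    qed
    also have "\<dots> \<le> d\<^sup>2 / e + e * (2 * (a\<^sup>2 + b\<^sup>2))"
      using assms(1) sum_squares_bound[of a b] by (intro add_left_mono mult_left_mono) (auto simp: power2_sum)
    finally show "\<bar>(cmod (F m p))\<^sup>2 - (cmod (F n p))\<^sup>2\<bar> \<le> g p"
      by (simp add: g_def a_def b_def d_def algebra_simps)
  qed
  also have "\<dots> = ennreal (LINT p|tor. g p)"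
    by (rule nn_integral_eq_integral[OF int]) (use assms(1) in \<open>auto simp: g_def\<close>)
  also have "(LINT p|tor. g p) = (norm (dilate (rad m) t - dilate (rad n) t))\<^sup>2 / e +
      2 * e * ((norm (dilate (rad m) t))\<^sup>2 + (norm (dilate (rad n) t))\<^sup>2)"
    unfolding g_def F_def using integral_norm_torfn_square[OF r] integral_norm_torfn_diff_square[OF r r]
    by simp
  also have "\<dots> \<le> (norm (dilate (rad m) t - dilate (rad n) t))\<^sup>2 / e + 4 * e * (norm t)\<^sup>2"
  proof -
    have "(norm (dilate (rad k) t))\<^sup>2 \<le> (norm t)\<^sup>2" for k by (intro power_mono norm_dilate) auto
    from add_mono[OF this[of m] this[of n]]
    have "(norm (dilate (rad m) t))\<^sup>2 + (norm (dilate (rad n) t))\<^sup>2 \<le> 2 * (norm t)\<^sup>2" by simp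
    from mult_left_mono[OF this, of "2 * e"] assms(1) show ?thesis by simp
  qed
  finally show ?thesis by (simp add: ennreal_leI)
qed

section \<open>From radial limits to an orthonormal system\<close>

text \<open>The Hilbert space form of |t| = 1 almost everywhere on the torus: the Fourier
  coefficients of |t|^2 are those of the constant 1. The multiplication operator is built from this
  property.\<close>

definition inner_elt :: "hardy \<Rightarrow> bool" where
  "inner_elt t \<longleftrightarrow> (\<forall>i j. hinner (shift i t) (shift j t) = (if i = j then 1 else 0))"

lemma nn_integral_Fatou_le:
  assumes [measurable]: "\<And>n. u n \<in> borel_measurable M" "v \<in> borel_measurable M"
    and lim: "AE x in M. (\<lambda>n. u n x) \<longlonglongrightarrow> (v x :: real)"
    and bound: "\<And>n. (\<integral>\<^sup>+ x. ennreal (u n x) \<partial>M) \<le> ennreal (c n)" "c \<longlonglongrightarrow> C"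
  shows "(\<integral>\<^sup>+ x. ennreal (v x) \<partial>M) \<le> ennreal C"
proof -
  have "(\<integral>\<^sup>+ x. ennreal (v x) \<partial>M) = (\<integral>\<^sup>+ x. liminf (\<lambda>n. ennreal (u n x)) \<partial>M)"
    using lim
  proof (intro nn_integral_cong_AE, eventually_elim)
    case (elim x)
    from tendsto_ennrealI[OF elim(2)] have "(\<lambda>n. ennreal (u n x)) \<longlonglongrightarrow> ennreal (v x)" .
    from lim_imp_Liminf[OF _ this] show ?case by simp
  qed
  also have "\<dots> \<le> liminf (\<lambda>n. \<integral>\<^sup>+ x. ennreal (u n x) \<partial>M)"
    by (rule nn_integral_liminf) measurable
  also have "\<dots> \<le> liminf (\<lambda>n. ennreal (c n))"
    by (rule Liminf_mono) (simp add: bound)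
  also have "\<dots> = ennreal C"
    by (rule lim_imp_Liminf) (auto intro: tendsto_ennrealI bound)
  finally show ?thesis .
qed

text \<open>For fixed \<open>m\<close> the second radius goes to 1 first, so Fatou bounds the mean
  distance of |F m|^2 from 1 in terms of the norm of \<open>dilate (rad m) t - t\<close>. Letting
  \<open>m\<close> grow gives convergence in mean, hence against every bounded weight, in particular
  against products of characters.\<close>

lemma inner_function_imp_inner_elt:
  assumes "inner_function (fn t)"
  shows "inner_elt t"
proof -
  have r: "0 \<le> rad k" "rad k < 1" for k using rad_bounds[of k] by auto
  define F where "F = (\<lambda>m. torfn t (rad m))"
  have meas [measurable]: "F m \<in> borel_measurable borel" for m
    unfolding F_def by (rule torfn_parseval(1)[OF r r])
  have rad: "filterlim rad (at_left 1) sequentially"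
    unfolding filterlim_at using rad_tendsto rad_bounds(2) by (auto simp: less_imp_neq)
  have "AE p in tor. (\<lambda>n. cmod (F n p)) \<longlonglongrightarrow> 1"
  proof (rule AE_tor)
    have "AE (s, u) in (lborel :: (real \<times> real) measure).
        \<exists>l. ((\<lambda>r. fn t (of_real r * cis s, of_real r * cis u)) \<longlongrightarrow> l) (at_left 1) \<and> cmod l = 1"
      using assms unfolding inner_function_def by blast
    then show "AE p in lborel. (\<lambda>n. cmod (F n p)) \<longlonglongrightarrow> 1"
    proof eventually_elim
      case (elim p)
      then obtain l where l: "((\<lambda>r. fn t (of_real r * cis (fst p), of_real r * cis (snd p))) \<longlongrightarrow> l) (at_left 1)" "cmod l = 1"
        by (auto simp: case_prod_unfold)
      from tendsto_norm[OF filterlim_compose[OF l(1) rad]] l(2)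
      show ?case by (simp add: F_def torfn_def)
    qed
  qed
  then have lim: "AE p in tor. (\<lambda>n. \<bar>(cmod (F m p))\<^sup>2 - (cmod (F n p))\<^sup>2\<bar>) \<longlonglongrightarrow> \<bar>(cmod (F m p))\<^sup>2 - 1\<bar>" for m
  proof eventually_elim
    case (elim p)
    have "(\<lambda>n. \<bar>(cmod (F m p))\<^sup>2 - (cmod (F n p))\<^sup>2\<bar>) \<longlonglongrightarrow> \<bar>(cmod (F m p))\<^sup>2 - 1\<^sup>2\<bar>"
      by (intro tendsto_intros elim)
    then show ?case by simp
  qed
  have L1: "(\<integral>\<^sup>+ p. ennreal \<bar>(cmod (F m p))\<^sup>2 - 1\<bar> \<partial>tor) \<le>
      ennreal ((norm (dilate (rad m) t - t))\<^sup>2 / e + 4 * e * (norm t)\<^sup>2)" if "e > 0" for e m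
  proof (rule nn_integral_Fatou_le[OF _ _ lim])
    show "(\<integral>\<^sup>+ p. ennreal \<bar>(cmod (F m p))\<^sup>2 - (cmod (F n p))\<^sup>2\<bar> \<partial>tor) \<le>
        ennreal ((norm (dilate (rad m) t - dilate (rad n) t))\<^sup>2 / e + 4 * e * (norm t)\<^sup>2)" for n
      unfolding F_def by (rule integral_torfn_square_diff_le[OF that])
    show "(\<lambda>n. (norm (dilate (rad m) t - dilate (rad n) t))\<^sup>2 / e + 4 * e * (norm t)\<^sup>2) \<longlonglongrightarrow>
        (norm (dilate (rad m) t - t))\<^sup>2 / e + 4 * e * (norm t)\<^sup>2"
      using that by (intro tendsto_intros dilate_tendsto) auto
  qed measurable
  have int2: "integrable tor (\<lambda>p. (cmod (F m p))\<^sup>2)" for m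
    unfolding F_def by (rule integral_norm_torfn_square[OF r])
  have L1': "(LINT p|tor. \<bar>(cmod (F m p))\<^sup>2 - 1\<bar>) \<le> (norm (dilate (rad m) t - t))\<^sup>2 / e + 4 * e * (norm t)\<^sup>2"
    if "e > 0" for e m
  proof -
    have "integrable tor (\<lambda>p. \<bar>(cmod (F m p))\<^sup>2 - 1\<bar>)" using int2 by simp
    then have "ennreal (LINT p|tor. \<bar>(cmod (F m p))\<^sup>2 - 1\<bar>) \<le> ennreal ((norm (dilate (rad m) t - t))\<^sup>2 / e + 4 * e * (norm t)\<^sup>2)"
      using L1[OF that, of m] by (subst (asm) nn_integral_eq_integral) auto
    then show ?thesis using that by (subst (asm) ennreal_le_iff) auto
  qed
  have L1_lim: "(\<lambda>m. LINT p|tor. \<bar>(cmod (F m p))\<^sup>2 - 1\<bar>) \<longlonglongrightarrow> 0"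
  proof (rule LIMSEQ_I)
    fix e :: real assume "e > 0"
    \<comment> \<open>Chosen so that \<open>4 * d * (norm t)\<^sup>2\<close> is at most e/2; the
      summand 1 excludes a zero denominator.\<close>
    define d where "d = e / (8 * ((norm t)\<^sup>2 + 1))"
    have "(norm t)\<^sup>2 + 1 > 0" by (simp add: add_nonneg_pos)
    then have d: "d > 0" "4 * d * (norm t)\<^sup>2 \<le> e / 2"
      using \<open>e > 0\<close> by (auto simp: d_def field_simps)
    have "(\<lambda>m. (norm (dilate (rad m) t - t))\<^sup>2 / d) \<longlonglongrightarrow> (norm (t - t))\<^sup>2 / d"
      using d by (intro tendsto_intros dilate_tendsto) auto
    then have "\<forall>\<^sub>F m in sequentially. (norm (dilate (rad m) t - t))\<^sup>2 / d < e / 2"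
      using \<open>e > 0\<close> by (intro order_tendstoD(2)) auto
    then obtain N where N: "\<And>m. m \<ge> N \<Longrightarrow> (norm (dilate (rad m) t - t))\<^sup>2 / d < e / 2"
      unfolding eventually_sequentially by blast
    have "norm ((LINT p|tor. \<bar>(cmod (F m p))\<^sup>2 - 1\<bar>) - 0) < e" if "m \<ge> N" for m
    proof -
      have "0 \<le> (LINT p|tor. \<bar>(cmod (F m p))\<^sup>2 - 1\<bar>)" by (rule integral_nonneg_AE) simp
      then show ?thesis using N[OF that] L1'[OF d(1), of m] d(2) unfolding real_norm_def by linarith
    qed
    then show "\<exists>N. \<forall>m\<ge>N. norm ((LINT p|tor. \<bar>(cmod (F m p))\<^sup>2 - 1\<bar>) - 0) < e" by blast
  qed
  have "hinner (shift i t) (shift j t) = (if i = j then 1 else 0)" for i j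
  proof -
    define h where "h = (\<lambda>p. echar i p * cnj (echar j p))"
    have h [measurable]: "h \<in> borel_measurable borel" unfolding h_def by measurable
    have hn: "cmod (h p) = 1" for p by (simp add: h_def norm_mult)
    define \<delta> where "\<delta> = (if i = j then 1 else 0 :: complex)"
    have hint: "integrable tor h"
      by (rule tor.integrable_const_bound[where B = 1]) (auto simp: hn)
    have int: "integrable tor (\<lambda>p. h p * of_real ((cmod (F m p))\<^sup>2))" for m
      using integrable_torfn[OF r r h, of 1 t m t m] hn unfolding F_def complex_norm_square by simp
    have "norm ((LINT p|tor. h p * of_real ((cmod (F m p))\<^sup>2)) - \<delta>) \<le> (LINT p|tor. \<bar>(cmod (F m p))\<^sup>2 - 1\<bar>)" for m
    proof -
      have "(LINT p|tor. h p * of_real ((cmod (F m p))\<^sup>2)) - \<delta> = (LINT p|tor. h p * of_real ((cmod (F m p))\<^sup>2 - 1))"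
        using int[of m] hint integral_echar[of i j]
        by (simp add: algebra_simps \<delta>_def h_def)
      also have "norm \<dots> \<le> (LINT p|tor. norm (h p * of_real ((cmod (F m p))\<^sup>2 - 1)))"
        by (rule integral_norm_bound)
      also have "\<dots> = (LINT p|tor. \<bar>(cmod (F m p))\<^sup>2 - 1\<bar>)"
        by (simp only: norm_mult hn norm_of_real mult_1_left real_norm_def)
      finally show ?thesis .
    qed
    then have lim1: "(\<lambda>m. LINT p|tor. h p * of_real ((cmod (F m p))\<^sup>2)) \<longlonglongrightarrow> \<delta>"
      by (intro LIM_zero_cancel[OF tendsto_0_le[OF L1_lim, where K = 1]]) (auto intro!: always_eventually)
    \<comment> \<open>The dilated shifts carry the factor \<open>rad m ^ w\<close>, which tends to 1
      and disappears in the limit.\<close>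
    define w where "w = fst i + snd i + (fst j + snd j)"
    have "hinner (dilate (rad m) (shift i t)) (dilate (rad m) (shift j t)) =
        of_real (rad m) ^ w * (LINT p|tor. h p * of_real ((cmod (F m p))\<^sup>2))" for m
    proof -
      have "torfn (shift i t) (rad m) p * cnj (torfn (shift j t) (rad m) p) =
          of_real (rad m) ^ w * (h p * of_real ((cmod (F m p))\<^sup>2))" for p
        unfolding torfn_shift[OF r] complex_norm_square F_def h_def w_def by (simp add: power_add)
      then show ?thesis
        unfolding torfn_parseval(3)[OF r r, symmetric] by simp
    qed
    moreover have "(\<lambda>m. of_real (rad m) ^ w * (LINT p|tor. h p * of_real ((cmod (F m p))\<^sup>2))) \<longlonglongrightarrow> of_real 1 ^ w * \<delta>"
      by (intro tendsto_intros lim1 rad_tendsto)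
    moreover have "(\<lambda>m. hinner (dilate (rad m) (shift i t)) (dilate (rad m) (shift j t))) \<longlonglongrightarrow> hinner (shift i t) (shift j t)"
      by (intro tendsto_hinner dilate_tendsto)
    ultimately show ?thesis using LIMSEQ_unique by (fastforce simp: \<delta>_def)
  qed
  then show ?thesis by (simp add: inner_elt_def)
qed

section \<open>Multiplication by an inner function\<close>

text \<open>On polynomials the product with \<open>t\<close> is a combination of shifts of
  \<open>t\<close>, isometric by orthonormality. The truncations of \<open>x\<close> are Cauchy,
  hence so are their products, and continuity of evaluation identifies the limit with the pointwise
  product.\<close>

lemma ex_mult_inner:
  assumes "inner_elt t"
  shows "\<exists>y. (\<forall>z w. cmod z < 1 \<longrightarrow> cmod w < 1 \<longrightarrow> fn y (z, w) = fn t (z, w) * fn x (z, w)) \<and> norm y = norm x"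
proof -
  define X Y where "X = (\<lambda>N. lincomb (box N) (coef x) one)" and "Y = (\<lambda>N. lincomb (box N) (coef x) t)"
  have ip: "hinner (shift i t) (shift j t) = (if i = j then 1 else 0)" for i j
    using assms unfolding inner_elt_def by blast
  have X: "X \<longlonglongrightarrow> x" unfolding X_def by (rule lincomb_one_tendsto)
  have n: "norm (Y N) = norm (X N)" for N
    using norm_lincomb[OF finite_box ip, of N "coef x"] norm_lincomb[OF finite_box hinner_shift_one, of N "coef x"]
    by (simp add: X_def Y_def power2_eq_iff_nonneg flip: power2_eq_iff_nonneg)
  have d: "dist (Y M) (Y N) = dist (X M) (X N)" if "M \<le> N" for M N
  proof -
    have l: "lincomb (box N) c y - lincomb (box M) c y = lincomb (box N - box M) c y" for c y
      unfolding lincomb_def using box_mono[OF that] by (simp add: sum_diff)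
    have "(norm (Y N - Y M))\<^sup>2 = (norm (X N - X M))\<^sup>2"
      unfolding X_def Y_def l
      using norm_lincomb[OF _ ip, of "box N - box M" "coef x"] norm_lincomb[OF _ hinner_shift_one, of "box N - box M" "coef x"]
      by simp
    then show ?thesis by (simp add: dist_norm norm_minus_commute power2_eq_iff_nonneg)
  qed
  have "Cauchy Y"
  proof (rule CauchyI')
    fix e :: real assume "e > 0"
    then obtain K where "\<forall>m\<ge>K. \<forall>n\<ge>K. dist (X m) (X n) < e"
      using X metric_CauchyD[OF LIMSEQ_imp_Cauchy] by blast
    then show "\<exists>K. \<forall>m\<ge>K. \<forall>n>m. dist (Y m) (Y n) < e"
      by (intro exI[of _ K]) (auto simp: d)
  qed
  then obtain y where y: "Y \<longlonglongrightarrow> y" by (auto simp: Cauchy_convergent_iff convergent_def)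
  have "norm y = norm x"
    using tendsto_norm[OF y] tendsto_norm[OF X] unfolding n by (rule LIMSEQ_unique)
  moreover have "fn y (z, w) = fn t (z, w) * fn x (z, w)" if zw: "cmod z < 1" "cmod w < 1" for z w
  proof -
    have f: "fn (lincomb F c u) (z, w) = (\<Sum>k\<in>F. c k * (z ^ fst k * w ^ snd k)) * fn u (z, w)" if "finite F" for F c u
    proof -
      have "fn (lincomb F c u) (z, w) = (\<Sum>k\<in>F. fn (cs (c k) (shift k u)) (z, w))"
        unfolding lincomb_def using that by (induction F) auto
      also have "\<dots> = (\<Sum>k\<in>F. c k * (z ^ fst k * w ^ snd k) * fn u (z, w))"
        by (intro sum.cong refl) (metis fn_apply(3) fn_shift mult.assoc surjective_pairing)
      finally show ?thesis by (simp add: sum_distrib_right)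
    qed
    have lim: "(\<lambda>N. fn (U N) (z, w)) \<longlonglongrightarrow> fn u (z, w)" if "U \<longlonglongrightarrow> u" for U u
      using tendsto_hinner[OF that tendsto_const, of "ker z w"] zw by (simp add: fn_def)
    have "fn (Y N) (z, w) = fn t (z, w) * fn (X N) (z, w)" for N
      unfolding X_def Y_def f[OF finite_box] by (simp add: fn_one zw)
    then have "(\<lambda>N. fn (Y N) (z, w)) \<longlonglongrightarrow> fn t (z, w) * fn x (z, w)"
      using tendsto_mult_left[OF lim[OF X]] by simp
    then show ?thesis using lim[OF y] LIMSEQ_unique by blast
  qed
  ultimately show ?thesis by blast
qed

section \<open>Closed subspaces\<close>

definition closed_subspace :: "hardy set \<Rightarrow> bool" where
  "closed_subspace R \<longleftrightarrow> closed R \<and> 0 \<in> R \<and> (\<forall>x\<in>R. \<forall>y\<in>R. x + y \<in> R) \<and> (\<forall>c. \<forall>x\<in>R. cs c x \<in> R)"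

lemma orthogonal_if_minimal:
  assumes min: "\<And>c. norm x \<le> norm (x - cs c s)"
  shows "hinner x s = 0"
proof (rule ccontr)
  assume ne: "hinner x s \<noteq> 0"
  then have "s \<noteq> 0" by auto
  \<comment> \<open>\<open>cs c s\<close> is the projection of \<open>x\<close> onto the line of
    \<open>s\<close>; subtracting it lowers the squared norm by |h|^2 / |s|^2.\<close>
  define h c where "h = hinner x s" and "c = h / of_real ((norm s)\<^sup>2)"
  have s: "(norm s)\<^sup>2 > 0" using \<open>s \<noteq> 0\<close> by simp
  have "hinner s x = cnj h" unfolding h_def by (rule hinner_commute)
  then have "complex_of_real ((norm (x - cs c s))\<^sup>2) = of_real ((norm x)\<^sup>2) - c * cnj h - cnj c * h + c * cnj c * of_real ((norm s)\<^sup>2)"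
    unfolding hinner_self[symmetric] by (simp add: hinner_algebra h_def algebra_simps)
  also have "\<dots> = of_real ((norm x)\<^sup>2 - (cmod h)\<^sup>2 / (norm s)\<^sup>2)"
    using s by (simp add: c_def complex_norm_square field_simps del: of_real_power)
  finally have "(norm (x - cs c s))\<^sup>2 = (norm x)\<^sup>2 - (cmod h)\<^sup>2 / (norm s)\<^sup>2"
    by (simp only: of_real_eq_iff)
  moreover have "(norm x)\<^sup>2 \<le> (norm (x - cs c s))\<^sup>2" by (intro power_mono min) auto
  moreover have "(cmod h)\<^sup>2 / (norm s)\<^sup>2 > 0" using s ne by (simp add: h_def)
  ultimately show False by linarith
qed

text \<open>A minimising sequence is Cauchy by the parallelogram law, because midpoints stay in
  \<open>R\<close>.\<close>

lemma ex_projection: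
  assumes "closed_subspace R"
  shows "\<exists>r\<in>R. \<forall>s\<in>R. hinner (x - r) s = 0"
proof -
  have R: "closed R" "0 \<in> R" "\<And>x y. x \<in> R \<Longrightarrow> y \<in> R \<Longrightarrow> x + y \<in> R" "\<And>c x. x \<in> R \<Longrightarrow> cs c x \<in> R"
    using assms unfolding closed_subspace_def by blast+
  define D where "D = (\<lambda>r. (norm (x - r))\<^sup>2) ` R"
  define d where "d = Inf D"
  have bdd: "bdd_below D" unfolding D_def by (intro bdd_belowI2[where m = 0]) simp
  have d_le: "d \<le> (norm (x - r))\<^sup>2" if "r \<in> R" for r
    unfolding d_def by (rule cInf_lower[OF _ bdd]) (use that in \<open>auto simp: D_def\<close>)
  have "\<exists>r\<in>R. (norm (x - r))\<^sup>2 < d + 1 / real (Suc n)" for n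
  proof -
    have "Inf D < d + 1 / real (Suc n)" by (simp add: d_def)
    moreover have "D \<noteq> {}" using R(2) by (auto simp: D_def)
    ultimately show ?thesis using cInf_lessD[of D] by (fastforce simp: D_def)
  qed
  then obtain r where r: "\<And>n. r n \<in> R" "\<And>n. (norm (x - r n))\<^sup>2 < d + 1 / real (Suc n)" by metis
  have mid: "(norm (r m - r n))\<^sup>2 \<le> 2 / real (Suc m) + 2 / real (Suc n)" for m n
  proof -
    define h where "h = cs (1/2) (r m + r n)"
    have "h \<in> R" unfolding h_def by (intro R r)
    have "(norm ((x - r n) + (x - r m)))\<^sup>2 + (norm ((x - r n) - (x - r m)))\<^sup>2 = 2 * (norm (x - r n))\<^sup>2 + 2 * (norm (x - r m))\<^sup>2"
      by (simp add: power2_norm_eq_inner inner_add_left inner_add_right inner_diff_left inner_diff_right)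
    moreover have "(x - r n) + (x - r m) = cs 2 (x - h)"
      unfolding h_def by (rule hardy_eqI) (simp add: algebra_simps)
    moreover have "(x - r n) - (x - r m) = r m - r n" by simp
    ultimately have "4 * (norm (x - h))\<^sup>2 + (norm (r m - r n))\<^sup>2 = 2 * (norm (x - r n))\<^sup>2 + 2 * (norm (x - r m))\<^sup>2"
      by (simp add: power_mult_distrib del: cs_simps)
    then show ?thesis using d_le[OF \<open>h \<in> R\<close>] r(2)[of m] r(2)[of n] by linarith
  qed
  have "Cauchy r"
  proof (rule metric_CauchyI)
    fix e :: real assume "e > 0"
    then obtain N where N: "4 / e\<^sup>2 < real N" using reals_Archimedean2 by blast
    have "dist (r m) (r n) < e" if "m \<ge> N" "n \<ge> N" for m n
    proof -
      have N0: "4 < e\<^sup>2 * real (Suc k)" if "k \<ge> N" for k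
      proof -
        have "4 < real N * e\<^sup>2" using N \<open>e > 0\<close> by (simp add: pos_divide_less_eq)
        also have "\<dots> \<le> real (Suc k) * e\<^sup>2" using that by (intro mult_right_mono) auto
        finally show ?thesis by (simp add: mult.commute)
      qed
      have "2 / real (Suc m) < e\<^sup>2 / 2" "2 / real (Suc n) < e\<^sup>2 / 2"
        using N0[OF that(1)] N0[OF that(2)] by (auto simp: field_simps)
      then have "(norm (r m - r n))\<^sup>2 < e\<^sup>2" using mid[of m n] by linarith
      then show ?thesis using \<open>e > 0\<close> by (simp add: dist_norm power2_less_imp_less)
    qed
    then show "\<exists>N. \<forall>m\<ge>N. \<forall>n\<ge>N. dist (r m) (r n) < e" by blast
  qed
  then obtain q where q: "r \<longlonglongrightarrow> q" by (auto simp: Cauchy_convergent_iff convergent_def)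
  have "q \<in> R" using R(1) r(1) q closed_sequentially by blast
  have "(norm (x - q))\<^sup>2 \<le> d"
  proof (rule LIMSEQ_le)
    show "(\<lambda>n. (norm (x - r n))\<^sup>2) \<longlonglongrightarrow> (norm (x - q))\<^sup>2" by (intro tendsto_intros q)
    show "(\<lambda>n. d + 1 / real (Suc n)) \<longlonglongrightarrow> d"
      using tendsto_add[OF tendsto_const[of d] LIMSEQ_Suc[OF lim_1_over_n]] by simp
  qed (use r(2) less_imp_le in blast)
  then have "norm (x - q) \<le> norm (x - q - cs c s)" if "s \<in> R" for c s
  proof -
    have "(norm (x - q))\<^sup>2 \<le> (norm (x - (q + cs c s)))\<^sup>2"
      using d_le[of "q + cs c s"] R \<open>q \<in> R\<close> that \<open>(norm (x - q))\<^sup>2 \<le> d\<close> by (meson order_trans)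
    then show ?thesis by (simp add: diff_diff_eq)
  qed
  then show ?thesis using \<open>q \<in> R\<close> orthogonal_if_minimal by blast
qed

section \<open>Resolvent equations\<close>

text \<open>The resolvent of a contraction, as a fixed point. Uniqueness matters as much as
  existence: it later carries an eigenvalue equation over to the solution.\<close>

lemma ex1_resolvent:
  assumes "\<And>x y. V (x - y) = V x - V y" "\<And>x. norm (V x) \<le> norm x" "cmod c < 1"
  shows "\<exists>!u. cs c (V u) + h = u"
proof (rule banach_fix_type[of "cmod c"])
  show "\<forall>x y. dist (cs c (V x) + h) (cs c (V y) + h) \<le> cmod c * dist x y"
  proof (intro allI)
    fix x y
    have "dist (cs c (V x) + h) (cs c (V y) + h) = norm (cs c (V (x - y)))"
      by (simp add: dist_norm assms(1))
    also have "\<dots> \<le> cmod c * norm (x - y)" using assms(2) by (simp add: mult_left_mono)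
    finally show "dist (cs c (V x) + h) (cs c (V y) + h) \<le> cmod c * dist x y" by (simp add: dist_norm)
  qed
qed (use assms in auto)

lemma ex_resolvent_outside:
  assumes "\<And>x y. V (x - y) = V x - V y" "\<And>x. norm (V x) \<le> norm x" "cmod c > 1"
  shows "\<exists>u. V u - cs c u = h"
proof -
  have "cmod (1 / c) < 1" using assms(3) by (simp add: norm_divide divide_less_eq)
  from ex1_resolvent[OF assms(1,2) this, of "cs (- 1 / c) h"]
  obtain u where u: "cs (1 / c) (V u) + cs (- 1 / c) h = u" by auto
  have "c \<noteq> 0" using assms(3) by auto
  then have "cs c (cs (1 / c) (V u) + cs (- 1 / c) h) = V u - h" by simp
  then show ?thesis unfolding u by (metis diff_diff_eq2 add_diff_cancel_left' diff_add_cancel)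
qed

lemma coef_backshift_eigen:
  assumes "backshift (i, j) f = cs a f"
  shows "coef f (m + N * i, n + N * j) = a ^ N * coef f (m, n)"
proof (induction N)
  case (Suc N)
  have "coef f (m + N * i + i, n + N * j + j) = coef (backshift (i, j) f) (m + N * i, n + N * j)" by simp
  also have "\<dots> = a * coef f (m + N * i, n + N * j)" unfolding assms by simp
  finally show ?case using Suc by (simp add: algebra_simps)
qed auto

text \<open>Along the progression (m, n) + N (i, j) the coefficients are multiplied by powers of
  \<open>a\<close>, so their moduli do not decrease; square summability then forces them to vanish.
  Modulus exactly 1 is included.\<close>

lemma backshift_eigen_eq_0:
  assumes "backshift (i, j) f = cs a f" "cmod a \<ge> 1" "i + j > 0"
  shows "f = 0"
proof (rule hardy_eqI)
  fix m n
  have le: "real N * (cmod (coef f (m, n)))\<^sup>2 \<le> (norm f)\<^sup>2" for N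
  proof -
    define g where "g = (\<lambda>k. (m + k * i, n + k * j))"
    have inj: "inj_on g {..<N}" using assms(3) by (auto simp: inj_on_def g_def)
    have "real N * (cmod (coef f (m, n)))\<^sup>2 = (\<Sum>k<N. (cmod (coef f (m, n)))\<^sup>2)" by simp
    also have "\<dots> \<le> (\<Sum>k<N. (cmod (coef f (g k)))\<^sup>2)"
    proof (rule sum_mono)
      fix k
      have "1 \<le> cmod a ^ k" using assms(2) by (rule one_le_power)
      then have "cmod (coef f (m, n)) \<le> cmod (coef f (g k))"
        unfolding g_def coef_backshift_eigen[OF assms(1)] norm_mult norm_power
        using mult_right_mono[of 1 "cmod a ^ k" "cmod (coef f (m, n))"] by simp
      then show "(cmod (coef f (m, n)))\<^sup>2 \<le> (cmod (coef f (g k)))\<^sup>2" by (intro power_mono) auto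
    qed
    also have "\<dots> = (\<Sum>k\<in>g ` {..<N}. (cmod (coef f k))\<^sup>2)" by (simp add: sum.reindex[OF inj])
    also have "\<dots> \<le> (norm f)\<^sup>2" by (rule finite_sum_le_has_sum[OF norm_has_sum]) auto
    finally show ?thesis .
  qed
  show "coef f (m, n) = coef 0 (m, n)"
  proof (rule ccontr)
    assume "coef f (m, n) \<noteq> coef 0 (m, n)"
    then have "(cmod (coef f (m, n)))\<^sup>2 > 0" by simp
    then obtain N where "(norm f)\<^sup>2 < real N * (cmod (coef f (m, n)))\<^sup>2"
      using reals_Archimedean3 by blast
    with le[of N] show False by simp
  qed
qed

lemma fn_Bz_0: "Bz d = 0 \<Longrightarrow> cmod z < 1 \<Longrightarrow> cmod z' < 1 \<Longrightarrow> cmod w < 1 \<Longrightarrow> fn d (z, w) = fn d (z', w)"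
proof -
  assume d: "Bz d = 0" and *: "cmod z < 1" "cmod z' < 1" "cmod w < 1"
  have "coef d (Suc m, n) = 0" for m n using coef_backshift[of "Suc 0" 0 d m n] d by simp
  then have "coef d (m, n) * z ^ m * w ^ n = coef d (m, n) * z' ^ m * w ^ n" for m n
    by (cases m) simp_all
  then have "(\<lambda>(m, n). coef d (m, n) * z ^ m * w ^ n) = (\<lambda>(m, n). coef d (m, n) * z' ^ m * w ^ n)"
    by (intro ext) (simp split: prod.split)
  with fn_has_sum[OF *(1,3), of d] have "((\<lambda>(m, n). coef d (m, n) * z' ^ m * w ^ n) has_sum fn d (z, w)) UNIV"
    by simp
  from has_sum_unique[OF this fn_has_sum[OF *(2,3), of d]] show ?thesis .
qed

lemma fn_Bw_0: "Bw d = 0 \<Longrightarrow> cmod z < 1 \<Longrightarrow> cmod w < 1 \<Longrightarrow> cmod w' < 1 \<Longrightarrow> fn d (z, w) = fn d (z, w')"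
proof -
  assume d: "Bw d = 0" and *: "cmod z < 1" "cmod w < 1" "cmod w' < 1"
  have "coef d (m, Suc n) = 0" for m n using coef_backshift[of 0 "Suc 0" d m n] d by simp
  then have "coef d (m, n) * z ^ m * w ^ n = coef d (m, n) * z ^ m * w' ^ n" for m n
    by (cases n) simp_all
  then have "(\<lambda>(m, n). coef d (m, n) * z ^ m * w ^ n) = (\<lambda>(m, n). coef d (m, n) * z ^ m * w' ^ n)"
    by (intro ext) (simp split: prod.split)
  with fn_has_sum[OF *(1,2), of d] have "((\<lambda>(m, n). coef d (m, n) * z ^ m * w' ^ n) has_sum fn d (z, w)) UNIV"
    by simp
  from has_sum_unique[OF this fn_has_sum[OF *(1,3), of d]] show ?thesis .
qed

text \<open>Division with remainder by the shift minus c. With S the backward shift, the quotient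
  solves u = c S u + S h, which is exactly the condition that S kills the remainder.\<close>

lemma shift_decomp:
  assumes "cmod c < 1"
  shows "\<exists>u d. h = shift e u - cs c u + d \<and> backshift e d = 0"
proof -
  from ex1_resolvent[where V = "backshift e" and h = "backshift e h", OF backshift_linear(2) norm_backshift assms]
  obtain u where u: "cs c (backshift e u) + backshift e h = u" by auto
  define d where "d = h - (shift e u - cs c u)"
  have "backshift e d = backshift e h - (u - cs c (backshift e u))" by (simp add: d_def)
  also have "\<dots> = 0" using u by (metis add_diff_cancel_left' diff_self)
  finally show ?thesis by (intro exI[of _ u] exI[of _ d]) (auto simp: d_def)
qed

lemma fn_Z: "fn (Z x) (z, w) = z * fn x (z, w)" and fn_W: "fn (W x) (z, w) = w * fn x (z, w)"
  by (simp_all add: fn_shift)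

text \<open>The remainder of \<open>shift_decomp\<close> does not depend on z, so its values can be
  read off on the slice z = c, where they are 0.\<close>

lemma divide_by_z_minus:
  assumes "cmod c < 1" "\<And>w. cmod w < 1 \<Longrightarrow> fn h (c, w) = 0"
  shows "\<exists>u. h = Z u - cs c u"
proof -
  obtain u d where h: "h = Z u - cs c u + d" and d: "Bz d = 0"
    using shift_decomp[OF assms(1)] by blast
  have "fn d (z, w) = 0" if "cmod z < 1" "cmod w < 1" for z w
  proof -
    have "fn d (z, w) = fn d (c, w)" by (rule fn_Bz_0[OF d that(1) assms(1) that(2)])
    also have "\<dots> = 0" using assms(2)[OF that(2)] unfolding h by (simp add: fn_Z)
    finally show ?thesis .
  qed
  then have "d = 0" by (rule fn_eq_0D)
  then show ?thesis using h by auto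
qed

lemma divide_by_w_minus:
  assumes "cmod \<alpha> < 1"
  shows "\<exists>u. \<forall>z w. cmod z < 1 \<longrightarrow> cmod w < 1 \<longrightarrow> fn h (z, w) = fn h (z, \<alpha>) + (w - \<alpha>) * fn u (z, w)"
proof -
  obtain u d where h: "h = W u - cs \<alpha> u + d" and d: "Bw d = 0"
    using shift_decomp[OF assms] by blast
  have "fn h (z, w) = fn h (z, \<alpha>) + (w - \<alpha>) * fn u (z, w)" if "cmod z < 1" "cmod w < 1" for z w
    unfolding h using fn_Bw_0[OF d that assms] by (simp add: fn_W algebra_simps)
  then show ?thesis by blast
qed

text \<open>By division \<open>x\<close> lies in the range of \<open>Z\<close> minus c, which is
  orthogonal to the kernel of the adjoint.\<close>

lemma eigenvector_orthogonal:
  assumes "Bz f = cs (cnj c) f" "cmod c < 1" "\<And>w. cmod w < 1 \<Longrightarrow> fn x (c, w) = 0"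
  shows "hinner x f = 0"
proof -
  obtain u where "x = Z u - cs c u" using divide_by_z_minus[OF assms(2,3)] by blast
  then show ?thesis by (simp add: hinner_diff_left hinner_shift assms(1))
qed

section \<open>The model space and the compressed shift\<close>

text \<open>Only the pointwise product and the isometry are assumed; linearity and commutation with
  shifts follow from injectivity of \<open>fn\<close>.\<close>

locale inner_multiplier =
  fixes \<theta> :: cfun2 and M :: "hardy \<Rightarrow> hardy"
  assumes fn_M: "cmod z < 1 \<Longrightarrow> cmod w < 1 \<Longrightarrow> fn (M x) (z, w) = \<theta> (z, w) * fn x (z, w)"
    and norm_M [simp]: "norm (M x) = norm x"
begin

lemma M_linear [simp]: "M (x + y) = M x + M y" "M (x - y) = M x - M y" "M (cs c x) = cs c (M x)"
  "M 0 = 0" "M (shift e x) = shift e (M x)"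
  by (cases e; auto intro!: fn_eqI simp: fn_M algebra_simps fn_shift)+

lemma M_minus [simp]: "M (- x) = - M x"
  using M_linear(3)[of "-1" x] by (simp del: M_linear)

text \<open>Polarisation; the imaginary part comes from replacing \<open>x\<close> by
  \<open>cs \<i> x\<close>.\<close>

lemma hinner_M [simp]: "hinner (M x) (M y) = hinner x y"
proof -
  have re: "Re (hinner (M x) (M y)) = Re (hinner x y)" for x y
  proof -
    have "(norm (M (x + y)))\<^sup>2 = (norm (x + y))\<^sup>2" by (simp del: M_linear)
    then have "inner (M x) (M y) = inner x y"
      unfolding M_linear power2_norm_eq_inner inner_add_left inner_add_right
      using inner_commute[of x y] inner_commute[of "M x" "M y"] norm_M[of x] norm_M[of y]
      by (simp add: norm_eq_sqrt_inner)
    then show ?thesis by (simp add: inner_hardy_def)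
  qed
  from re[of x y] re[of "cs \<i> x" y] show ?thesis by (simp add: complex_eq_iff)
qed

lemma closed_subspace_range_M: "closed_subspace (range M)"
proof -
  have "closed (range M)"
    unfolding closed_sequential_limits
  proof safe
    fix X l assume X: "\<forall>n. X n \<in> range M" "X \<longlonglongrightarrow> l"
    then have "\<forall>n. \<exists>v. X n = M v" by (auto simp: image_iff)
    then obtain u where "\<forall>n. X n = M (u n)" unfolding choice_iff ..
    then have u: "X = (\<lambda>n. M (u n))" by (intro ext) (rule spec)
    have "dist (u m) (u n) = dist (X m) (X n)" for m n
      unfolding u dist_norm M_linear(2)[symmetric] norm_M ..
    moreover have "Cauchy X" by (rule LIMSEQ_imp_Cauchy[OF X(2)])
    ultimately have "Cauchy u" unfolding Cauchy_def by (simp only:)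
    then obtain v where v: "u \<longlonglongrightarrow> v" by (auto simp: Cauchy_convergent_iff convergent_def)
    have "dist (X n) (M v) = dist (u n) v" for n
      unfolding u dist_norm M_linear(2)[symmetric] norm_M ..
    then have "X \<longlonglongrightarrow> M v" using v unfolding tendsto_dist_iff[of _ "M v"] tendsto_dist_iff[of _ v] by (simp only:)
    from LIMSEQ_unique[OF X(2) this] show "l \<in> range M" by simp
  qed
  moreover have "0 \<in> range M" by (rule image_eqI[of _ _ 0]) auto
  moreover have "x + y \<in> range M" if xy: "x \<in> range M" "y \<in> range M" for x y
    using xy by (auto intro: image_eqI[of _ _ "_ + _"])
  moreover have "cs c x \<in> range M" if "x \<in> range M" for c x
    using that by (auto intro: image_eqI[of _ _ "cs c _"])
  ultimately show ?thesis by (auto simp: closed_subspace_def)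
qed

text \<open>\<open>M (M_adj x)\<close> is the orthogonal projection of \<open>x\<close> onto the
  closed range of \<open>M\<close>; since \<open>M\<close> is isometric, this makes
  \<open>M_adj\<close> its adjoint.\<close>

definition M_adj :: "hardy \<Rightarrow> hardy" where
  "M_adj x = (SOME y. \<forall>g. hinner (x - M y) (M g) = 0)"

lemma M_adj_orthogonal: "hinner (x - M (M_adj x)) (M g) = 0"
proof -
  have "\<exists>y. \<forall>g. hinner (x - M y) (M g) = 0"
    using ex_projection[OF closed_subspace_range_M, of x] by blast
  from someI_ex[OF this] show ?thesis unfolding M_adj_def by blast
qed

lemma hinner_M_adj: "hinner (M_adj x) y = hinner x (M y)"
  using M_adj_orthogonal[of x y] by (simp add: hinner_diff_left)

lemma hinner_Ma': "hinner y (M_adj x) = hinner (M y) x"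
  by (subst (1 2) hinner_commute) (simp add: hinner_M_adj)

lemma M_adj_linear [simp]: "M_adj (x + y) = M_adj x + M_adj y" "M_adj (x - y) = M_adj x - M_adj y" "M_adj (cs c x) = cs c (M_adj x)"
  "M_adj (M x) = x" "M_adj (backshift e x) = backshift e (M_adj x)" "M_adj 0 = 0"
  by (rule hinner_eqI; simp add: hinner_M_adj hinner_algebra hinner_backshift)+

definition KK :: "hardy set" where "KK = {f. M_adj f = 0}"

lemma KK_iff: "f \<in> KK \<longleftrightarrow> (\<forall>g. hinner f (M g) = 0)"
  unfolding KK_def hinner_M_adj[symmetric] using hinner_eqI[of "M_adj f" 0] by auto

lemma KK_simps [simp]: "0 \<in> KK" "f \<in> KK \<Longrightarrow> g \<in> KK \<Longrightarrow> f + g \<in> KK" "f \<in> KK \<Longrightarrow> g \<in> KK \<Longrightarrow> f - g \<in> KK"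
  "f \<in> KK \<Longrightarrow> cs c f \<in> KK" "f \<in> KK \<Longrightarrow> backshift e f \<in> KK"
  by (auto simp: KK_def)

lemma KK_range_M: "M g \<in> KK \<Longrightarrow> g = 0"
  by (simp add: KK_def)

definition pr :: "hardy \<Rightarrow> hardy" where "pr x = x - M (M_adj x)"

lemma pr_simps [simp]: "pr x \<in> KK" "pr (M g) = 0" "pr (x + y) = pr x + pr y" "pr (x - y) = pr x - pr y"
  "pr (cs c x) = cs c (pr x)"
  by (simp_all add: pr_def KK_def)

lemma pr_id [simp]: "f \<in> KK \<Longrightarrow> pr f = f"
  by (simp add: pr_def KK_def)

lemma hinner_pr: "f \<in> KK \<Longrightarrow> hinner (pr x) f = hinner x f"
  by (simp add: pr_def hinner_diff_left KK_def flip: hinner_Ma')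

lemma norm_pr: "(norm x)\<^sup>2 = (norm (pr x))\<^sup>2 + (norm (M_adj x))\<^sup>2"
proof -
  have "hinner (pr x) (M (M_adj x)) = 0" unfolding pr_def by (rule M_adj_orthogonal)
  then have i: "inner (pr x) (M (M_adj x)) = 0" by (simp add: inner_hardy_def)
  have "x = pr x + M (M_adj x)" by (simp add: pr_def)
  then have "(norm x)\<^sup>2 = (norm (pr x + M (M_adj x)))\<^sup>2" by simp
  also have "\<dots> = (norm (pr x))\<^sup>2 + (norm (M (M_adj x)))\<^sup>2"
    unfolding power2_norm_eq_inner inner_add_left inner_add_right using i inner_commute[of "pr x" "M (M_adj x)"] by simp
  finally show ?thesis by simp
qed

lemma norm_pr_le: "norm (pr x) \<le> norm x"
  by (rule power2_le_imp_le) (simp_all add: norm_pr[of x])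

text \<open>On the model space, \<open>A c\<close> is the compressed shift minus \<open>c\<close>, and \<open>A_adj c\<close> is its adjoint.\<close>

definition A :: "complex \<Rightarrow> hardy \<Rightarrow> hardy" where "A c x = pr (Z x - cs c x)"

definition A_adj :: "complex \<Rightarrow> hardy \<Rightarrow> hardy" where "A_adj c x = Bz x - cs (cnj c) x"

lemma A_KK [simp]: "A c x \<in> KK" and A_adj_KK [simp]: "f \<in> KK \<Longrightarrow> A_adj c f \<in> KK"
  by (simp_all add: A_def A_adj_def)

lemma A_linear [simp]: "A c (x + y) = A c x + A c y" "A c (x - y) = A c x - A c y" "A c (cs b x) = cs b (A c x)"
  "A c 0 = 0"
proof -
  have "Z (x + y) - cs c (x + y) = (Z x - cs c x) + (Z y - cs c y)"
    "Z (x - y) - cs c (x - y) = (Z x - cs c x) - (Z y - cs c y)"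
    "Z (cs b x) - cs c (cs b x) = cs b (Z x - cs c x)"
    by (simp_all add: mult.commute)
  then show "A c (x + y) = A c x + A c y" "A c (x - y) = A c x - A c y" "A c (cs b x) = cs b (A c x)"
    unfolding A_def by (simp_all only: pr_simps)
  show "A c 0 = 0" by (simp add: A_def)
qed

lemma A_adj_linear [simp]: "A_adj c (x + y) = A_adj c x + A_adj c y" "A_adj c (x - y) = A_adj c x - A_adj c y" "A_adj c (cs b x) = cs b (A_adj c x)"
  "A_adj c 0 = 0"
  by (simp_all add: A_adj_def mult.commute)

lemma A_pr: "A c (pr x) = A c x"
proof -
  have "A c (M g) = 0" for g
    using pr_simps(2)[of "Z g - cs c g"] unfolding A_def by simp
  then show ?thesis by (simp add: pr_def)
qed

lemma hinner_A: "g \<in> KK \<Longrightarrow> hinner (A c f) g = hinner f (A_adj c g)"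
  by (simp add: A_def A_adj_def hinner_pr hinner_algebra hinner_shift del: pr_simps)

text \<open>The projection changes elements only by the range of \<open>M\<close>. The range of
  \<open>A c\<close> thus becomes the membership problem for (z - c) H^2 + \<theta> H^2, which can
  be tested on the slice z = c.\<close>

lemma range_A_iff: "x \<in> A c ` KK \<longleftrightarrow> x \<in> KK \<and> (\<exists>u g. x = Z u - cs c u + M g)"
proof
  assume "x \<in> A c ` KK"
  then obtain f where "x = A c f" by auto
  have "A c f = Z f - cs c f + M (- M_adj (Z f - cs c f))"
    by (simp add: A_def pr_def)
  with \<open>x = A c f\<close> have "\<exists>u g. x = Z u - cs c u + M g" by blast
  with \<open>x = A c f\<close> show "x \<in> KK \<and> (\<exists>u g. x = Z u - cs c u + M g)" by simp
next
  assume "x \<in> KK \<and> (\<exists>u g. x = Z u - cs c u + M g)"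
  then obtain u g where x: "x \<in> KK" "x = Z u - cs c u + M g" by blast
  have "x = pr x" using x(1) by simp
  also have "\<dots> = A c u" unfolding x(2) A_def by simp
  also have "\<dots> = A c (pr u)" by (simp add: A_pr)
  finally show "x \<in> A c ` KK" by (intro image_eqI) auto
qed

lemma A_adj_eigen: "A_adj c f = 0 \<longleftrightarrow> Bz f = cs (cnj c) f"
  by (simp add: A_adj_def)

text \<open>The component of \<open>x\<close> orthogonal to the range is a kernel vector of the
  adjoint, hence orthogonal to \<open>x\<close> as well, hence 0.\<close>

lemma closed_range_A:
  assumes "closed (A c ` KK)" "x \<in> KK" "\<And>g. g \<in> KK \<Longrightarrow> A_adj c g = 0 \<Longrightarrow> hinner x g = 0"
  shows "x \<in> A c ` KK"
proof -
  have "A c f + A c g \<in> A c ` KK" if "f \<in> KK" "g \<in> KK" for f g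
    using that by (intro image_eqI[of _ _ "f + g"]) auto
  moreover have "cs b (A c f) \<in> A c ` KK" if "f \<in> KK" for b f
    using that by (intro image_eqI[of _ _ "cs b f"]) auto
  moreover have "0 \<in> A c ` KK" by (intro image_eqI[of _ _ 0]) auto
  ultimately have "closed_subspace (A c ` KK)" using assms(1) by (auto simp: closed_subspace_def)
  from ex_projection[OF this, of x] obtain r where r: "r \<in> A c ` KK" "\<And>s. s \<in> A c ` KK \<Longrightarrow> hinner (x - r) s = 0"
    by blast
  define n where "n = x - r"
  have "r \<in> KK" using r(1) by auto
  then have n: "n \<in> KK" using assms(2) by (simp add: n_def)
  have "hinner (A_adj c n) (A_adj c n) = 0"
  proof -
    have "hinner (A_adj c n) (A_adj c n) = hinner (A c (A_adj c n)) n" using n by (simp add: hinner_A)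
    also have "\<dots> = cnj (hinner n (A c (A_adj c n)))" by (rule hinner_commute)
    also have "hinner n (A c (A_adj c n)) = 0" unfolding n_def by (rule r(2)[OF imageI]) (rule A_adj_KK[OF n[unfolded n_def]])
    finally show ?thesis by simp
  qed
  then have "A_adj c n = 0" by (simp add: hinner_self)
  then have "hinner x n = 0" using assms(3) n by blast
  moreover have "hinner r n = 0"
    using r(2)[OF r(1)] hinner_commute[of r n] by (simp add: n_def)
  ultimately have "hinner n n = 0" by (simp add: n_def hinner_diff_left)
  then have "x = r" by (simp add: hinner_self n_def)
  then show ?thesis using r(1) by simp
qed

text \<open>Pythagoras for \<open>Z f\<close> leaves no room: its model-space part already has norm
  at least that of \<open>f\<close>, so the other part vanishes and \<open>Z f = cs c f\<close>,
  which is impossible for nonzero \<open>f\<close>.\<close>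

lemma inj_A_outside:
  assumes "cmod c \<ge> 1" "f \<in> KK" "A c f = 0"
  shows "f = 0"
proof -
  have pZ: "pr (Z f) = cs c f" using assms(2,3) by (simp add: A_def)
  have "(norm f)\<^sup>2 \<le> (cmod c * norm f)\<^sup>2"
    using assms(1) by (intro power_mono) (auto simp: mult_le_cancel_right1)
  then have "(norm (M_adj (Z f)))\<^sup>2 \<le> 0" using norm_pr[of "Z f"] unfolding pZ norm_shift norm_cs by linarith
  then have "M_adj (Z f) = 0" by simp
  then have Zf: "Z f = cs c f" using pZ by (simp add: pr_def)
  show ?thesis
  proof (rule fn_eq_0D)
    fix z w :: complex assume zw: "cmod z < 1" "cmod w < 1"
    have "z * fn f (z, w) = c * fn f (z, w)" using fn_Z[of f z w] unfolding Zf by auto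
    moreover have "z \<noteq> c" using zw(1) assms(1) by auto
    ultimately show "fn f (z, w) = 0" by simp
  qed
qed

text \<open>On the slice z = c the relation (z - c) f = \<theta> g reads 0 = \<theta> g, and
  \<theta>(c, .) is nonzero on an open set. So g vanishes on the slice and z - c divides it;
  cancelling gives f = \<theta> h, which lies in the model space only if it is 0.\<close>

lemma inj_A_inside:
  assumes "cmod c < 1" "cmod w0 < 1" "\<theta> (c, w0) \<noteq> 0" "f \<in> KK" "A c f = 0"
  shows "f = 0"
proof -
  define g where "g = M_adj (Z f - cs c f)"
  have g: "Z f - cs c f = M g" using assms(5) by (simp add: A_def pr_def g_def)
  have *: "fn (M one) (c, w) * fn g (c, w) = 0" if "cmod w < 1" for w
  proof -
    have "fn (M g) (c, w) = 0" unfolding g[symmetric] by (simp add: fn_Z)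
    then show ?thesis using assms(1) that by (simp add: fn_M fn_one)
  qed
  have "fn (M one) (c, w0) \<noteq> 0" using assms by (simp add: fn_M fn_one)
  have hol: "(\<lambda>w. fn (M one) (c, w)) holomorphic_on \<D>" "(\<lambda>w. fn g (c, w)) holomorphic_on \<D>"
    using holomorphic_fn[OF assms(1)] by auto
  have cont: "continuous_on \<D> (\<lambda>w. fn (M one) (c, w))" using hol(1) by (rule holomorphic_on_imp_continuous_on)
  define U where "U = (\<lambda>w. fn (M one) (c, w)) -` (- {0}) \<inter> \<D>"
  have "open U" unfolding U_def
    using cont continuous_on_open_vimage[of \<D> "\<lambda>w. fn (M one) (c, w)"] by blast
  have "fn g (c, w) = 0" if "cmod w < 1" for w
  proof (rule analytic_continuation_open[of U \<D> "\<lambda>w. fn g (c, w)" "\<lambda>_. 0"])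
    show "U \<noteq> {}" using \<open>fn (M one) (c, w0) \<noteq> 0\<close> assms(2) by (auto simp: U_def)
    show "fn g (c, z) = 0" if "z \<in> U" for z using * that by (auto simp: U_def)
  qed (use \<open>open U\<close> hol that in \<open>auto simp: U_def\<close>)
  then obtain h where h: "g = Z h - cs c h" using divide_by_z_minus[OF assms(1)] by blast
  define x where "x = f - M h"
  have "Z x = cs c x" using g unfolding h x_def by (simp add: algebra_simps)
  then have "norm x = cmod c * norm x" using norm_shift[of "(1, 0)" x] by simp
  then have "x = 0" using assms(1) by (cases "norm x = 0") auto
  then have "f = M h" by (simp add: x_def)
  moreover have "h = 0" using KK_range_M[of h] assms(4) unfolding \<open>f = M h\<close> .
  ultimately show ?thesis by simp
qed

end

section \<open>A gliding hump, and uniqueness from boundary values on an arc\<close>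

text \<open>Plays the part of uniform boundedness. Each step adds a multiple of \<open>g n\<close>
  of size 3^-n, with the sign that prevents cancellation against the pairing reached so far. All
  later steps together have norm at most 3^-n / 2, so half of each gain survives in the
  limit.\<close>

lemma gliding_hump:
  fixes g :: "nat \<Rightarrow> hardy"
  assumes "\<And>n. norm (g n) = 1"
  shows "\<exists>h. \<forall>n. (1/3) ^ n / 2 \<le> cmod (hinner h (g n))"
proof -
  define x where "x = rec_nat (0 :: hardy)
    (\<lambda>n y. y + (if 0 \<le> inner y (g n) then (1/3) ^ n else - ((1/3) ^ n)) *\<^sub>R g n)"
  have x_Suc: "x (Suc n) = x n + (if 0 \<le> inner (x n) (g n) then (1/3) ^ n else - ((1/3) ^ n)) *\<^sub>R g n" for n
    by (simp add: x_def)
  have step: "norm (x (Suc n) - x n) = (1/3) ^ n" for n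
    unfolding x_Suc by (simp add: assms)
  have hump: "(1/3) ^ n \<le> \<bar>inner (x (Suc n)) (g n)\<bar>" for n
  proof -
    have "inner (g n) (g n) = 1" using assms[of n] by (simp add: norm_eq_sqrt_inner)
    then show ?thesis unfolding x_Suc by (auto simp: inner_add_left)
  qed
  have tele: "norm (x (n + k) - x n) \<le> 3/2 * ((1/3) ^ n - (1/3) ^ (n + k))" for n k
  proof (induction k)
    case (Suc k)
    have "norm (x (n + Suc k) - x n) \<le> norm (x (Suc (n + k)) - x (n + k)) + norm (x (n + k) - x n)"
      using norm_triangle_ineq[of "x (Suc (n + k)) - x (n + k)" "x (n + k) - x n"] by simp
    moreover define p q where "p = (1/3 :: real) ^ n" and "q = (1/3 :: real) ^ (n + k)"
    ultimately show ?case
      using Suc step[of "n + k"] unfolding add_Suc_right power_Suc p_def[symmetric] q_def[symmetric]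
      by argo
  qed simp
  have tail: "norm (x m - x n) \<le> 3/2 * (1/3) ^ n" if "n \<le> m" for m n
  proof -
    have "norm (x m - x n) \<le> 3/2 * ((1/3) ^ n - (1/3) ^ m)" using tele[of n "m - n"] that by simp
    also have "\<dots> \<le> 3/2 * (1/3) ^ n" by simp
    finally show ?thesis .
  qed
  have "Cauchy x"
  proof (rule CauchyI')
    fix e :: real assume "e > 0"
    then obtain N where "(1/3 :: real) ^ N < 2/3 * e" using real_arch_pow_inv[of "2/3 * e" "1/3"] by auto
    then have "\<forall>m\<ge>N. \<forall>n>m. dist (x m) (x n) < e"
    proof (intro allI impI)
      fix m n assume "N \<le> m" "m < n"
      have "dist (x m) (x n) \<le> 3/2 * (1/3) ^ m" using tail[of m n] \<open>m < n\<close> by (simp add: dist_norm norm_minus_commute)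
      also have "\<dots> \<le> 3/2 * (1/3) ^ N" using power_decreasing[OF \<open>N \<le> m\<close>, of "1/3 :: real"] by simp
      also have "\<dots> < e" using \<open>(1/3) ^ N < 2/3 * e\<close> by simp
      finally show "dist (x m) (x n) < e" .
    qed
    then show "\<exists>N. \<forall>m\<ge>N. \<forall>n>m. dist (x m) (x n) < e" by blast
  qed
  then obtain h where h: "x \<longlonglongrightarrow> h" by (auto simp: Cauchy_convergent_iff convergent_def)
  have "(1/3) ^ n / 2 \<le> cmod (hinner h (g n))" for n
  proof -
    have "norm (h - x (Suc n)) \<le> 3/2 * (1/3) ^ Suc n"
    proof (rule LIMSEQ_le_const2)
      show "(\<lambda>m. norm (x m - x (Suc n))) \<longlonglongrightarrow> norm (h - x (Suc n))" by (intro tendsto_intros h)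
    qed (use tail in blast)
    then have "\<bar>inner (h - x (Suc n)) (g n)\<bar> \<le> (1/3) ^ n / 2"
      using Cauchy_Schwarz_ineq2[of "h - x (Suc n)" "g n"] assms[of n] by simp
    then have "(1/3) ^ n / 2 \<le> \<bar>inner h (g n)\<bar>" using hump[of n] unfolding inner_diff_left by linarith
    also have "\<dots> \<le> cmod (hinner h (g n))" unfolding inner_hardy_def by (rule abs_Re_le_cmod)
    finally show ?thesis .
  qed
  then show ?thesis by blast
qed

text \<open>The map \<Phi>(u) = c exp(i u) sends the real line to the circle and the upper
  half-plane into the disc. Composing \<open>g\<close> with it and continuing by 0 below the line
  gives a function that is holomorphic across the line and vanishes in the lower half, hence
  everywhere near 0.\<close>

lemma holomorphic_zero_arc:
  assumes g: "g holomorphic_on \<D>" and c: "cmod c = 1" "\<epsilon> > 0"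
    and lim: "\<And>\<zeta>. cmod \<zeta> = 1 \<Longrightarrow> \<zeta> \<in> ball c \<epsilon> \<Longrightarrow> (g \<longlongrightarrow> 0) (at \<zeta> within \<D>)"
    and z: "z \<in> \<D>"
  shows "g z = 0"
proof -
  define \<Phi> where "\<Phi> = (\<lambda>u. c * exp (\<i> * u))"
  have \<Phi>c: "isCont \<Phi> u" for u unfolding \<Phi>_def by (intro continuous_intros)
  have \<Phi>h: "\<Phi> holomorphic_on S" for S unfolding \<Phi>_def by (intro holomorphic_intros)
  have n\<Phi>: "cmod (\<Phi> u) = exp (- Im u)" for u by (simp add: \<Phi>_def norm_mult c)
  have "\<Phi> \<midarrow>0\<rightarrow> c" using \<Phi>c[of 0] by (simp add: isCont_def \<Phi>_def)
  then have "\<forall>\<^sub>F u in nhds 0. \<Phi> u \<in> ball c \<epsilon>"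
    using c(2) \<Phi>c[of 0] unfolding continuous_at tendsto_at_iff_tendsto_nhds
    by (intro topological_tendstoD[of \<Phi> "\<Phi> 0"]) (auto simp: \<Phi>_def)
  then obtain r where r: "r > 0" "\<And>u. u \<in> ball 0 r \<Longrightarrow> \<Phi> u \<in> ball c \<epsilon>"
    unfolding eventually_nhds_metric by (auto simp: dist_commute)
  define F where "F = (\<lambda>u. if Im u > 0 then g (\<Phi> u) else 0)"
  have up: "(\<lambda>u. g (\<Phi> u)) holomorphic_on (ball 0 r \<inter> {u. Im u > 0})"
  proof -
    have "\<Phi> ` (ball 0 r \<inter> {u :: complex. Im u > 0}) \<subseteq> \<D>" by (auto simp: n\<Phi>)
    from holomorphic_on_compose_gen[OF \<Phi>h g this] show ?thesis by (simp add: o_def)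
  qed
  have hol: "F holomorphic_on ball 0 r"
  proof (rule holomorphic_on_paste_across_line[of _ \<i> _ 0])
    show "F holomorphic_on (ball 0 r \<inter> {z. \<i> \<bullet> z < 0})"
      by (rule holomorphic_transform[of "\<lambda>_. 0"]) (auto simp: F_def inner_complex_def)
    show "F holomorphic_on (ball 0 r \<inter> {z. 0 < \<i> \<bullet> z})"
      by (rule holomorphic_transform[of "\<lambda>u. g (\<Phi> u)"]) (use up in \<open>auto simp: F_def inner_complex_def\<close>)
    show "continuous_on (ball 0 r) F"
    proof (rule continuous_at_imp_continuous_on, rule ballI)
      fix u :: complex assume u: "u \<in> ball 0 r"
      consider "Im u > 0" | "Im u < 0" | "Im u = 0" by linarith
      then show "isCont F u"
      proof cases
        case 1
        have "open (ball 0 r \<inter> {u. Im u > 0})" by (intro open_Int open_ball open_halfspace_Im_gt)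
        then have "isCont (\<lambda>u. g (\<Phi> u)) u"
          using holomorphic_on_imp_continuous_on[OF up] 1 u by (simp add: continuous_on_eq_continuous_at)
        moreover have "\<forall>\<^sub>F v in nhds u. F v = g (\<Phi> v)"
          using eventually_nhds_in_open[OF open_halfspace_Im_gt[of 0], of u] 1
          by (auto elim!: eventually_mono simp: F_def)
        ultimately show ?thesis by (simp add: isCont_cong)
      next
        case 2
        have "\<forall>\<^sub>F v in nhds u. F v = 0"
          using eventually_nhds_in_open[OF open_halfspace_Im_lt[of 0], of u] 2
          by (auto elim!: eventually_mono simp: F_def)
        then show ?thesis by (simp add: isCont_cong)
      next
        case 3
        have "cmod (\<Phi> u) = 1" by (simp add: n\<Phi> 3)
        from lim[OF this r(2)[OF u]] have *: "(g \<longlongrightarrow> 0) (at (\<Phi> u) within \<D>)" .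
        have "F \<midarrow>u\<rightarrow> 0"
        proof (rule metric_LIM_I)
          fix e :: real assume "e > 0"
          then obtain d where d: "d > 0" "\<And>v. v \<in> \<D> \<Longrightarrow> v \<noteq> \<Phi> u \<Longrightarrow> dist v (\<Phi> u) < d \<Longrightarrow> dist (g v) 0 < e"
            using * unfolding tendsto_iff eventually_at by (metis (no_types, lifting))
          obtain s where s: "s > 0" "\<And>v. dist v u < s \<Longrightarrow> dist (\<Phi> v) (\<Phi> u) < d"
            using \<Phi>c[of u] \<open>d > 0\<close> unfolding continuous_at_eps_delta by metis
          have "dist (F v) 0 < e" if "v \<noteq> u" "dist v u < s" for v
          proof (cases "Im v > 0")
            case True
            then have "\<Phi> v \<in> \<D>" by (simp add: n\<Phi>)
            moreover have "\<Phi> v \<noteq> \<Phi> u" using True n\<Phi>[of v] n\<Phi>[of u] 3 by auto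
            ultimately show ?thesis using d(2) s(2)[OF that(2)] True by (simp add: F_def)
          qed (use \<open>e > 0\<close> in \<open>simp add: F_def\<close>)
          then show "\<exists>s>0. \<forall>v. v \<noteq> u \<and> dist v u < s \<longrightarrow> dist (F v) 0 < e" using s(1) by blast
        qed
        then show ?thesis by (simp add: isCont_def F_def 3)
      qed
    qed
  qed auto
  have F0: "F u = 0" if "u \<in> ball 0 r" for u
  proof (rule analytic_continuation_open[of "ball 0 r \<inter> {u. Im u < 0}" "ball 0 r" F "\<lambda>_. 0"])
    have "Complex 0 (- r / 2) \<in> ball 0 r \<inter> {u. Im u < 0}"
      using r(1) by (simp add: cmod_def)
    then show "ball 0 r \<inter> {u. Im u < 0} \<noteq> {}" by blast
    show "open (ball 0 r \<inter> {u. Im u < 0})" by (intro open_Int open_ball open_halfspace_Im_lt)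
  qed (use that hol in \<open>auto simp: F_def\<close>)
  \<comment> \<open>Continuation from the image of \<Phi> to the whole disc needs zeros of
    \<open>g\<close> accumulating inside the disc: the points \<open>y n\<close> lie on the radius
    through \<open>c\<close> and tend to \<xi>.\<close>
  define \<xi> where "\<xi> = \<Phi> (\<i> * (r / 2))"
  define y where "y = (\<lambda>n. \<Phi> (\<i> * (r / 2 - r / 4 / real (Suc n))))"
  have pos: "0 < r / 2 - r / 4 / real (Suc n)" "r / 2 - r / 4 / real (Suc n) < r" for n
    using r(1) by (auto simp: field_simps add_pos_nonneg)
  show ?thesis
  proof (rule analytic_continuation[of g \<D> "range y" \<xi>])
    show "\<xi> \<in> \<D>" using r(1) by (simp add: \<xi>_def n\<Phi>)
    show "range y \<subseteq> \<D>" using pos(1) by (auto simp: y_def n\<Phi>)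
    show "g v = 0" if "v \<in> range y" for v
    proof -
      obtain n where v: "v = y n" using \<open>v \<in> range y\<close> by auto
      define u where "u = \<i> * complex_of_real (r / 2 - r / 4 / real (Suc n))"
      have u: "Im u = r / 2 - r / 4 / real (Suc n)" "cmod u = \<bar>r / 2 - r / 4 / real (Suc n)\<bar>"
        unfolding u_def by (simp_all only: norm_mult norm_ii norm_of_real mult_1_left Im_i_times Re_complex_of_real)
      then have "u \<in> ball 0 r" using pos[of n] by simp
      from F0[OF this] show ?thesis using u pos(1)[of n] by (simp add: F_def v y_def u_def)
    qed
    show "\<xi> islimpt range y"
      unfolding islimpt_sequential
    proof (intro exI conjI allI)
      fix n
      have "cmod (y n) \<noteq> cmod \<xi>" using r(1) by (simp add: y_def \<xi>_def n\<Phi>)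
      then show "y n \<in> range y - {\<xi>}" by auto
    next
      have "(\<lambda>n. \<i> * complex_of_real (r / 2 - r / 4 / real (Suc n))) \<longlonglongrightarrow> \<i> * complex_of_real (r / 2 - 0)"
        by (intro tendsto_intros LIMSEQ_Suc[OF lim_const_over_n])
      then show "y \<longlonglongrightarrow> \<xi>"
        unfolding y_def \<xi>_def using isCont_tendsto_compose[OF \<Phi>c] by fastforce
    qed
  qed (use g z in auto)
qed

text \<open>The geometric series in recursive form, a shape that survives the application of
  \<open>M\<close>.\<close>

lemma ker_eq_one_plus: "cmod z < 1 \<Longrightarrow> ker z 0 = one + cs (cnj z) (Z (ker z 0))"
  by (rule hardy_eqI) (auto simp: coef_shift coef_one power_0_left power_eq_if)

section \<open>Closed range at a point of the circle\<close>

context inner_multiplier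
begin

text \<open>Suppose unit vectors \<open>g n\<close> have images under \<open>A_adj c\<close> of norm
  at most 4^-n. The hump vector \<open>h\<close> pairs with them at size at least 3^-n / 2, yet a
  preimage \<open>f\<close> of \<open>pr h\<close> bounds the same pairings by \<open>norm f\<close>
  times 4^-n, and (4/3)^n is unbounded.\<close>

lemma A_adj_bounded_below:
  assumes surj: "KK \<subseteq> A c ` KK"
  shows "\<exists>\<delta>>0. \<forall>g\<in>KK. \<delta> * norm g \<le> norm (A_adj c g)"
proof (rule ccontr)
  assume "\<not> ?thesis"
  then have "\<exists>g\<in>KK. norm (A_adj c g) < (1/4) ^ n * norm g" for n
    by (metis linorder_not_le zero_less_divide_1_iff zero_less_numeral zero_less_power)
  then obtain G where G: "\<And>n. G n \<in> KK" "\<And>n. norm (A_adj c (G n)) < (1/4) ^ n * norm (G n)" by metis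
  define g where "g = (\<lambda>n. cs (of_real (1 / norm (G n))) (G n))"
  have ne: "norm (G n) > 0" for n using G(2)[of n] by (cases "G n = 0") auto
  have g: "g n \<in> KK" "norm (g n) = 1" "norm (A_adj c (g n)) \<le> (1/4) ^ n" for n
    using G(1)[of n] ne[of n] less_imp_le[OF G(2)[of n]] by (auto simp: g_def norm_divide field_simps)
  obtain h where h: "\<And>n. (1/3) ^ n / 2 \<le> cmod (hinner h (g n))" using gliding_hump[of g] g(2) by blast
  obtain f where f: "pr h = A c f" using surj pr_simps(1) by blast
  have "(1/3) ^ n / 2 \<le> norm f * (1/4) ^ n" for n
  proof -
    have "(1/3) ^ n / 2 \<le> cmod (hinner f (A_adj c (g n)))"
      using h[of n] hinner_pr[OF g(1), of h n] hinner_A[OF g(1), of c f n] unfolding f by simp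
    also have "\<dots> \<le> norm f * norm (A_adj c (g n))" by (rule hinner_bound)
    also have "\<dots> \<le> norm f * (1/4) ^ n" by (intro mult_left_mono g) simp
    finally show ?thesis .
  qed
  then have "(4/3) ^ n \<le> 2 * norm f" for n
    by (simp add: power_divide field_simps)
  moreover obtain n where "2 * norm f < (4/3) ^ n" using real_arch_pow[of "4/3"] by auto
  ultimately show False by (meson linorder_not_le)
qed

lemma M_adj_ker:
  assumes "cmod z < 1" "cmod w < 1"
  shows "M_adj (ker z w) = cs (cnj (\<theta> (z, w))) (ker z w)"
proof (rule hinner_eqI)
  fix y
  have e: "hinner (ker z w) x = cnj (fn x (z, w))" for x
    using assms hinner_commute[of "ker z w" x] by (simp add: fn_def)
  show "hinner (M_adj (ker z w)) y = hinner (cs (cnj (\<theta> (z, w))) (ker z w)) y"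
    using assms by (simp add: hinner_M_adj e fn_M)
qed

lemma norm_pr_ker:
  assumes "cmod z < 1" "cmod w < 1"
  shows "(norm (pr (ker z w)))\<^sup>2 = (1 - (cmod (\<theta> (z, w)))\<^sup>2) * (norm (ker z w))\<^sup>2"
  using norm_pr[of "ker z w"] by (simp add: M_adj_ker[OF assms] power_mult_distrib algebra_simps)

lemma norm_ker_pos: "cmod z < 1 \<Longrightarrow> cmod w < 1 \<Longrightarrow> norm (ker z w) > 0"
  using coef_ker[of z w 0 0] by (auto simp del: coef_ker)

lemma norm_\<theta>_le_1:
  assumes "cmod z < 1" "cmod w < 1"
  shows "cmod (\<theta> (z, w)) \<le> 1"
proof -
  have "0 \<le> (1 - (cmod (\<theta> (z, w)))\<^sup>2) * (norm (ker z w))\<^sup>2"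
    unfolding norm_pr_ker[OF assms, symmetric] by simp
  then have "(cmod (\<theta> (z, w)))\<^sup>2 \<le> 1"
    using norm_ker_pos[OF assms] by (simp add: zero_le_mult_iff)
  then show ?thesis by (simp add: abs_square_le_1)
qed

text \<open>The test vector is the projection \<open>f\<close> of the kernel \<open>k\<close> at (l,
  0). As \<open>k\<close> is an eigenvector of \<open>Bz\<close>, applying \<open>Bz\<close> minus
  \<open>cnj l\<close> to \<open>f\<close> leaves, up to sign, \<open>t\<close> times the backward
  shift of \<open>M one\<close>, of norm at most 1. Passing from l to c costs half of the lower
  bound \<delta>.\<close>

lemma bounded_below_imp_\<theta>_near_circle:
  assumes \<delta>: "\<delta> > 0" "\<And>g. g \<in> KK \<Longrightarrow> \<delta> * norm g \<le> norm (A_adj c g)"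
    and l: "cmod l < 1" "cmod (l - c) \<le> \<delta> / 2"
  shows "(\<delta> / 2)\<^sup>2 * (1 - (cmod (\<theta> (l, 0)))\<^sup>2) \<le> 1 - (cmod l)\<^sup>2"
proof -
  define k where "k = ker l 0"
  define t where "t = cnj (\<theta> (l, 0))"
  have k: "k = one + cs (cnj l) (Z k)" unfolding k_def by (rule ker_eq_one_plus[OF l(1)])
  have Bk: "Bz k = cs (cnj l) k" using backshift_ker[of l 0 "Suc 0" 0] l(1) by (simp add: k_def)
  have "M k = M one + cs (cnj l) (Z (M k))" using arg_cong[OF k, of M] by simp
  then have "Bz (M k) = Bz (M one) + cs (cnj l) (M k)" by (metis backshift_linear(1,3) backshift_shift)
  then have BMk: "Bz (M k) - cs (cnj l) (M k) = Bz (M one)" by simp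
  define f where "f = pr k"
  have f: "f = k - cs t (M k)" using l(1) by (simp add: f_def pr_def k_def M_adj_ker t_def)
  have "Bz f - cs (cnj l) f = - cs t (Bz (M k) - cs (cnj l) (M k))"
    unfolding f by (simp add: Bk mult.commute)
  then have "norm (Bz f - cs (cnj l) f) \<le> cmod t * norm one"
    unfolding BMk using norm_backshift[of "(Suc 0, 0)" "M one"] by (simp add: mult_left_mono)
  also have "norm one = 1" using norm_ker[of 0 0] by (simp add: one_def abs_square_eq_1)
  also have "cmod t * 1 \<le> 1" using norm_\<theta>_le_1[of l 0] l(1) by (simp add: t_def)
  finally have 1: "norm (Bz f - cs (cnj l) f) \<le> 1" .
  have "A_adj c f = (Bz f - cs (cnj l) f) + cs (cnj (l - c)) f"
    by (simp add: A_adj_def cs_diff_left)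
  then have "norm (A_adj c f) \<le> 1 + \<delta> / 2 * norm f"
    using norm_triangle_ineq[of "Bz f - cs (cnj l) f" "cs (cnj (l - c)) f"] 1
      mult_right_mono[OF l(2), of "norm f"] unfolding norm_cs complex_mod_cnj by simp
  moreover have "f \<in> KK" by (simp add: f_def)
  ultimately have "\<delta> / 2 * norm f \<le> 1" using \<delta>(2)[of f] by simp
  then have "(\<delta> / 2 * norm f)\<^sup>2 \<le> 1" using \<delta>(1) by (simp add: abs_square_le_1)
  then have "(\<delta> / 2)\<^sup>2 * (norm f)\<^sup>2 \<le> 1" by (simp only: power_mult_distrib)
  moreover have "(norm f)\<^sup>2 = (1 - (cmod (\<theta> (l, 0)))\<^sup>2) / (1 - (cmod l)\<^sup>2)"
    unfolding f_def k_def using norm_pr_ker[of l 0] norm_ker[of l 0] l(1) by simp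
  moreover have "1 - (cmod l)\<^sup>2 > 0" using l(1) by (simp add: abs_square_less_1)
  ultimately show ?thesis by (simp only: times_divide_eq_right pos_divide_le_eq mult_1_left)
qed

lemma \<theta>_eq_zcoef:
  assumes "cmod z < 1"
  shows "\<theta> (z, 0) = zcoef (M one) 0 z"
proof -
  have "shift (0, 0) x = x" for x by (rule hardy_eqI) (simp add: coef_shift)
  moreover have "\<theta> (z, 0) = fn (M one) (z, 0)" using assms by (simp add: fn_M fn_one)
  ultimately show ?thesis using assms by (simp add: zcoef_def fn_def)
qed

text \<open>Two terms of Parseval on the slice, where |\<theta>| \<le> 1. They are extracted by
  pairing \<open>M k\<close> with the combination of \<open>k\<close> and w^n k whose weights are
  the two coefficients themselves.\<close>

lemma zcoef_square_le:
  assumes z: "cmod z < 1" and n: "n > 0"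
  shows "(cmod (zcoef (M one) n z))\<^sup>2 \<le> 1 - (cmod (\<theta> (z, 0)))\<^sup>2"
proof -
  define k e a b where "k = ker z 0" and "e = shift (0, n) k" and "a = zcoef (M one) 0 z" and "b = zcoef (M one) n z"
  define K where "K = (norm k)\<^sup>2"
  have K: "K = 1 / (1 - (cmod z)\<^sup>2)" using norm_ker[of z 0] z by (simp add: K_def k_def)
  have z2: "1 - (cmod z)\<^sup>2 > 0" using z by (simp add: abs_square_less_1)
  \<comment> \<open>The recursion for \<open>k\<close> turns this inner product into an equation h =
    coefficient + |z|^2 h, whose solution carries the factor K = 1 / (1 - |z|^2).\<close>
  have hk: "hinner (M k) (shift (0, j) k) = of_real K * zcoef (M one) j z" for j
  proof -
    define h where "h = hinner (M k) (shift (0, j) k)"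
    have "M k = M one + cs (cnj z) (Z (M k))"
      using arg_cong[OF ker_eq_one_plus[OF z], of M] by (simp add: k_def)
    then have "h = hinner (M one) (shift (0, j) k) + cnj z * hinner (Z (M k)) (shift (0, j) k)"
      unfolding h_def by (metis hinner_add_left hinner_cs_left)
    also have "hinner (Z (M k)) (shift (0, j) k) = z * h"
      using backshift_ker[of z 0 "Suc 0" 0] z by (simp add: hinner_shift[of "(Suc 0, 0)"] shift_commute k_def h_def)
    finally have "h = zcoef (M one) j z + (cnj z * z) * h" by (simp add: zcoef_def k_def mult.assoc)
    then have "(1 - of_real ((cmod z)\<^sup>2)) * h = zcoef (M one) j z"
      unfolding complex_norm_square by (simp add: algebra_simps)
    moreover have "1 - complex_of_real ((cmod z)\<^sup>2) = of_real (1 - (cmod z)\<^sup>2)" by simp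
    ultimately have "of_real (1 - (cmod z)\<^sup>2) * h = zcoef (M one) j z" by simp
    moreover have "K * (1 - (cmod z)\<^sup>2) = 1" using z2 by (simp add: K)
    ultimately show ?thesis unfolding h_def[symmetric]
      by (metis mult.assoc mult_1 of_real_1 of_real_mult)
  qed
  have s0: "shift (0, 0) x = x" for x by (rule hardy_eqI) (simp add: coef_shift)
  define f where "f = cs a k + cs b e"
  define s where "s = (cmod a)\<^sup>2 + (cmod b)\<^sup>2"
  have hf: "hinner (M k) f = of_real (K * s)"
    using hk[of 0] hk[of n] unfolding f_def s_def of_real_mult of_real_add complex_norm_square
    by (simp add: hinner_add_right e_def s0 a_def b_def algebra_simps)
  have ek: "hinner e k = 0"
    using backshift_ker[of z 0 0 n] z n by (simp add: e_def hinner_shift k_def power_0_left)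
  have ke: "hinner k e = 0" using hinner_commute[of k e] ek by simp
  have ee: "hinner e e = of_real K" and kk: "hinner k k = of_real K"
    by (simp_all add: e_def K_def hinner_self)
  have "complex_of_real ((norm f)\<^sup>2) = of_real (K * s)"
    unfolding hinner_self[symmetric] f_def s_def of_real_mult of_real_add complex_norm_square
    by (simp add: hinner_algebra ek ke ee kk algebra_simps)
  then have nf: "(norm f)\<^sup>2 = K * s" by (simp only: of_real_eq_iff)
  have s: "s \<ge> 0" by (simp add: s_def)
  have K0: "K > 0" using K z2 by simp
  \<comment> \<open>Cauchy-Schwarz now reads (K s)^2 \<le> K (K s), that is s \<le> 1.\<close>
  have "K * s = cmod (hinner (M k) f)" unfolding hf norm_of_real using s K0 by simp
  also have "\<dots> \<le> norm k * norm f" using hinner_bound[of "M k" f] by simp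
  finally have "(K * s)\<^sup>2 \<le> (norm k * norm f)\<^sup>2" using s K0 by (intro power_mono) auto
  then have "K * K * (s * s) \<le> K * K * s" unfolding power_mult_distrib nf K_def[symmetric] by (simp add: power2_eq_square algebra_simps)
  then have "s * s \<le> s" using K0 by simp
  then have "s \<le> 1" using s by (cases "s = 0") (auto simp: mult_le_cancel_right1)
  then show ?thesis using \<theta>_eq_zcoef[OF z] by (simp add: s_def a_def b_def)
qed

text \<open>Separated from the operator theory because it serves twice: after a closed range on the
  circle, and when \<open>q\<close> has no zero over a point of the circle.\<close>

lemma depends_only_on_z:
  assumes c: "cmod c = 1" "\<epsilon> > 0"
    and lim: "\<And>\<zeta>. cmod \<zeta> = 1 \<Longrightarrow> \<zeta> \<in> ball c \<epsilon> \<Longrightarrow> ((\<lambda>z. 1 - (cmod (\<theta> (z, 0)))\<^sup>2) \<longlongrightarrow> 0) (at \<zeta> within \<D>)"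
    and zw: "cmod z < 1" "cmod w < 1"
  shows "\<theta> (z, w) = \<theta> (z, 0)"
proof -
  have 0: "zcoef (M one) n z = 0" if n: "n > 0" for n
  proof (rule holomorphic_zero_arc[OF holomorphic_zcoef c])
    fix \<zeta> assume \<zeta>: "cmod \<zeta> = 1" "\<zeta> \<in> ball c \<epsilon>"
    have "((\<lambda>z. (cmod (zcoef (M one) n z))\<^sup>2) \<longlongrightarrow> 0) (at \<zeta> within \<D>)"
    proof (rule tendsto_sandwich[OF _ _ tendsto_const lim[OF \<zeta>]])
      show "\<forall>\<^sub>F z in at \<zeta> within \<D>. (cmod (zcoef (M one) n z))\<^sup>2 \<le> 1 - (cmod (\<theta> (z, 0)))\<^sup>2"
        using zcoef_square_le[OF _ n] by (auto simp: eventually_at_filter intro!: always_eventually)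
    qed auto
    from tendsto_real_sqrt[OF this] show "(zcoef (M one) n \<longlongrightarrow> 0) (at \<zeta> within \<D>)"
      by (simp add: tendsto_norm_zero_iff)
  qed (use zw in auto)
  have "fn (M one) (z, v) = zcoef (M one) 0 z" if "cmod v < 1" for v
    using has_sum_unique[OF fn_has_sum_zcoef[OF zw(1) that, of "M one"] has_sum_finite_neutralI[of "{0}"]] 0
    by simp
  from this[of w] this[of 0] show ?thesis using zw by (simp add: fn_M fn_one)
qed

text \<open>The adjoint has no eigenvector for a unimodular eigenvalue, so a closed range is all of
  \<open>KK\<close>. The lower bound obtained at the single point \<open>c\<close> then serves the
  whole arc within \<delta> / 2 of it.\<close>

lemma closed_range_on_circle:
  assumes c: "cmod c = 1" and closed: "closed (A c ` KK)"
    and zw: "cmod z < 1" "cmod w < 1"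
  shows "\<theta> (z, w) = \<theta> (z, 0)"
proof -
  have "KK \<subseteq> A c ` KK"
  proof
    fix x assume "x \<in> KK"
    then show "x \<in> A c ` KK"
    proof (rule closed_range_A[OF closed])
      fix g assume "A_adj c g = 0"
      then have "g = 0" using backshift_eigen_eq_0[of "Suc 0" 0 g "cnj c"] c by (simp add: A_adj_eigen)
      then show "hinner x g = 0" by simp
    qed
  qed
  then obtain \<delta> where \<delta>: "\<delta> > 0" "\<And>g. g \<in> KK \<Longrightarrow> \<delta> * norm g \<le> norm (A_adj c g)"
    using A_adj_bounded_below by blast
  show ?thesis
  proof (rule depends_only_on_z[OF c, of "\<delta> / 2"])
    fix \<zeta> assume \<zeta>: "cmod \<zeta> = 1" "\<zeta> \<in> ball c (\<delta> / 2)"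
    show "((\<lambda>z. 1 - (cmod (\<theta> (z, 0)))\<^sup>2) \<longlongrightarrow> 0) (at \<zeta> within \<D>)"
    proof (rule tendsto_sandwich[of "\<lambda>_. 0" _ _ "\<lambda>z. (1 - (cmod z)\<^sup>2) / (\<delta> / 2)\<^sup>2"])
      show "\<forall>\<^sub>F z in at \<zeta> within \<D>. 0 \<le> 1 - (cmod (\<theta> (z, 0)))\<^sup>2"
        using norm_\<theta>_le_1[of _ 0] by (auto simp: eventually_at_filter abs_square_le_1 intro!: always_eventually)
      have "\<forall>\<^sub>F z in at \<zeta> within \<D>. z \<in> ball c (\<delta> / 2)"
        using eventually_nhds_in_open[OF open_ball \<zeta>(2)] by (auto simp: eventually_at_filter elim: eventually_mono)
      moreover have "\<forall>\<^sub>F z in at \<zeta> within \<D>. z \<in> \<D>" by (auto simp: eventually_at_filter)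
      ultimately show "\<forall>\<^sub>F z in at \<zeta> within \<D>. 1 - (cmod (\<theta> (z, 0)))\<^sup>2 \<le> (1 - (cmod z)\<^sup>2) / (\<delta> / 2)\<^sup>2"
      proof eventually_elim
        case (elim z)
        then have "(\<delta> / 2)\<^sup>2 * (1 - (cmod (\<theta> (z, 0)))\<^sup>2) \<le> 1 - (cmod z)\<^sup>2"
          by (intro bounded_below_imp_\<theta>_near_circle[OF \<delta>]) (auto simp: dist_norm norm_minus_commute)
        then show ?case using \<delta>(1) by (simp add: pos_le_divide_eq mult.commute)
      qed
      have "((\<lambda>z. (1 - (cmod z)\<^sup>2) / (\<delta> / 2)\<^sup>2) \<longlongrightarrow> (1 - (cmod \<zeta>)\<^sup>2) / (\<delta> / 2)\<^sup>2) (at \<zeta> within \<D>)"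
        using \<delta>(1) by (intro tendsto_intros) auto
      then show "((\<lambda>z. (1 - (cmod z)\<^sup>2) / (\<delta> / 2)\<^sup>2) \<longlongrightarrow> 0) (at \<zeta> within \<D>)" using \<zeta>(1) by simp
    qed auto
  qed (use \<delta>(1) zw in auto)
qed

end

section \<open>Polynomials in the second variable\<close>

definition pw :: "complex poly \<Rightarrow> hardy \<Rightarrow> hardy" where
  "pw p x = (\<Sum>i\<le>degree p. cs (coeff p i) (shift (0, i) x))"

text \<open>The adjoint of multiplication by p(w), whence the conjugated coefficients and the
  reversed order in \<open>adjw_mult\<close>.\<close>

definition adjw :: "complex poly \<Rightarrow> hardy \<Rightarrow> hardy" where
  "adjw p f = (\<Sum>i\<le>degree p. cs (cnj (coeff p i)) (backshift (0, i) f))"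

lemma hinner_eqI': "(\<And>z. hinner z x = hinner z y) \<Longrightarrow> x = y"
  by (rule hinner_eqI) (metis hinner_commute)

lemma fn_sum: "fn (\<Sum>i\<in>I. g i) p = (\<Sum>i\<in>I. fn (g i) p)"
  by (induction I rule: infinite_finite_induct) auto

lemma hinner_sum_left: "hinner (\<Sum>i\<in>I. g i) y = (\<Sum>i\<in>I. hinner (g i) y)"
  by (induction I rule: infinite_finite_induct) (auto simp: hinner_add_left)

lemma hinner_sum_right: "hinner y (\<Sum>i\<in>I. g i) = (\<Sum>i\<in>I. hinner y (g i))"
  by (induction I rule: infinite_finite_induct) (auto simp: hinner_add_right)

lemma fn_pw [simp]: "fn (pw p x) (z, w) = poly p w * fn x (z, w)"
  by (simp add: pw_def fn_sum fn_shift poly_altdef sum_distrib_right mult.assoc)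

lemma pw_mult: "pw (p * q) x = pw p (pw q x)"
  by (rule fn_eqI) simp

lemma hinner_pw: "hinner (pw p g) f = hinner g (adjw p f)"
  by (simp add: pw_def adjw_def hinner_sum_left hinner_sum_right hinner_shift)

lemma adjw_mult: "adjw (p * q) f = adjw q (adjw p f)"
  by (rule hinner_eqI') (simp add: hinner_pw[symmetric] pw_mult)

lemma adjw_smult: "adjw (smult a p) f = cs (cnj a) (adjw p f)"
proof (rule hinner_eqI')
  have "pw (smult a p) g = cs a (pw p g)" for g by (rule fn_eqI) simp
  then show "hinner g (adjw (smult a p) f) = hinner g (cs (cnj a) (adjw p f))" for g
    by (simp add: hinner_pw[symmetric])
qed

lemma adjw_linear [simp]: "adjw p (f - g) = adjw p f - adjw p g" "adjw p (cs c f) = cs c (adjw p f)"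
  "adjw p 0 = 0" "adjw p (Bz f) = Bz (adjw p f)"
proof -
  have pwZ: "pw p (Z g) = Z (pw p g)" for g by (rule fn_eqI) (simp add: fn_Z)
  show "adjw p (f - g) = adjw p f - adjw p g" "adjw p (cs c f) = cs c (adjw p f)" "adjw p 0 = 0"
    by (rule hinner_eqI', simp add: hinner_algebra hinner_pw[symmetric])+
  show "adjw p (Bz f) = Bz (adjw p f)"
    by (rule hinner_eqI') (simp add: hinner_pw[symmetric] hinner_shift[symmetric] pwZ)
qed

lemma adjw_1 [simp]: "adjw 1 f = f"
  by (simp add: adjw_def) (rule hardy_eqI, simp)

lemma adjw_linear_factor: "adjw [:-a, 1:] f = Bw f - cs (cnj a) f"
proof -
  have "backshift (0, 0) f = f" by (rule hardy_eqI) simp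
  then show ?thesis by (simp add: adjw_def)
qed

text \<open>A list of roots with repetition lets one linear factor be treated at a time, and its
  length counts zeros with multiplicity.\<close>

definition linprod :: "complex list \<Rightarrow> complex poly" where
  "linprod L = (\<Prod>a\<leftarrow>L. [:-a, 1:])"

lemma linprod_simps [simp]: "linprod [] = 1" "linprod (a # L) = [:-a, 1:] * linprod L"
  "linprod (L @ L') = linprod L * linprod L'"
  by (simp_all add: linprod_def)

lemma adjw_linprod_Cons: "adjw (linprod (a # L)) f = adjw (linprod L) (Bw f - cs (cnj a) f)"
  by (simp only: linprod_simps adjw_mult adjw_linear_factor)

lemma poly_linprod_eq_0_iff: "poly (linprod L) w = 0 \<longleftrightarrow> w \<in> set L"
  by (induction L) auto

text \<open>Roots on the circle are grouped with the outer ones in \<open>Lo\<close>: like these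
  they contribute nothing to kernels, and they are excluded separately where ranges are
  concerned.\<close>

lemma poly_split_roots:
  fixes Q :: "complex poly"
  assumes "Q \<noteq> 0"
  obtains a Li Lo where "a \<noteq> 0" "Q = smult a (linprod Li * linprod Lo)"
    "\<And>w. w \<in> set Li \<longleftrightarrow> poly Q w = 0 \<and> cmod w < 1" "\<And>w. w \<in> set Lo \<longleftrightarrow> poly Q w = 0 \<and> cmod w \<ge> 1"
    "length Li = (\<Sum>w | poly Q w = 0 \<and> cmod w < 1. order w Q)"
proof -
  obtain Li where Li: "mset Li = filter_mset (\<lambda>w. cmod w < 1) (proots Q)" using ex_mset by blast
  obtain Lo where Lo: "mset Lo = filter_mset (\<lambda>w. \<not> cmod w < 1) (proots Q)" using ex_mset by blast
  have lp: "linprod L = (\<Prod>x\<in>#mset L. [:-x, 1:])" for L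
    by (induction L) auto
  have "(\<Prod>x\<in>#proots Q. [:-x, 1:]) = linprod Li * linprod Lo"
  proof -
    have "proots Q = mset Li + mset Lo" unfolding Li Lo by (rule multiset_partition)
    then show ?thesis by (simp add: lp)
  qed
  then have "Q = smult (lead_coeff Q) (linprod Li * linprod Lo)"
    using complex_poly_decompose_multiset[of Q] by simp
  moreover have "set Li = {w. poly Q w = 0 \<and> cmod w < 1}" "set Lo = {w. poly Q w = 0 \<and> \<not> cmod w < 1}"
    using assms arg_cong[OF Li, of set_mset] arg_cong[OF Lo, of set_mset] by auto
  moreover have "length Li = (\<Sum>w | poly Q w = 0 \<and> cmod w < 1. order w Q)"
  proof -
    have "length Li = size (mset Li)" by simp
    also have "\<dots> = (\<Sum>w\<in>set_mset (mset Li). count (mset Li) w)"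
      by (rule size_multiset_overloaded_eq)
    also have "set_mset (mset Li) = {w. poly Q w = 0 \<and> cmod w < 1}"
      unfolding Li using assms by auto
    also have "(\<Sum>w | poly Q w = 0 \<and> cmod w < 1. count (mset Li) w) = (\<Sum>w | poly Q w = 0 \<and> cmod w < 1. order w Q)"
      unfolding Li using assms by (intro sum.cong refl) auto
    finally show ?thesis .
  qed
  ultimately show ?thesis using assms by (intro that[of "lead_coeff Q" Li Lo]) (auto simp: not_less)
qed

text \<open>Each factor leaves an eigenvector of \<open>Bw\<close> with eigenvalue of modulus at
  least 1, hence 0; roots on the circle are covered.\<close>

lemma adjw_outside_inj:
  assumes "\<And>a. a \<in> set L \<Longrightarrow> cmod a \<ge> 1" "adjw (linprod L) f = 0"
  shows "f = 0"
  using assms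
proof (induction L arbitrary: f)
  case (Cons a L)
  have "adjw (linprod L) (Bw f - cs (cnj a) f) = 0"
    using Cons.prems(2) unfolding adjw_linprod_Cons .
  then have "Bw f - cs (cnj a) f = 0" by (rule Cons.IH[rotated]) (use Cons.prems(1) in simp)
  then have "Bw f = cs (cnj a) f" by simp
  then show ?case using backshift_eigen_eq_0[of 0 "Suc 0" f "cnj a"] Cons.prems(1)[of a] by simp
qed simp

text \<open>Each factor w - a is inverted by a resolvent. Unlike in \<open>adjw_outside_inj\<close>,
  the circle is excluded: there w - a is not surjective.\<close>

lemma pw_outside_surj:
  assumes "\<And>a. a \<in> set L \<Longrightarrow> cmod a > 1"
  shows "\<exists>u. pw (linprod L) u = g"
  using assms
proof (induction L arbitrary: g)
  case Nil
  have "pw 1 g = g" by (rule fn_eqI) simp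
  then show ?case by auto
next
  case (Cons a L)
  obtain v where v: "W v - cs a v = g"
    using ex_resolvent_outside[of W a g] Cons.prems by auto
  obtain u where u: "pw (linprod L) u = v" using Cons by fastforce
  have "pw (linprod (a # L)) u = g"
    unfolding linprod_simps pw_mult u v[symmetric] by (rule fn_eqI) (simp add: fn_W algebra_simps)
  then show ?case by blast
qed

section \<open>Joint kernels\<close>

text \<open>For |c| < 1 these are the functions g(w) / (1 - cnj c * z): candidates for kernel
  vectors of the adjoint, before membership in the model space is imposed.\<close>

definition eig :: "complex \<Rightarrow> hardy set" where "eig c = {f. Bz f = cs (cnj c) f}"

definition sol :: "complex \<Rightarrow> complex list \<Rightarrow> hardy set" where
  "sol c L = {f \<in> eig c. adjw (linprod L) f = 0}"

lemma eigI: "Bz f = cs (cnj c) f \<Longrightarrow> f \<in> eig c" and eigD: "f \<in> eig c \<Longrightarrow> Bz f = cs (cnj c) f"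
  by (simp_all add: eig_def)

lemma eig_closed: "f \<in> eig c \<Longrightarrow> g \<in> eig c \<Longrightarrow> f - g \<in> eig c" "f \<in> eig c \<Longrightarrow> cs a f \<in> eig c"
  "f \<in> eig c \<Longrightarrow> Bw f \<in> eig c" "f \<in> eig c \<Longrightarrow> adjw p f \<in> eig c" "0 \<in> eig c"
  by (auto simp: eig_def mult.commute shift_commute adjw_linear(4)[symmetric] simp del: adjw_linear(4))

lemma eig_hinner_eq:
  assumes "f \<in> eig c" "cmod c < 1" "\<And>w. cmod w < 1 \<Longrightarrow> fn x (c, w) = fn y (c, w)"
  shows "hinner x f = hinner y f"
  using eigenvector_orthogonal[OF eigD[OF assms(1)] assms(2), of "x - y"] assms(3)
  by (simp add: hinner_diff_left)

lemma eig_eq_0: "f \<in> eig c \<Longrightarrow> (\<And>n. coef f (0, n) = 0) \<Longrightarrow> f = 0"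
proof (rule hardy_eqI)
  fix m n assume f: "f \<in> eig c" "\<And>n. coef f (0, n) = 0"
  show "coef f (m, n) = coef 0 (m, n)"
    using coef_backshift_eigen[OF eigD[OF f(1)], of 0 m n] f(2) by simp
qed

text \<open>An element of \<open>sol c L\<close> is a linear recurrent sequence whose characteristic roots are the
  conjugates of the entries of \<open>L\<close>, so it is given by its first \<open>length L\<close> terms.\<close>

lemma sol_unique:
  assumes "f \<in> sol c L" "\<And>n. n < length L \<Longrightarrow> coef f (0, n) = 0"
  shows "f = 0"
  using assms
proof (induction L arbitrary: f)
  case Nil
  then show ?case by (simp add: sol_def)
next
  case (Cons a L)
  have f: "f \<in> eig c" using Cons.prems(1) by (simp add: sol_def)
  define y where "y = Bw f - cs (cnj a) f"
  have "adjw (linprod L) y = 0"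
    using Cons.prems(1) unfolding sol_def adjw_linprod_Cons y_def by blast
  then have "y \<in> sol c L" using f by (auto simp: sol_def y_def intro!: eig_closed)
  moreover have "coef y (0, n) = 0" if "n < length L" for n
    using Cons.prems(2)[of n] Cons.prems(2)[of "Suc n"] that by (simp add: y_def)
  ultimately have "y = 0" by (rule Cons.IH)
  then have B: "Bw f = cs (cnj a) f" by (simp add: y_def)
  have "coef f (0, n) = 0" for n
    using coef_backshift_eigen[OF B, of 0 n 0] Cons.prems(2)[of 0] by simp
  then show ?case by (rule eig_eq_0[OF f])
qed

text \<open>The kernel at (c, 0) spans the null space of \<open>Bw\<close> in \<open>eig c\<close>,
  so its multiple \<open>e\<close> prescribes the coefficient at (0, 0). The solution lies in
  \<open>eig c\<close> because \<open>Bz f\<close> and \<open>cs (cnj c) f\<close> solve the same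
  uniquely solvable equation.\<close>

lemma ex_eig_resolvent_inside:
  assumes "cmod c < 1" "cmod a < 1" "y \<in> eig c"
  shows "\<exists>f\<in>eig c. Bw f - cs (cnj a) f = y \<and> coef f (0, 0) = b"
proof -
  define e where "e = cs b (ker c 0)"
  have e: "Bz e = cs (cnj c) e" "Bw e = 0" "coef e (0, 0) = b"
    using backshift_ker[of c 0 "Suc 0" 0] backshift_ker[of c 0 0 "Suc 0"] assms(1) by (simp_all add: e_def mult.commute)
  note ex1 = ex1_resolvent[where V = W and c = "cnj a", OF shift_linear(2)]
  obtain f where f: "cs (cnj a) (W f) + (W y + e) = f"
    using ex1[of "W y + e"] assms(2) by auto
  have "Bw f = Bw (cs (cnj a) (W f) + (W y + e))" by (simp only: f)
  also have "\<dots> = cs (cnj a) f + y" by (simp add: e)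
  finally have B: "Bw f - cs (cnj a) f = y" by simp
  have "Bz f = cs (cnj c) f"
  proof -
    have "Bz (cs (cnj a) (W f) + (W y + e)) = cs (cnj a) (W (Bz f)) + cs (cnj c) (W y + e)"
      using eigD[OF assms(3)] e by (simp add: shift_commute)
    then have "cs (cnj a) (W (Bz f)) + cs (cnj c) (W y + e) = Bz f" unfolding f by simp
    moreover have "cs (cnj a) (W (cs (cnj c) f)) + cs (cnj c) (W y + e) = cs (cnj c) f"
    proof -
      have "cs (cnj a) (W (cs (cnj c) f)) + cs (cnj c) (W y + e) = cs (cnj c) (cs (cnj a) (W f) + (W y + e))"
        by (simp add: mult.commute)
      also have "\<dots> = cs (cnj c) f" by (simp only: f)
      finally show ?thesis .
    qed
    moreover have "\<exists>!u. cs (cnj a) (W u) + cs (cnj c) (W y + e) = u"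
      by (rule ex1) (use assms(2) in simp_all)
    ultimately show ?thesis by blast
  qed
  moreover have "coef f (0, 0) = b"
  proof -
    have "coef f (0, 0) = coef (cs (cnj a) (W f) + (W y + e)) (0, 0)" by (simp only: f)
    also have "\<dots> = b" by (simp add: coef_shift e del: shift_linear)
    finally show ?thesis .
  qed
  ultimately show ?thesis using B by (intro bexI[of _ f]) (auto intro: eigI)
qed

text \<open>A resolvent solves the equation in the whole Hardy space; the failure \<open>e\<close>
  of the solution to lie in \<open>eig c\<close> is an eigenvector of \<open>Bw\<close> with
  eigenvalue of modulus above 1, hence 0.\<close>

lemma ex_eig_resolvent_outside:
  assumes "cmod a > 1" "y \<in> eig c"
  shows "\<exists>f\<in>eig c. Bw f - cs (cnj a) f = y"
proof -
  obtain f where f: "Bw f - cs (cnj a) f = y"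
    using ex_resolvent_outside[of Bw "cnj a" y] assms(1) norm_backshift by auto
  define e where "e = Bz f - cs (cnj c) f"
  have "Bw e - cs (cnj a) e = Bz y - cs (cnj c) y"
    unfolding e_def f[symmetric] by (simp add: shift_commute mult.commute)
  also have "\<dots> = 0" using eigD[OF assms(2)] by simp
  finally have "e = 0" using backshift_eigen_eq_0[of 0 "Suc 0" e "cnj a"] assms(1) by simp
  then show ?thesis using f by (intro bexI[of _ f]) (auto simp: e_def eig_def)
qed

text \<open>The existence half of the dimension count, solving one first-order recurrence per
  root.\<close>

lemma ex_sol:
  assumes "cmod c < 1" "\<And>a. a \<in> set L \<Longrightarrow> cmod a < 1"
  shows "\<exists>f\<in>sol c L. \<forall>n<length L. coef f (0, n) = d n"
  using assms(2)
proof (induction L arbitrary: d)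
  case Nil
  have "0 \<in> sol c []" by (simp add: sol_def eig_closed)
  then show ?case by auto
next
  case (Cons a L)
  \<comment> \<open>The data for \<open>y\<close> are what the factor of \<open>a\<close> makes of
    the prescribed values \<open>d\<close>.\<close>
  obtain y where y: "y \<in> sol c L" "\<And>n. n < length L \<Longrightarrow> coef y (0, n) = d (Suc n) - cnj a * d n"
    using Cons.IH[of "\<lambda>n. d (Suc n) - cnj a * d n"] Cons.prems by auto
  obtain f where f: "f \<in> eig c" "Bw f - cs (cnj a) f = y" "coef f (0, 0) = d 0"
    using ex_eig_resolvent_inside[OF assms(1), of a y "d 0"] Cons.prems y(1) by (auto simp: sol_def)
  have "adjw (linprod (a # L)) f = adjw (linprod L) y"
    unfolding adjw_linprod_Cons f(2) ..
  then have "f \<in> sol c (a # L)" using f(1) y(1) unfolding sol_def by simp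
  moreover have "coef f (0, n) = d n" if "n < length (a # L)" for n
    using that
  proof (induction n)
    case (Suc n)
    have "coef f (0, Suc n) = coef y (0, n) + cnj a * coef f (0, n)"
      unfolding f(2)[symmetric] by simp
    then show ?case using Suc y(2)[of n] by simp
  qed (simp add: f(3))
  ultimately show ?case by blast
qed

text \<open>Roots inside and outside are handled by different resolvents; on the circle neither
  exists.\<close>

lemma adjw_eig_surj:
  assumes "cmod c < 1" "\<And>a. a \<in> set L \<Longrightarrow> cmod a \<noteq> 1" "y \<in> eig c"
  shows "\<exists>d\<in>eig c. adjw (linprod L) d = y"
  using assms(2,3)
proof (induction L arbitrary: y)
  case (Cons a L)
  obtain x where x: "x \<in> eig c" "adjw (linprod L) x = y" using Cons by auto
  have "cmod a < 1 \<or> cmod a > 1" using Cons.prems(1)[of a] by auto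
  then obtain d where d: "d \<in> eig c" "Bw d - cs (cnj a) d = x"
    using ex_eig_resolvent_inside[OF assms(1) _ x(1), of a 0] ex_eig_resolvent_outside[OF _ x(1), of a] by blast
  have "adjw (linprod (a # L)) d = y"
    unfolding adjw_linprod_Cons d(2) by (rule x(2))
  then show ?case using d(1) by blast
qed auto

text \<open>Synthetic division, root by root. The degree bound is stated on coefficients so that an
  empty list forces the remainder 0.\<close>

lemma slice_division:
  assumes "cmod c < 1" "\<And>a. a \<in> set L \<Longrightarrow> cmod a < 1"
  shows "\<exists>u R. (\<forall>n\<ge>length L. coeff R n = 0) \<and>
    (\<forall>w. cmod w < 1 \<longrightarrow> fn h (c, w) = poly (linprod L) w * fn u (c, w) + poly R w)"
  using assms(2)
proof (induction L arbitrary: h)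
  case Nil
  then show ?case by (intro exI[of _ h] exI[of _ 0]) auto
next
  case (Cons a L)
  obtain v where v: "\<And>w. cmod w < 1 \<Longrightarrow> fn h (c, w) = fn h (c, a) + (w - a) * fn v (c, w)"
    using divide_by_w_minus[of a h] Cons.prems assms(1) by auto
  obtain u R where u: "\<And>n. n \<ge> length L \<Longrightarrow> coeff R n = 0"
    "\<And>w. cmod w < 1 \<Longrightarrow> fn v (c, w) = poly (linprod L) w * fn u (c, w) + poly R w"
    using Cons.IH[of v] Cons.prems by auto
  define R' where "R' = [:-a, 1:] * R + [:fn h (c, a):]"
  have "coeff R' n = 0" if "n \<ge> length (a # L)" for n
    using that u(1)[of n] u(1)[of "n - 1"] by (cases n) (auto simp: R'_def coeff_pCons)
  moreover have "fn h (c, w) = poly (linprod (a # L)) w * fn u (c, w) + poly R' w" if "cmod w < 1" for w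
    unfolding v[OF that] u(2)[OF that] by (simp add: R'_def algebra_simps)
  ultimately show ?case by blast
qed

lemma hinner_shift_one_left: "hinner (shift k one) f = cnj (coef f k)"
proof -
  have "hinner (shift k one) f = (\<Sum>\<^sub>\<infinity>j. if j = k then cnj (coef f k) else 0)"
    unfolding hinner.rep_eq by (intro infsum_cong) (auto simp: coef_shift_one)
  also have "\<dots> = cnj (coef f k)" by (rule infsumI, rule has_sum_finite_neutralI[of "{k}"]) auto
  finally show ?thesis .
qed

context inner_multiplier
begin

text \<open>Beyond the circle \<open>Z\<close> minus c is already onto the Hardy space, and the
  lower bound holds because \<open>pr\<close> composed with \<open>Z\<close> is a
  contraction.\<close>

lemma A_outside:
  assumes "cmod c > 1"
  shows "A c ` KK = KK" "f \<in> KK \<Longrightarrow> (cmod c - 1) * norm f \<le> norm (A c f)"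
proof -
  have "x \<in> A c ` KK" if "x \<in> KK" for x
  proof -
    obtain u where "Z u - cs c u = x" using ex_resolvent_outside[of Z c x] assms by auto
    then have "x = Z u - cs c u + M 0" by simp
    then show ?thesis using that unfolding range_A_iff by blast
  qed
  then show "A c ` KK = KK" by auto
  assume "f \<in> KK"
  then have e: "pr (Z f) - A c f = cs c f" by (simp add: A_def)
  have "cmod c * norm f \<le> norm (pr (Z f)) + norm (A c f)"
    using norm_triangle_ineq4[of "pr (Z f)" "A c f"] norm_cs[of c f] unfolding e by simp
  also have "norm (pr (Z f)) \<le> norm f" using norm_pr_le[of "Z f"] by simp
  finally show "(cmod c - 1) * norm f \<le> norm (A c f)" by (simp add: algebra_simps)
qed

end

section \<open>A single slice of a rational inner function\<close>

locale rational_slice = inner_multiplier +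
  fixes c :: complex and P Q :: "complex poly" and a :: complex and Li Lo :: "complex list"
  assumes c: "cmod c < 1"
    and PQ: "\<And>w. cmod w < 1 \<Longrightarrow> poly P w * \<theta> (c, w) = poly Q w"
    and P: "\<And>w. cmod w \<le> 1 \<Longrightarrow> poly P w \<noteq> 0"
    and a: "a \<noteq> 0" and Q: "Q = smult a (linprod Li * linprod Lo)"
    and Li: "\<And>w. w \<in> set Li \<longleftrightarrow> poly Q w = 0 \<and> cmod w < 1"
    and Lo: "\<And>w. w \<in> set Lo \<longleftrightarrow> poly Q w = 0 \<and> cmod w \<ge> 1"
begin

lemma fn_M_pw: "cmod w < 1 \<Longrightarrow> fn (M (pw P g)) (c, w) = fn (pw Q g) (c, w)"
  using PQ[of w] c by (simp add: fn_M mult.assoc[symmetric] mult.commute[of "\<theta> (c, w)"])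

lemma P_factor: "\<exists>b L. b \<noteq> 0 \<and> P = smult b (linprod L) \<and> (\<forall>x\<in>set L. cmod x > 1)"
proof -
  have "P \<noteq> 0" using P[of 0] by auto
  then obtain b L L' where b: "b \<noteq> 0" "P = smult b (linprod L * linprod L')"
    "\<And>w. w \<in> set L \<longleftrightarrow> poly P w = 0 \<and> cmod w < 1" "\<And>w. w \<in> set L' \<longleftrightarrow> poly P w = 0 \<and> cmod w \<ge> 1"
    "length L = (\<Sum>w | poly P w = 0 \<and> cmod w < 1. order w P)"
    by (rule poly_split_roots) (rule that; assumption)
  have noroot: "x \<notin> set L" for x
  proof
    assume "x \<in> set L"
    then have "poly P x = 0" "cmod x \<le> 1" using b(3)[of x] by auto
    then show False using P[of x] by blast
  qed
  have "L = []" using noroot[of "hd L"] hd_in_set[of L] by argo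
  moreover have "cmod x > 1" if "x \<in> set L'" for x
  proof (rule ccontr)
    assume "\<not> cmod x > 1"
    moreover have "poly P x = 0" using b(4)[of x] that by blast
    ultimately show False using P[of x] by simp
  qed
  ultimately show ?thesis using b(1,2) by (intro exI[of _ b] exI[of _ L']) simp
qed

text \<open>All roots of \<open>P\<close> lie outside the closed disc, so every element is a
  multiple of \<open>P\<close>; this is how \<theta>(c, .) is traded for the polynomial
  \<open>Q\<close>.\<close>

lemma pw_P_surj: "\<exists>u. pw P u = g"
proof -
  obtain b L where b: "b \<noteq> 0" "P = smult b (linprod L)" "\<And>x. x \<in> set L \<Longrightarrow> cmod x > 1"
    using P_factor by blast
  obtain u where u: "pw (linprod L) u = cs (1 / b) g" using pw_outside_surj[OF b(3)] by blast
  have "pw P u = cs b (pw (linprod L) u)" unfolding b(2) by (rule fn_eqI) simp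
  then show ?thesis using u b(1) by auto
qed

lemma adjw_P_inj: "adjw P f = 0 \<Longrightarrow> f = 0"
proof -
  obtain b L where b: "b \<noteq> 0" "P = smult b (linprod L)" "\<And>x. x \<in> set L \<Longrightarrow> cmod x > 1"
    using P_factor by blast
  assume "adjw P f = 0"
  then have "adjw (linprod L) f = 0" using b(1) by (simp add: b(2) adjw_smult)
  then show ?thesis using adjw_outside_inj[of L f] b(3) less_imp_le by blast
qed

lemma adjw_Q_eq_0_iff: "adjw Q f = 0 \<longleftrightarrow> adjw (linprod Li) f = 0"
proof -
  have "adjw Q f = 0 \<longleftrightarrow> adjw (linprod Lo) (adjw (linprod Li) f) = 0"
    using a by (simp add: Q adjw_smult adjw_mult)
  also have "\<dots> \<longleftrightarrow> adjw (linprod Li) f = 0"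
    using adjw_outside_inj[of Lo "adjw (linprod Li) f"] Lo by auto
  finally show ?thesis .
qed

text \<open>For \<open>f\<close> in \<open>eig c\<close>, membership in \<open>KK\<close> is tested
  on the slice. Writing test elements as \<open>pw P u\<close> replaces \<open>M\<close> by
  \<open>pw Q\<close>, so the condition is that \<open>adjw Q\<close> kills \<open>f\<close>, and of
  \<open>Q\<close> only the inner roots survive.\<close>

lemma ker_A_adj_eq_sol: "{f \<in> KK. A_adj c f = 0} = sol c Li"
proof -
  have "f \<in> KK \<longleftrightarrow> adjw Q f = 0" if f: "f \<in> eig c" for f
  proof
    assume "f \<in> KK"
    have "hinner g (adjw Q f) = 0" for g
    proof -
      have "hinner g (adjw Q f) = hinner (M (pw P g)) f"
        unfolding hinner_pw[symmetric] by (rule eig_hinner_eq[OF f c]) (simp add: fn_M_pw del: fn_pw)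
      also have "\<dots> = 0" using \<open>f \<in> KK\<close> by (simp add: hinner_Ma'[symmetric] KK_def)
      finally show ?thesis .
    qed
    from this[of "adjw Q f"] show "adjw Q f = 0" by (simp add: hinner_self)
  next
    assume 0: "adjw Q f = 0"
    have "hinner (M g) f = 0" for g
    proof -
      obtain u where u: "pw P u = g" using pw_P_surj by blast
      have "hinner (M g) f = hinner (pw Q u) f"
        unfolding u[symmetric] by (rule eig_hinner_eq[OF f c]) (simp add: fn_M_pw del: fn_pw)
      then show ?thesis by (simp add: hinner_pw 0)
    qed
    then show "f \<in> KK" unfolding KK_iff using hinner_commute[of f] by simp
  qed
  then show ?thesis unfolding sol_def adjw_Q_eq_0_iff A_adj_eigen by (auto simp: eig_def)
qed

text \<open>Divide the slice of \<open>x\<close> by the inner roots. The quotient part belongs to (z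
  - c) H^2 + \<theta> H^2 because the outer factors are invertible. The remainder \<open>R\<close>
  is paired with a kernel vector that copies its coefficients; orthogonality makes the sum of their
  squared moduli 0.\<close>

lemma in_range_if_orthogonal:
  assumes circ: "\<And>w. cmod w = 1 \<Longrightarrow> poly Q w \<noteq> 0"
    and x: "x \<in> KK" "\<And>f. f \<in> sol c Li \<Longrightarrow> hinner x f = 0"
  shows "x \<in> A c ` KK"
proof -
  have Li1: "cmod b < 1" if "b \<in> set Li" for b using Li that by blast
  have Lo1: "cmod b > 1" if "b \<in> set Lo" for b using Lo[of b] circ[of b] that by force
  obtain u R where u: "\<And>n. n \<ge> length Li \<Longrightarrow> coeff R n = 0"
    "\<And>w. cmod w < 1 \<Longrightarrow> fn x (c, w) = poly (linprod Li) w * fn u (c, w) + poly R w"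
    using slice_division[OF c Li1, of Li x] by blast
  \<comment> \<open>With this \<open>v\<close>, the slice of \<open>M (pw P v)\<close> is that of
    \<open>Q\<close> times \<open>v\<close>, which is the product of the inner factors with
    \<open>u\<close>.\<close>
  obtain v where v: "pw (linprod Lo) v = cs (1 / a) u" using pw_outside_surj[OF Lo1] by blast
  have "fn (x - M (pw P v) - pw R one) (c, w) = 0" if w: "cmod w < 1" for w
  proof -
    have "poly (linprod Lo) w * fn v (c, w) = fn u (c, w) / a"
      using arg_cong[OF v, of "\<lambda>y. fn y (c, w)"] by simp
    then have "a * (poly (linprod Lo) w * fn v (c, w)) = fn u (c, w)" using a by simp
    then have "poly Q w * fn v (c, w) = poly (linprod Li) w * fn u (c, w)"
      unfolding Q poly_smult poly_mult by (metis mult.assoc mult.left_commute)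
    then show ?thesis using u(2)[OF w] fn_M_pw[OF w, of v] w c by (simp add: fn_one)
  qed
  from divide_by_z_minus[OF c this] obtain y where y: "x - M (pw P v) - pw R one = Z y - cs c y" by blast
  \<comment> \<open>The kernel vector that copies \<open>R\<close>: the remainder has no more
    coefficients than there are inner roots, and that many can be prescribed.\<close>
  obtain f where f: "f \<in> sol c Li" "\<And>n. n < length Li \<Longrightarrow> coef f (0, n) = coeff R n"
    using ex_sol[OF c Li1, of Li "coeff R"] by blast
  have "f \<in> KK" "A_adj c f = 0" using f(1) ker_A_adj_eq_sol by auto
  then have "hinner (M (pw P v)) f = 0" "hinner (Z y - cs c y) f = 0"
    by (simp_all add: hinner_Ma'[symmetric] KK_def A_adj_eigen hinner_diff_left hinner_shift)
  then have "hinner (pw R one) f = 0"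
    using x(2)[OF f(1)] arg_cong[OF y, of "\<lambda>y. hinner y f"] by (simp add: hinner_diff_left)
  moreover have "hinner (pw R one) f = of_real (\<Sum>i\<le>degree R. (cmod (coeff R i))\<^sup>2)"
  proof -
    have "coeff R i * cnj (coef f (0, i)) = of_real ((cmod (coeff R i))\<^sup>2)" for i
      unfolding complex_norm_square using u(1)[of i] f(2)[of i] by (cases "i < length Li") auto
    then show ?thesis
      by (simp add: pw_def hinner_sum_left hinner_shift_one_left del: of_real_power)
  qed
  ultimately have "(\<Sum>i\<le>degree R. (cmod (coeff R i))\<^sup>2) = 0" by (simp only: of_real_eq_0_iff)
  then have "lead_coeff R = 0" by (simp add: sum_nonneg_eq_0_iff)
  then have "pw R one = 0" by (intro fn_eq_0D) simp
  then have "x = Z y - cs c y + M (pw P v)" using y by (simp add: algebra_simps)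
  then show ?thesis using x(1) unfolding range_A_iff by blast
qed

lemma range_A_eq:
  assumes "\<And>w. cmod w = 1 \<Longrightarrow> poly Q w \<noteq> 0"
  shows "A c ` KK = {x \<in> KK. \<forall>f\<in>sol c Li. hinner x f = 0}"
proof (intro equalityI subsetI)
  fix x assume "x \<in> A c ` KK"
  then obtain g where g: "g \<in> KK" "x = A c g" by blast
  have "hinner x f = 0" if "f \<in> sol c Li" for f
  proof -
    have "f \<in> KK" "A_adj c f = 0" using that ker_A_adj_eq_sol by auto
    then show ?thesis by (simp add: g(2) hinner_A)
  qed
  then show "x \<in> {x \<in> KK. \<forall>f\<in>sol c Li. hinner x f = 0}" using g by simp
qed (use in_range_if_orthogonal[OF assms] in blast)

text \<open>Solve first in the whole Hardy space, by \<open>f\<close>. The obstruction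
  \<open>M_adj f\<close> lies in \<open>eig c\<close>. There \<open>adjw P\<close> after
  \<open>M_adj\<close> equals \<open>adjw Q\<close>, which is onto \<open>eig c\<close> when no root
  is on the circle, and \<open>adjw P\<close> is injective. So some \<open>d\<close> in
  \<open>eig c\<close> has the same obstruction, and subtracting it repairs \<open>f\<close> without
  changing its image.\<close>

lemma range_A_adj:
  assumes circ: "\<And>w. cmod w = 1 \<Longrightarrow> poly Q w \<noteq> 0"
  shows "A_adj c ` KK = KK"
proof (intro equalityI subsetI)
  fix y assume y: "y \<in> KK"
  obtain f where f: "cs (cnj c) (Z f) + Z y = f"
    using ex1_resolvent[where V = Z and c = "cnj c" and h = "Z y", OF shift_linear(2)] c by auto
  have "Bz (cs (cnj c) (Z f) + Z y) = cs (cnj c) f + y" by simp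
  then have Bf: "Bz f = cs (cnj c) f + y" unfolding f .
  have "Bz (M_adj f) = M_adj (Bz f)" by simp
  also have "\<dots> = cs (cnj c) (M_adj f)" unfolding Bf using y by (simp add: KK_def)
  finally have x: "M_adj f \<in> eig c" by (rule eigI)
  have "adjw P (M_adj f) \<in> eig c" by (rule eig_closed(4)[OF x])
  then have "cs (1 / cnj a) (adjw P (M_adj f)) \<in> eig c" by (rule eig_closed)
  then obtain d where d: "d \<in> eig c" "adjw (linprod (Li @ Lo)) d = cs (1 / cnj a) (adjw P (M_adj f))"
    using adjw_eig_surj[OF c, of "Li @ Lo"] circ Li Lo by force
  then have "adjw Q d = adjw P (M_adj f)" using a by (simp add: Q adjw_smult)
  moreover have "adjw P (M_adj d) = adjw Q d"
  proof (rule hinner_eqI')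
    fix g
    have "hinner g (adjw P (M_adj d)) = hinner (M (pw P g)) d" by (simp add: hinner_pw[symmetric] hinner_Ma')
    also have "\<dots> = hinner (pw Q g) d" by (rule eig_hinner_eq[OF d(1) c]) (rule fn_M_pw)
    also have "\<dots> = hinner g (adjw Q d)" by (rule hinner_pw)
    finally show "hinner g (adjw P (M_adj d)) = hinner g (adjw Q d)" .
  qed
  ultimately have "adjw P (M_adj d - M_adj f) = 0" by simp
  then have "M_adj d - M_adj f = 0" by (rule adjw_P_inj)
  then have "f - d \<in> KK" by (simp add: KK_def)
  moreover have "A_adj c (f - d) = y" using eigD[OF d(1)] by (simp add: A_adj_def Bf)
  ultimately show "y \<in> A_adj c ` KK" by blast
qed auto

text \<open>A closed range contains the projection of the product of the inner factors, since that
  product is orthogonal to the kernel of the adjoint. On the slice this says P = a *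
  \<open>linprod Lo\<close> * h. Radially towards w0, \<open>linprod Lo\<close> vanishes at least to
  first order while h grows at most like (1 - r)^(-1/2); so P(w0) = 0, a contradiction.\<close>

lemma range_not_closed:
  assumes w0: "cmod w0 = 1" "poly Q w0 = 0"
  shows "\<not> closed (A c ` KK)"
proof
  assume closed: "closed (A c ` KK)"
  have "pr (pw (linprod Li) one) \<in> A c ` KK"
  proof (rule closed_range_A[OF closed])
    fix g assume g: "g \<in> KK" "A_adj c g = 0"
    then have "g \<in> sol c Li" using ker_A_adj_eq_sol by blast
    then show "hinner (pr (pw (linprod Li) one)) g = 0"
      using g(1) by (simp add: hinner_pr hinner_pw sol_def)
  qed simp
  then obtain u g where "pr (pw (linprod Li) one) = Z u - cs c u + M g" unfolding range_A_iff by blast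
  then have "pw (linprod Li) one = Z u - cs c u + M (g + M_adj (pw (linprod Li) one))"
    by (simp add: pr_def algebra_simps)
  then obtain h where h: "pw (linprod Li) one = Z u - cs c u + M h" by blast
  obtain Q2 where Q2: "linprod Lo = [:-w0, 1:] * Q2"
    using poly_linprod_eq_0_iff[of Lo w0] Lo[of w0] w0 poly_eq_0_iff_dvd by (auto simp: dvd_def)
  define r where "r = (\<lambda>n. of_real (rad n) * w0)"
  have r1: "cmod (r n) = rad n" for n using rad_bounds[of n] w0 by (simp add: r_def norm_mult)
  have r: "cmod (r n) < 1" for n unfolding r1 by (rule rad_bounds)
  have rlim: "r \<longlonglongrightarrow> w0"
    using tendsto_mult[OF tendsto_of_real[OF rad_tendsto] tendsto_const[of w0]] by (simp add: r_def)
  have plim: "(\<lambda>n. poly p (r n)) \<longlonglongrightarrow> poly p w0" for p by (intro tendsto_intros rlim)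
  have "poly (linprod Li) w0 \<noteq> 0" using poly_linprod_eq_0_iff[of Li w0] Li[of w0] w0 by simp
  \<comment> \<open>Cancelling the inner factors needs them to be nonzero, which they are near
    \<open>w0\<close>.\<close>
  then have ev: "\<forall>\<^sub>F n in sequentially. poly (linprod Li) (r n) \<noteq> 0"
    using plim[of "linprod Li"] tendsto_imp_eventually_ne by blast
  \<comment> \<open>Collects what does not depend on \<open>n\<close> in the reproducing kernel
    bound for \<open>h\<close>.\<close>
  define K where "K = (cmod a)\<^sup>2 * (norm h)\<^sup>2 / (1 - (cmod c)\<^sup>2)"
  have c2: "1 - (cmod c)\<^sup>2 > 0" using c by (simp add: abs_square_less_1)
  have bound: "(cmod (poly P (r n)))\<^sup>2 \<le> K * (1 - rad n) * (cmod (poly Q2 (r n)))\<^sup>2"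
    if ne: "poly (linprod Li) (r n) \<noteq> 0" for n
  proof -
    have "poly (linprod Li) (r n) = \<theta> (c, r n) * fn h (c, r n)"
      using arg_cong[OF h, of "\<lambda>x. fn x (c, r n)"] r[of n] c by (simp add: fn_Z fn_M fn_one)
    then have "poly P (r n) * poly (linprod Li) (r n) = poly Q (r n) * fn h (c, r n)"
      using PQ[OF r[of n]] by (metis mult.assoc)
    then have "poly P (r n) * poly (linprod Li) (r n) = (a * poly (linprod Lo) (r n) * fn h (c, r n)) * poly (linprod Li) (r n)"
      by (simp add: Q algebra_simps)
    then have e: "poly P (r n) = a * poly (linprod Lo) (r n) * fn h (c, r n)" using ne by simp
    have "cmod (r n - w0) = 1 - rad n"
    proof -
      have "r n - w0 = of_real (rad n - 1) * w0" by (simp add: r_def algebra_simps)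
      then show ?thesis using rad_bounds[of n] w0 by (simp add: norm_mult del: of_real_diff)
    qed
    then have lo: "cmod (poly (linprod Lo) (r n)) = (1 - rad n) * cmod (poly Q2 (r n))"
    proof -
      have "poly (linprod Lo) (r n) = (r n - w0) * poly Q2 (r n)" by (simp add: Q2 algebra_simps)
      then show ?thesis using \<open>cmod (r n - w0) = 1 - rad n\<close> by (simp only: norm_mult)
    qed
    have "(cmod (fn h (c, r n)))\<^sup>2 \<le> (norm h * norm (ker c (r n)))\<^sup>2"
      by (intro power_mono fn_bound c r) simp
    also have "\<dots> = (norm h)\<^sup>2 / ((1 - (cmod c)\<^sup>2) * (1 - (rad n)\<^sup>2))"
      using norm_ker[OF c r[of n]] by (simp add: power_mult_distrib r1)
    finally have hb: "(cmod (fn h (c, r n)))\<^sup>2 \<le> (norm h)\<^sup>2 / ((1 - (cmod c)\<^sup>2) * (1 - (rad n)\<^sup>2))" .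
    define s where "s = 1 - rad n"
    have s: "s > 0" "1 - (rad n)\<^sup>2 = s * (1 + rad n)" "1 + rad n \<ge> 1"
      using rad_bounds[of n] by (auto simp: s_def power2_eq_square algebra_simps)
    have "(cmod (poly P (r n)))\<^sup>2 = (cmod a)\<^sup>2 * s\<^sup>2 * (cmod (poly Q2 (r n)))\<^sup>2 * (cmod (fn h (c, r n)))\<^sup>2"
      unfolding e norm_mult lo by (simp add: power_mult_distrib s_def)
    also have "\<dots> \<le> (cmod a)\<^sup>2 * s\<^sup>2 * (cmod (poly Q2 (r n)))\<^sup>2 * ((norm h)\<^sup>2 / ((1 - (cmod c)\<^sup>2) * (1 - (rad n)\<^sup>2)))"
      by (intro mult_left_mono hb) auto
    also have "\<dots> = (K * s * (cmod (poly Q2 (r n)))\<^sup>2) / (1 + rad n)"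
    proof -
      have "A * s\<^sup>2 * q * (H / (e * (s * t))) = (A * H / e * s * q) / t" if "e > 0" "t > 0" for A q H e t :: real
        using that s(1) by (simp add: field_simps power2_eq_square)
      then show ?thesis unfolding s(2) K_def using c2 s(3) by simp
    qed
    also have "\<dots> \<le> (K * s * (cmod (poly Q2 (r n)))\<^sup>2) / 1"
      using s c2 by (intro divide_left_mono) (auto simp: K_def)
    finally show ?thesis by (simp add: s_def)
  qed
  have "(\<lambda>n. K * (1 - rad n) * (cmod (poly Q2 (r n)))\<^sup>2) \<longlonglongrightarrow> K * (1 - 1) * (cmod (poly Q2 w0))\<^sup>2"
    by (intro tendsto_intros rad_tendsto plim)
  then have "(cmod (poly P w0))\<^sup>2 \<le> K * (1 - 1) * (cmod (poly Q2 w0))\<^sup>2"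
  proof (rule tendsto_le[OF sequentially_bot])
    show "(\<lambda>n. (cmod (poly P (r n)))\<^sup>2) \<longlonglongrightarrow> (cmod (poly P w0))\<^sup>2" by (intro tendsto_intros plim)
    show "\<forall>\<^sub>F n in sequentially. (cmod (poly P (r n)))\<^sup>2 \<le> K * (1 - rad n) * (cmod (poly Q2 (r n)))\<^sup>2"
      using ev bound by (rule eventually_mono)
  qed
  then show False using P[of w0] w0 by simp
qed

end

section \<open>Polynomials in two variables\<close>

lemma poly2_pCons: "poly2 (pCons r q) (z, w) = poly r z + w * poly2 q (z, w)"
  by (simp add: poly2_def)

lemma poly2_0 [simp]: "poly2 0 x = 0"
  by (cases x) (simp add: poly2_def)

lemma poly2_add: "poly2 (p + q) x = poly2 p x + poly2 q x"
  by (cases x) (simp add: poly2_def)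

lemma poly2_mult: "poly2 (p * q) x = poly2 p x * poly2 q x"
  by (cases x) (simp add: poly2_def)

lemma poly2_const: "poly2 [:r:] (z, w) = poly r z"
  by (simp add: poly2_def)

lemma continuous_poly2: "continuous_on S (poly2 q)"
proof -
  have "continuous_on UNIV (\<lambda>x. poly2 q (fst x, snd x))"
  proof (induction q)
    case (pCons r q)
    have "continuous_on UNIV (\<lambda>x. poly r (fst x) + snd x * poly2 q (fst x, snd x))"
      by (intro continuous_intros pCons.IH)
    then show ?case by (simp only: poly2_pCons)
  qed simp
  then show ?thesis using continuous_on_subset by auto
qed

lemmas isCont_poly2 = continuous_on_eq_continuous_at[OF open_UNIV, THEN iffD1, OF continuous_poly2, rule_format, OF UNIV_I]

definition slice :: "complex \<Rightarrow> complex poly poly \<Rightarrow> complex poly" where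
  "slice c q = map_poly (\<lambda>r. poly r c) q"

lemma poly_slice: "poly (slice c q) w = poly2 q (c, w)"
  unfolding slice_def by (induction q) (auto simp: poly2_pCons map_poly_pCons)

lemma coeff_slice: "coeff (slice c q) n = poly (coeff q n) c"
  by (simp add: slice_def coeff_map_poly)

text \<open>Gauss: over the fraction field of the coefficients \<open>a\<close> is a unit, and
  primitivity of \<open>p\<close> brings divisibility back.\<close>

lemma primitive_dvd_if_dvd_smult:
  fixes p q :: "complex poly poly"
  assumes "p dvd smult a q" "a \<noteq> 0" "content p = 1"
  shows "p dvd q"
proof (rule fract_poly_dvdD[OF _ assms(3)])
  have "fract_poly p dvd smult (to_fract a) (fract_poly q)"
    using fract_poly_dvd[OF assms(1)] by simp
  then show "fract_poly p dvd fract_poly q"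
    using assms(2) by (simp add: dvd_smult_iff)
qed

text \<open>A nonzero element of minimal degree in the ideal generated by \<open>p\<close> and \<open>q\<close> divides both of them
  up to factors depending only on \<open>z\<close>, by pseudo-division, so coprimality forces its degree to be zero.\<close>

lemma coprime_eliminate_w:
  fixes p q :: "complex poly poly"
  assumes "p \<noteq> 0" "coprime q p"
  shows "\<exists>r. r \<noteq> 0 \<and> (\<forall>z w. poly2 q (z, w) = 0 \<longrightarrow> poly2 p (z, w) = 0 \<longrightarrow> poly r z = 0)"
proof -
  define I where "I = {u * q + v * p | u v. True}"
  have I: "f * g \<in> I" "smult b g - f * h \<in> I" if gh: "g \<in> I" "h \<in> I" for f g h b
  proof -
    obtain u v u' v' where e: "g = u * q + v * p" "h = u' * q + v' * p" using gh unfolding I_def by blast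
    have "f * g = (f * u) * q + (f * v) * p" by (simp add: e algebra_simps)
    then show "f * g \<in> I" unfolding I_def by blast
    have "smult b g - f * h = (smult b u - f * u') * q + (smult b v - f * v') * p"
      by (simp add: e algebra_simps smult_add_right)
    then show "smult b g - f * h \<in> I" unfolding I_def by blast
  qed
  have "q = 1 * q + 0 * p" "p = 0 * q + 1 * p" by simp_all
  then have qI: "q \<in> I" and pI: "p \<in> I" unfolding I_def by blast+
  define d where "d = arg_min degree (\<lambda>d. d \<in> I \<and> d \<noteq> 0)"
  have "d \<in> I \<and> d \<noteq> 0" and min: "\<And>f. f \<in> I \<and> f \<noteq> 0 \<Longrightarrow> degree d \<le> degree f"
    using arg_min_nat_lemma[of "\<lambda>d. d \<in> I \<and> d \<noteq> 0" p degree] pI assms(1) unfolding d_def by blast+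
  then have d: "d \<in> I" "d \<noteq> 0" by auto
  have dvd: "\<exists>b. b \<noteq> 0 \<and> d dvd smult b f" if "f \<in> I" for f
  proof -
    obtain b h where bh: "b \<noteq> 0" "smult b f = d * h + pseudo_mod f d" using pseudo_mod(1)[OF d(2), of f] by blast
    have "pseudo_mod f d = smult b f - h * d" using bh(2) by (simp add: mult.commute)
    then have "pseudo_mod f d \<in> I" using I(2)[OF that d(1)] by simp
    then have "pseudo_mod f d = 0" using pseudo_mod(2)[OF d(2), of f] min[of "pseudo_mod f d"] by force
    then show ?thesis using bh by (intro exI[of _ b]) simp
  qed
  define e where "e = primitive_part d"
  have e: "content e = 1" using d(2) by (simp add: e_def)
  have "d = smult (content d) e" by (simp add: e_def)
  then have ed: "e dvd d" by (metis dvd_smult dvd_refl)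
  have ef: "e dvd f" if fI: "f \<in> I" for f
  proof -
    obtain b where "b \<noteq> 0" "d dvd smult b f" using dvd[OF fI] by blast
    then show ?thesis using primitive_dvd_if_dvd_smult[of e b f] e ed dvd_trans by blast
  qed
  have "is_unit e" using coprime_common_divisor[OF assms(2) ef[OF qI] ef[OF pI]] .
  then have "degree e = 0" by (auto elim: is_unit_polyE)
  then have "degree d = 0" by (simp add: e_def)
  then obtain r where r: "d = [:r:]" using degree_eq_zeroE by blast
  obtain u v where uv: "d = u * q + v * p" using d(1) by (auto simp: I_def)
  have "poly r z = 0" if "poly2 q (z, w) = 0" "poly2 p (z, w) = 0" for z w
  proof -
    have "poly r z = poly2 (u * q + v * p) (z, w)" unfolding uv[symmetric] r poly2_const ..
    then show ?thesis using that by (simp add: poly2_add poly2_mult)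
  qed
  then show ?thesis using r d(2) by auto
qed

text \<open>If both slices vanished, z - c would divide every coefficient of both
  polynomials.\<close>

lemma coprime_slice:
  fixes p q :: "complex poly poly"
  assumes "coprime q p"
  shows "slice c q \<noteq> 0 \<or> slice c p \<noteq> 0"
proof (rule ccontr)
  assume "\<not> ?thesis"
  then have 0: "poly (coeff q n) c = 0" "poly (coeff p n) c = 0" for n
    using coeff_slice[of c q n] coeff_slice[of c p n] by auto
  have "[:[:-c, 1:]:] dvd q" "[:[:-c, 1:]:] dvd p"
    unfolding const_poly_dvd_iff using 0 by (auto simp: poly_eq_0_iff_dvd)
  with assms have "is_unit [:[:-c, 1:]:]" by (rule coprime_common_divisor)
  then have "is_unit [:-c, 1:]" by (simp add: is_unit_const_poly_iff)
  then show False by (auto elim!: is_unit_polyE)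
qed

text \<open>Elimination leaves finitely many z, and over each of them one of the two slices is a
  nonzero polynomial in w.\<close>

lemma finite_common_zeros_w:
  fixes p q :: "complex poly poly"
  assumes "p \<noteq> 0" "coprime q p"
  shows "finite {w. \<exists>z. poly2 q (z, w) = 0 \<and> poly2 p (z, w) = 0}"
proof -
  obtain r where r: "r \<noteq> 0" "\<And>z w. poly2 q (z, w) = 0 \<Longrightarrow> poly2 p (z, w) = 0 \<Longrightarrow> poly r z = 0"
    using coprime_eliminate_w[OF assms] by blast
  have "{w. \<exists>z. poly2 q (z, w) = 0 \<and> poly2 p (z, w) = 0} \<subseteq>
      (\<Union>z\<in>{z. poly r z = 0}. {w. poly (slice z q) w = 0 \<and> poly (slice z p) w = 0})"
    using r(2) by (auto simp: poly_slice)
  moreover have "finite {w. poly (slice z q) w = 0 \<and> poly (slice z p) w = 0}" for z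
    using coprime_slice[OF assms(2), of z] poly_roots_finite[of "slice z q"] poly_roots_finite[of "slice z p"]
    by (auto intro: rev_finite_subset)
  ultimately show ?thesis using poly_roots_finite[OF r(1)] by (meson finite_UN_I finite_subset)
qed

lemma uniform_limit_poly2:
  assumes "compact K" "u \<longlonglongrightarrow> w0" "\<And>n. cmod (u n) \<le> 1"
  shows "uniform_limit K (\<lambda>n z. poly2 p (z, u n)) (\<lambda>z. poly2 p (z, w0)) sequentially"
proof (rule uniform_limitI)
  fix e :: real assume "e > 0"
  have w0: "cmod w0 \<le> 1" using tendsto_upperbound[OF tendsto_norm[OF assms(2)]] assms(3) by simp
  have "compact (K \<times> cball (0 :: complex) 1)" by (intro compact_Times assms compact_cball)
  then have "uniformly_continuous_on (K \<times> cball 0 1) (poly2 p)"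
    by (intro compact_uniformly_continuous continuous_poly2)
  then obtain d where d: "d > 0" "\<And>x y. x \<in> K \<times> cball 0 1 \<Longrightarrow> y \<in> K \<times> cball 0 1 \<Longrightarrow> dist x y < d \<Longrightarrow> dist (poly2 p x) (poly2 p y) < e"
    using \<open>e > 0\<close> unfolding uniformly_continuous_on_def by metis
  have "\<forall>\<^sub>F n in sequentially. dist (u n) w0 < d" using assms(2) d(1) by (rule tendstoD)
  then show "\<forall>\<^sub>F n in sequentially. \<forall>z\<in>K. dist (poly2 p (z, u n)) (poly2 p (z, w0)) < e"
    using assms(3) w0 by (auto elim!: eventually_mono intro!: d(2) simp: dist_Pair_Pair)
qed

section \<open>Numerator and denominator on the closed bidisc\<close>

locale rational_inner = inner_multiplier +
  fixes q p :: "complex poly poly"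
  assumes p: "p \<noteq> 0" and cop: "coprime q p"
    and pq: "\<And>z w. cmod z < 1 \<Longrightarrow> cmod w < 1 \<Longrightarrow> poly2 p (z, w) * \<theta> (z, w) = poly2 q (z, w)"
begin

text \<open>Dilation carries |\<theta>| \<le> 1 to the closed bidisc in a form without division. It
  makes every zero of \<open>p\<close> there a zero of \<open>q\<close>.\<close>

lemma poly2_le:
  assumes "cmod z \<le> 1" "cmod w \<le> 1"
  shows "cmod (poly2 q (z, w)) \<le> cmod (poly2 p (z, w))"
proof -
  define y where "y = (\<lambda>n. (of_real (rad n) * z, of_real (rad n) * w))"
  have "(\<lambda>n. of_real (rad n) * u) \<longlonglongrightarrow> u" for u :: complex
    using tendsto_mult[OF tendsto_of_real[OF rad_tendsto] tendsto_const[of u]] by simp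
  then have y: "y \<longlonglongrightarrow> (z, w)" unfolding y_def by (intro tendsto_Pair)
  have lim: "(\<lambda>n. cmod (poly2 f (y n))) \<longlonglongrightarrow> cmod (poly2 f (z, w))" for f
    by (intro tendsto_norm isCont_tendsto_compose[OF isCont_poly2] y)
  have "cmod (poly2 q (y n)) \<le> cmod (poly2 p (y n))" for n
  proof -
    have sm: "cmod (of_real (rad n) * u) < 1" if "cmod u \<le> 1" for u
    proof -
      have "cmod (of_real (rad n) * u) = rad n * cmod u" using rad_bounds[of n] by (simp add: norm_mult)
      also have "\<dots> \<le> rad n * 1" using rad_bounds[of n] that by (intro mult_left_mono) auto
      finally show ?thesis using rad_bounds[of n] by simp
    qed
    have "cmod (poly2 p (y n)) * cmod (\<theta> (y n)) \<le> cmod (poly2 p (y n)) * 1"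
      unfolding y_def using norm_\<theta>_le_1[OF sm sm] assms by (intro mult_left_mono) auto
    then show ?thesis unfolding y_def pq[OF sm[OF assms(1)] sm[OF assms(2)], symmetric] by (simp add: norm_mult)
  qed
  then show ?thesis by (intro LIMSEQ_le[OF lim lim]) auto
qed

lemma p_nonzero:
  assumes c: "cmod c < 1" and w0: "cmod w0 \<le> 1"
  shows "poly2 p (c, w0) \<noteq> 0"
proof -
  define E where "E = {w. \<exists>z. poly2 q (z, w) = 0 \<and> poly2 p (z, w) = 0}"
  have zero: "poly2 q (z, w) = 0" if "cmod z \<le> 1" "cmod w \<le> 1" "poly2 p (z, w) = 0" for z w
    using poly2_le[OF that(1,2)] that(3) by simp
  have "finite E" unfolding E_def by (rule finite_common_zeros_w[OF p cop])
  \<comment> \<open>\<open>w0\<close> is approached from inside the disc while avoiding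
    \<open>E\<close>: for such w a zero of \<open>p\<close> over the disc would be a common zero and
    put w into \<open>E\<close>.\<close>
  have "w0 islimpt \<D>" using w0 by (simp add: islimpt_ball)
  then have "w0 islimpt (E \<union> (\<D> - E))" by (rule islimpt_subset) auto
  then have "w0 islimpt (\<D> - E)" using islimpt_Un_finite[OF \<open>finite E\<close>, of w0 "\<D> - E"] by blast
  then obtain u where u: "\<And>n. u n \<in> \<D> - E" "u \<longlonglongrightarrow> w0" unfolding islimpt_sequential by blast
  have hol: "(\<lambda>z. poly2 p (z, w)) holomorphic_on S" for w S
    unfolding poly2_def by (auto intro!: holomorphic_intros)
  show ?thesis
  proof
    assume c0: "poly2 p (c, w0) = 0"
    have "poly2 p (c, w0) \<noteq> 0"
    proof (rule Hurwitz_no_zeros[of \<D> "\<lambda>n z. poly2 p (z, u n)" "\<lambda>z. poly2 p (z, w0)"])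
      fix K :: "complex set" assume "compact K" "K \<subseteq> \<D>"
      show "uniform_limit K (\<lambda>n z. poly2 p (z, u n)) (\<lambda>z. poly2 p (z, w0)) sequentially"
        using u(1) less_imp_le by (intro uniform_limit_poly2 \<open>compact K\<close> u(2)) auto
    next
      \<comment> \<open>A constant limit would be 0 because of the zero at \<open>c\<close>, and
        then the nonzero eliminant \<open>r\<close> would vanish on the whole disc.\<close>
      show "\<not> (\<lambda>z. poly2 p (z, w0)) constant_on \<D>"
      proof
        assume "(\<lambda>z. poly2 p (z, w0)) constant_on \<D>"
        then obtain k where k: "\<And>z. z \<in> \<D> \<Longrightarrow> poly2 p (z, w0) = k" unfolding constant_on_def by blast
        have k0: "k = 0" using k[of c] c c0 by simp
        show False
        proof -
          obtain r where r: "r \<noteq> 0" "\<And>z w. poly2 q (z, w) = 0 \<Longrightarrow> poly2 p (z, w) = 0 \<Longrightarrow> poly r z = 0"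
            using coprime_eliminate_w[OF p cop] by blast
          have "\<D> \<subseteq> {z. poly r z = 0}"
          proof
            fix z :: complex assume z: "z \<in> \<D>"
            then have "poly2 p (z, w0) = 0" using k k0 by simp
            moreover from this have "poly2 q (z, w0) = 0" using zero z w0 by simp
            ultimately show "z \<in> {z. poly r z = 0}" using r(2) by blast
          qed
          then have "finite \<D>" using poly_roots_finite[OF r(1)] finite_subset by blast
          then show False using uncountable_ball[of 1 "0 :: complex"] countable_finite[OF \<open>finite \<D>\<close>] by simp
        qed
      qed
    next
      fix n z assume z: "z \<in> \<D>"
      show "poly2 p (z, u n) \<noteq> 0"
      proof
        assume 0: "poly2 p (z, u n) = 0"
        moreover have "poly2 q (z, u n) = 0" by (rule zero[OF _ _ 0]) (use z u(1)[of n] in auto)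
        ultimately have "u n \<in> E" unfolding E_def by blast
        then show False using u(1)[of n] by blast
      qed
    qed (use c hol in auto)
    then show False using c0 by blast
  qed
qed

text \<open>Radial limits give equality almost everywhere in the angles; the difference is
  continuous, and a nonempty open set is not null.\<close>

lemma norm_eq_on_torus:
  assumes ae: "AE (s, u) in (lborel :: (real \<times> real) measure).
        \<exists>l. ((\<lambda>r. \<theta> (of_real r * cis s, of_real r * cis u)) \<longlongrightarrow> l) (at_left 1) \<and> cmod l = 1"
    and zw: "cmod z = 1" "cmod w = 1"
  shows "cmod (poly2 q (z, w)) = cmod (poly2 p (z, w))"
proof -
  define F where "F = (\<lambda>x :: real \<times> real. cmod (poly2 q (cis (fst x), cis (snd x))) - cmod (poly2 p (cis (fst x), cis (snd x))))"
  have cont: "continuous_on UNIV F"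
    unfolding F_def
    by (intro continuous_intros continuous_on_compose2[OF continuous_poly2[of UNIV]] continuous_on_cis) auto
  have lim1: "((\<lambda>r. (of_real r * cis s, of_real r * cis u)) \<longlongrightarrow> (cis s, cis u)) (at_left 1)" for s u
  proof -
    have "((\<lambda>r. (of_real r * cis s, of_real r * cis u)) \<longlongrightarrow> (of_real 1 * cis s, of_real 1 * cis u)) (at_left 1)"
      by (intro tendsto_intros)
    then show ?thesis by simp
  qed
  have "AE x in lborel. F x = 0"
    using ae
  proof eventually_elim
    case (elim x)
    obtain s u where x: "x = (s, u)" by (cases x)
    then obtain l where l: "((\<lambda>r. \<theta> (of_real r * cis s, of_real r * cis u)) \<longlongrightarrow> l) (at_left 1)" "cmod l = 1"
      using elim by auto
    have "((\<lambda>r. poly2 p (of_real r * cis s, of_real r * cis u) * \<theta> (of_real r * cis s, of_real r * cis u)) \<longlongrightarrow>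
        poly2 p (cis s, cis u) * l) (at_left 1)"
      by (intro tendsto_mult isCont_tendsto_compose[OF isCont_poly2] lim1 l)
    moreover have "\<forall>\<^sub>F r in at_left 1. poly2 p (of_real r * cis s, of_real r * cis u) * \<theta> (of_real r * cis s, of_real r * cis u) =
        poly2 q (of_real r * cis s, of_real r * cis u)"
    proof (rule eventually_mono[OF eventually_at_left_real[of 0 "1 :: real"]])
      fix r :: real assume "r \<in> {0<..<1}"
      then show "poly2 p (of_real r * cis s, of_real r * cis u) * \<theta> (of_real r * cis s, of_real r * cis u) =
          poly2 q (of_real r * cis s, of_real r * cis u)"
        by (intro pq) (simp_all add: norm_mult)
    qed simp
    ultimately have "((\<lambda>r. poly2 q (of_real r * cis s, of_real r * cis u)) \<longlongrightarrow> poly2 p (cis s, cis u) * l) (at_left 1)"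
      using tendsto_cong by fast
    moreover have "((\<lambda>r. poly2 q (of_real r * cis s, of_real r * cis u)) \<longlongrightarrow> poly2 q (cis s, cis u)) (at_left 1)"
      by (intro isCont_tendsto_compose[OF isCont_poly2] lim1)
    ultimately have "poly2 q (cis s, cis u) = poly2 p (cis s, cis u) * l"
      using tendsto_unique trivial_limit_at_left_real by blast
    then show "F x = 0" using l(2) by (simp add: F_def x norm_mult)
  qed
  moreover have "open {x. F x \<noteq> 0}"
    using open_Collect_neq[OF cont continuous_on_const] by simp
  ultimately have "{x. F x \<noteq> 0} = {}"
  proof -
    assume ae: "AE x in lborel. F x = 0" and op: "open {x. F x \<noteq> 0}"
    have "{x. F x \<noteq> 0} \<in> sets lborel" using op by simp
    then have "{x. F x \<noteq> 0} \<in> null_sets lborel"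
      using ae by (subst AE_iff_null_sets) auto
    then have "negligible {x. F x \<noteq> 0}"
      by (simp add: negligible_iff_null_sets null_sets_completionI)
    then show ?thesis using open_not_negligible[OF op] by blast
  qed
  then have "F (Arg z, Arg w) = 0" by blast
  moreover have "cis (Arg z) = z" "cis (Arg w) = w" 
    using rcis_cmod_Arg[of z] rcis_cmod_Arg[of w] zw by (simp_all add: rcis_def)
  ultimately show ?thesis by (simp add: F_def)
qed

text \<open>Read contrapositively: \<open>q\<close> has a zero over each point of the circle. By
  compactness the absence of zeros extends to slices over nearby \<zeta>. For \<zeta> on the circle
  p/q has modulus 1 on the boundary of its slice, so |p| \<le> |q| at (\<zeta>, 0), while |q| \<le>
  |p| always holds. Hence |\<theta>(z, 0)| tends to 1 along an arc.\<close>

lemma zero_over_circle: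
  assumes ae: "AE (s, u) in (lborel :: (real \<times> real) measure).
        \<exists>l. ((\<lambda>r. \<theta> (of_real r * cis s, of_real r * cis u)) \<longlongrightarrow> l) (at_left 1) \<and> cmod l = 1"
    and l: "cmod l = 1" and nz: "\<And>w. cmod w \<le> 1 \<Longrightarrow> poly2 q (l, w) \<noteq> 0"
    and zw: "cmod z < 1" "cmod w < 1"
  shows "\<theta> (z, w) = \<theta> (z, 0)"
proof -
  have "closed {x. poly2 q x = 0}"
    by (intro closed_Collect_eq continuous_poly2 continuous_on_const)
  moreover have "compact ({l} \<times> cball (0 :: complex) 1)" by (intro compact_Times) auto
  moreover have "({l} \<times> cball 0 1) \<inter> {x. poly2 q x = 0} = {}" using nz by auto
  ultimately obtain d where d: "d > 0"
    "\<And>x y. x \<in> {l} \<times> cball 0 1 \<Longrightarrow> y \<in> {x. poly2 q x = 0} \<Longrightarrow> d \<le> dist x y"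
    using separate_compact_closed[of "{l} \<times> cball (0 :: complex) 1" "{x. poly2 q x = 0}"] by blast
  have q: "poly2 q (\<zeta>, v) \<noteq> 0" if "\<zeta> \<in> ball l d" "cmod v \<le> 1" for \<zeta> v
    using d(2)[of "(l, v)" "(\<zeta>, v)"] that by (auto simp: dist_Pair_Pair)
  show ?thesis
  proof (rule depends_only_on_z[OF l d(1) _ zw])
    fix \<zeta> assume \<zeta>: "cmod \<zeta> = 1" "\<zeta> \<in> ball l d"
    have hol: "(\<lambda>v. poly2 f (\<zeta>, v)) holomorphic_on S" for f S
      unfolding poly_slice[symmetric] by (intro holomorphic_intros)
    have hol': "(\<lambda>v. poly2 p (\<zeta>, v) / poly2 q (\<zeta>, v)) holomorphic_on cball 0 1"
      using q[OF \<zeta>(2)] by (intro holomorphic_on_divide hol) auto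
    have "norm (poly2 p (\<zeta>, 0) / poly2 q (\<zeta>, 0)) \<le> 1"
    proof (rule maximum_modulus_frontier[where S = "cball 0 1" and \<xi> = 0 and f = "\<lambda>v. poly2 p (\<zeta>, v) / poly2 q (\<zeta>, v)"])
      show "(\<lambda>v. poly2 p (\<zeta>, v) / poly2 q (\<zeta>, v)) holomorphic_on interior (cball 0 1)"
        by (rule holomorphic_on_subset[OF hol' interior_subset])
      show "continuous_on (closure (cball 0 1)) (\<lambda>v. poly2 p (\<zeta>, v) / poly2 q (\<zeta>, v))"
        using holomorphic_on_imp_continuous_on[OF hol'] by simp
      fix v :: complex assume "v \<in> frontier (cball 0 1)"
      then have "cmod v = 1" by simp
      then show "norm (poly2 p (\<zeta>, v) / poly2 q (\<zeta>, v)) \<le> 1"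
        using norm_eq_on_torus[OF ae \<zeta>(1)] by (simp add: norm_divide)
    qed auto
    then have "cmod (poly2 p (\<zeta>, 0)) \<le> cmod (poly2 q (\<zeta>, 0))"
      using q[OF \<zeta>(2), of 0] by (simp add: norm_divide divide_le_eq)
    then have eq: "cmod (poly2 q (\<zeta>, 0)) = cmod (poly2 p (\<zeta>, 0))"
      using poly2_le[of \<zeta> 0] \<zeta>(1) by simp
    then have p0: "poly2 p (\<zeta>, 0) \<noteq> 0" using q[OF \<zeta>(2), of 0] by auto
    have lim: "((\<lambda>z. poly2 f (z, 0)) \<longlongrightarrow> poly2 f (\<zeta>, 0)) (at \<zeta> within \<D>)" for f
      by (intro isCont_tendsto_compose[OF isCont_poly2] tendsto_intros)
    have "((\<lambda>z. 1 - (cmod (poly2 q (z, 0) / poly2 p (z, 0)))\<^sup>2) \<longlongrightarrow>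
        1 - (cmod (poly2 q (\<zeta>, 0) / poly2 p (\<zeta>, 0)))\<^sup>2) (at \<zeta> within \<D>)"
      by (intro tendsto_intros lim p0)
    moreover have "1 - (cmod (poly2 q (\<zeta>, 0) / poly2 p (\<zeta>, 0)))\<^sup>2 = 0"
      using eq p0 by (simp add: norm_divide)
    moreover have "\<forall>\<^sub>F z in at \<zeta> within \<D>. 1 - (cmod (poly2 q (z, 0) / poly2 p (z, 0)))\<^sup>2 = 1 - (cmod (\<theta> (z, 0)))\<^sup>2"
    proof -
      have "poly2 q (z, 0) / poly2 p (z, 0) = \<theta> (z, 0)" if "cmod z < 1" for z
        using pq[OF that, of 0] p_nonzero[OF that, of 0] by (simp add: field_simps)
      then show ?thesis by (auto simp: eventually_at_filter intro!: always_eventually)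
    qed
    ultimately show "((\<lambda>z. 1 - (cmod (\<theta> (z, 0)))\<^sup>2) \<longlongrightarrow> 0) (at \<zeta> within \<D>)"
      by (simp only:) (rule Lim_transform_eventually)
  qed
qed

end

section \<open>Finite-dimensional kernels\<close>

lemma fn_sum_cs: "fn (\<Sum>i\<in>I. cs (d i) (g i)) = (\<Sum>i\<in>I. cscale (d i) (fn (g i)))"
  by (induction I rule: infinite_finite_induct) (auto simp: fn_linear)

lemma cs_sum_coef: "coef (\<Sum>i\<in>I. cs (d i) (g i)) k = (\<Sum>i\<in>I. d i * coef (g i) k)"
  by (induction I rule: infinite_finite_induct) auto

lemma sol_diff: "f \<in> sol c L \<Longrightarrow> g \<in> sol c L \<Longrightarrow> f - g \<in> sol c L"
  by (auto simp: sol_def intro: eig_closed)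

lemma sol_0: "0 \<in> sol c L" and sol_cs: "f \<in> sol c L \<Longrightarrow> cs a f \<in> sol c L"
  by (auto simp: sol_def intro: eig_closed)

lemma sol_sum: "(\<And>i. i \<in> I \<Longrightarrow> g i \<in> sol c L) \<Longrightarrow> (\<Sum>i\<in>I. cs (d i) (g i)) \<in> sol c L"
proof (induction I rule: infinite_finite_induct)
  case (insert i I)
  have "cs (d i) (g i) - (0 - (\<Sum>i\<in>I. cs (d i) (g i))) \<in> sol c L"
    using insert by (intro sol_diff sol_cs sol_0) auto
  then show ?case using insert by simp
qed (auto simp: sol_0)

text \<open>The vectors \<open>\<phi> m\<close> are dual to the first coefficient functionals:
  \<open>ex_sol\<close> provides them and \<open>sol_unique\<close> makes them span. Dimensions are
  taken after \<open>fn\<close>, in the function space of the statement.\<close>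

lemma dim_sol:
  assumes "cmod c < 1" "\<And>a. a \<in> set L \<Longrightarrow> cmod a < 1"
  shows "finite_dim (fn ` sol c L)" "cfun2.dim (fn ` sol c L) = length L"
proof -
  have "\<exists>f\<in>sol c L. \<forall>n<length L. coef f (0, n) = (if n = m then 1 else 0)" for m
    by (rule ex_sol[OF assms(1)]) (rule assms(2))
  then obtain \<phi> where \<phi>: "\<And>m. \<phi> m \<in> sol c L"
    "\<And>m n. n < length L \<Longrightarrow> coef (\<phi> m) (0, n) = (if n = m then 1 else 0)" by metis
  define B where "B = (\<lambda>m. fn (\<phi> m)) ` {..<length L}"
  have inj: "inj_on (\<lambda>m. fn (\<phi> m)) {..<length L}"
  proof (rule inj_onI)
    fix m n assume mn: "m \<in> {..<length L}" "n \<in> {..<length L}" "fn (\<phi> m) = fn (\<phi> n)"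
    then have "coef (\<phi> m) (0, m) = coef (\<phi> n) (0, m)" by simp
    then show "m = n" using \<phi>(2)[of m m] \<phi>(2)[of m n] mn(1) by (simp split: if_splits)
  qed
  have expand: "f = (\<Sum>n<length L. cs (coef f (0, n)) (\<phi> n))" if f: "f \<in> sol c L" for f
  proof -
    have "f - (\<Sum>n<length L. cs (coef f (0, n)) (\<phi> n)) = 0"
    proof (rule sol_unique)
      show "f - (\<Sum>n<length L. cs (coef f (0, n)) (\<phi> n)) \<in> sol c L"
        by (intro sol_diff f sol_sum \<phi>(1))
      fix n assume n: "n < length L"
      have "(\<Sum>m<length L. coef f (0, m) * coef (\<phi> m) (0, n)) = (\<Sum>m<length L. if m = n then coef f (0, n) else 0)"
        using \<phi>(2)[OF n] by (intro sum.cong refl) auto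
      then show "coef (f - (\<Sum>n<length L. cs (coef f (0, n)) (\<phi> n))) (0, n) = 0"
        using n by (simp add: cs_sum_coef)
    qed
    then show ?thesis by simp
  qed
  have sub: "fn ` sol c L \<subseteq> cfun2.span B"
  proof (rule image_subsetI)
    fix f assume "f \<in> sol c L"
    have "(\<Sum>n<length L. cscale (coef f (0, n)) (fn (\<phi> n))) \<in> cfun2.span B"
      by (intro cfun2.span_sum cfun2.span_scale cfun2.span_base) (auto simp: B_def)
    then show "fn f \<in> cfun2.span B"
      using arg_cong[OF expand[OF \<open>f \<in> sol c L\<close>], of fn] by (simp only: fn_sum_cs)
  qed
  show "finite_dim (fn ` sol c L)"
    unfolding finite_dim_def using sub by (intro exI[of _ B]) (simp add: B_def)
  have ind: "cfun2.independent B"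
  proof (rule cfun2.independent_if_scalars_zero)
    show "finite B" by (simp add: B_def)
    fix d x assume 0: "(\<Sum>x\<in>B. cscale (d x) x) = 0" and "x \<in> B"
    then obtain n where n: "n < length L" "x = fn (\<phi> n)" by (auto simp: B_def)
    have "fn (\<Sum>m<length L. cs (d (fn (\<phi> m))) (\<phi> m)) = fn 0"
      using 0 unfolding B_def sum.reindex[OF inj] fn_sum_cs o_def by (simp add: fn_linear)
    then have "(\<Sum>m<length L. cs (d (fn (\<phi> m))) (\<phi> m)) = 0" by (simp only: fn_eq_iff)
    from arg_cong[OF this, of "\<lambda>y. coef y (0, n)"]
    have "(\<Sum>m<length L. d (fn (\<phi> m)) * coef (\<phi> m) (0, n)) = 0" by (simp add: cs_sum_coef)
    moreover have "(\<Sum>m<length L. d (fn (\<phi> m)) * coef (\<phi> m) (0, n)) = (\<Sum>m<length L. if m = n then d x else 0)"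
      using \<phi>(2)[OF n(1)] n(2) by (intro sum.cong refl) auto
    ultimately show "d x = 0" using n(1) by simp
  qed
  have "B \<subseteq> fn ` sol c L" using \<phi>(1) by (auto simp: B_def)
  then have "cfun2.span B = cfun2.span (fn ` sol c L)"
    using sub by (intro cfun2.span_eq[THEN iffD2] conjI) (auto intro: cfun2.span_base)
  from cfun2.dim_eq_card[OF this ind] show "cfun2.dim (fn ` sol c L) = length L"
    using card_image[OF inj] by (simp add: B_def)
qed

lemma finite_dim_0: "finite_dim {fn 0}" and dim_0: "cfun2.dim {fn 0} = 0"
proof -
  show "finite_dim {fn 0}"
    unfolding finite_dim_def by (intro exI[of _ "{}"]) (simp add: fn_linear)
  show "cfun2.dim {fn 0} = 0"
    by (rule cfun2.dim_eq_card[of "{}", simplified])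
      (simp_all add: fn_linear cfun2.span_zero cfun2.independent_empty)
qed

section \<open>The operators of the statement\<close>

text \<open>Vanishing outside the bidisc turns the pointwise identity for \<open>M\<close> into the
  equality of total functions \<open>fn_M_eq\<close>.\<close>

locale model = inner_multiplier +
  assumes \<theta>_outside: "x \<notin> \<D>\<^sup>2 \<Longrightarrow> \<theta> x = 0"
begin

lemma fn_M_eq: "fn (M x) = \<theta> * fn x"
proof
  fix p
  show "fn (M x) p = (\<theta> * fn x) p"
  proof (cases "p \<in> \<D>\<^sup>2")
    case True
    then show ?thesis by (cases p) (auto simp: fn_M)
  qed (simp add: fn_outside \<theta>_outside)
qed

lemma model_space_eq: "\<K> \<theta> = fn ` KK"
proof -
  have "h2_inner (fn x) (\<theta> * fn y) = hinner x (M y)" for x y by (simp flip: fn_M_eq)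
  then show ?thesis by (auto simp: model_space_def H2_eq KK_iff)
qed

lemma eq_0_if_orthogonal_KK: "f \<in> KK \<Longrightarrow> (\<And>h. h \<in> KK \<Longrightarrow> hinner f h = 0) \<Longrightarrow> f = 0"
  using hinner_self[of f] by fastforce

lemma proj_eq: "proj (\<K> \<theta>) (fn x) = fn (pr x)"
  unfolding proj_def model_space_eq
proof (rule the_equality)
  have "h2_inner (fn x - fn (pr x)) (fn h) = 0" if "h \<in> KK" for h
    unfolding fn_linear(2)[symmetric] h2_inner_fn using that by (simp add: hinner_diff_left hinner_pr)
  then show "fn (pr x) \<in> fn ` KK \<and> (\<forall>h\<in>fn ` KK. h2_inner (fn x - fn (pr x)) h = 0)" by simp
next
  fix g assume g: "g \<in> fn ` KK \<and> (\<forall>h\<in>fn ` KK. h2_inner (fn x - g) h = 0)"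
  then obtain y where y: "y \<in> KK" "g = fn y" by blast
  have "hinner (pr x - y) h = 0" if "h \<in> KK" for h
  proof -
    have "\<forall>h\<in>fn ` KK. h2_inner (fn x - fn y) h = 0" using g unfolding y(2) by simp
    from bspec[OF this imageI[OF that]] have "h2_inner (fn x - fn y) (fn h) = 0" .
    then show ?thesis unfolding fn_linear(2)[symmetric] h2_inner_fn
      using that by (simp add: hinner_diff_left hinner_pr)
  qed
  then have "pr x - y = 0" by (intro eq_0_if_orthogonal_KK) (use y in auto)
  then show "g = fn (pr x)" by (simp add: y)
qed

lemma S_z_eq: "S_z \<theta> (fn f) = fn (pr (Z f))"
  by (simp add: S_z_def mult_z_fn proj_eq)

lemma minus_scalar_eq: "f \<in> KK \<Longrightarrow> minus_scalar (S_z \<theta>) c (fn f) = fn (A c f)"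
  by (simp add: minus_scalar_def S_z_eq A_def fn_linear)

text \<open>Stated for any adjoint pair on \<open>KK\<close>, so that it serves \<open>S_z\<close>,
  its translates by scalars, and the adjoints of these.\<close>

lemma adj_eq:
  assumes "\<And>f. f \<in> KK \<Longrightarrow> T (fn f) = fn (B f)"
    "\<And>f g. f \<in> KK \<Longrightarrow> g \<in> KK \<Longrightarrow> hinner (B f) g = hinner f (B' g)" "\<And>g. g \<in> KK \<Longrightarrow> B' g \<in> KK"
    and g: "g \<in> KK"
  shows "adj (\<K> \<theta>) T (fn g) = fn (B' g)"
  unfolding adj_def model_space_eq
proof (rule the_equality)
  show "fn (B' g) \<in> fn ` KK \<and> (\<forall>f\<in>fn ` KK. h2_inner (T f) (fn g) = h2_inner f (fn (B' g)))"
    using assms by simp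
next
  fix h assume h: "h \<in> fn ` KK \<and> (\<forall>f\<in>fn ` KK. h2_inner (T f) (fn g) = h2_inner f h)"
  then obtain y where y: "y \<in> KK" "h = fn y" by blast
  have "hinner f (B' g - y) = 0" if "f \<in> KK" for f
    using h y that assms by (auto simp: hinner_diff_right)
  then have "hinner (B' g - y) (B' g - y) = 0" using y assms(3)[OF g] by simp
  then show "h = fn (B' g)" by (simp add: hinner_self y)
qed

lemma adj_S_z_eq: "g \<in> KK \<Longrightarrow> adj (\<K> \<theta>) (S_z \<theta>) (fn g) = fn (Bz g)"
  by (rule adj_eq[where B = "\<lambda>f. pr (Z f)"]) (auto simp: S_z_eq hinner_pr hinner_shift)

lemma adj_minus_scalar_eq: "g \<in> KK \<Longrightarrow> adj (\<K> \<theta>) (minus_scalar (S_z \<theta>) c) (fn g) = fn (A_adj c g)"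
  by (rule adj_eq[where B = "A c"]) (auto simp: minus_scalar_eq hinner_A)

lemma adj_adj_minus_scalar_eq:
  "g \<in> KK \<Longrightarrow> adj (\<K> \<theta>) (adj (\<K> \<theta>) (minus_scalar (S_z \<theta>) c)) (fn g) = fn (A c g)"
proof (rule adj_eq[where B = "A_adj c"])
  fix f g assume "f \<in> KK" "g \<in> KK"
  then show "hinner (A_adj c f) g = hinner f (A c g)" by (subst (1 2) hinner_commute) (simp add: hinner_A)
qed (auto simp: adj_minus_scalar_eq)

lemma Ker_eq:
  assumes "\<And>f. f \<in> KK \<Longrightarrow> T (fn f) = fn (B f)"
  shows "Ker (\<K> \<theta>) T = fn ` {f \<in> KK. B f = 0}"
proof -
  have "fn y = 0 \<longleftrightarrow> y = 0" for y using fn_eq_iff[of y 0] by (simp only: fn_linear)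
  then show ?thesis using assms by (auto simp: Ker_def model_space_eq)
qed

lemma closed_KK: "closed KK"
  unfolding closed_sequential_limits
proof (intro allI impI)
  fix x l assume x: "(\<forall>n. x n \<in> KK) \<and> x \<longlonglongrightarrow> l"
  have "hinner l (M g) = 0" for g
  proof (rule LIMSEQ_unique)
    show "(\<lambda>n. hinner (x n) (M g)) \<longlonglongrightarrow> hinner l (M g)" using x by (intro tendsto_hinner tendsto_const) blast
    have "hinner (x n) (M g) = 0" for n using x KK_iff by blast
    then show "(\<lambda>n. hinner (x n) (M g)) \<longlonglongrightarrow> 0" by simp
  qed
  then show "l \<in> KK" by (simp add: KK_iff)
qed

text \<open>The definition considers only limits inside the model space; as \<open>KK\<close> is
  closed, this amounts to closedness in \<open>hardy\<close>.\<close>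

lemma h2_closed_in_eq:
  assumes "\<And>f. f \<in> KK \<Longrightarrow> T (fn f) = fn (B f)" "\<And>f. f \<in> KK \<Longrightarrow> B f \<in> KK"
  shows "h2_closed_in (\<K> \<theta>) (T ` \<K> \<theta>) \<longleftrightarrow> closed (B ` KK)"
proof -
  have T: "T ` fn ` KK = fn ` (B ` KK)" unfolding image_image using assms(1) by (intro image_cong) auto
  have sub: "B ` KK \<subseteq> KK" using assms(2) by blast
  have norm: "h2_norm (fn x - fn y) = dist x y" for x y
    unfolding fn_linear(2)[symmetric] h2_norm_fn dist_norm ..
  show ?thesis
  proof
    assume cl: "h2_closed_in (\<K> \<theta>) (T ` \<K> \<theta>)"
    show "closed (B ` KK)"
      unfolding closed_sequential_limits
    proof (intro allI impI)
      fix x l assume x: "(\<forall>n. x n \<in> B ` KK) \<and> x \<longlonglongrightarrow> l"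
      then have "l \<in> KK" using closed_KK sub unfolding closed_sequential_limits by blast
      moreover have "(\<lambda>n. h2_norm (fn (x n) - fn l)) \<longlonglongrightarrow> 0"
        unfolding norm using x tendsto_dist_iff by blast
      moreover have "\<forall>n. fn (x n) \<in> fn ` (B ` KK)" using x by blast
      ultimately have "(\<forall>n. fn (x n) \<in> fn ` (B ` KK)) \<and> fn l \<in> fn ` KK \<and> (\<lambda>n. h2_norm (fn (x n) - fn l)) \<longlonglongrightarrow> 0"
        by simp
      with cl[unfolded h2_closed_in_def T model_space_eq, THEN conjunct2, THEN spec, THEN spec, of "\<lambda>n. fn (x n)" "fn l"]
      have "fn l \<in> fn ` (B ` KK)" by (rule mp)
      then show "l \<in> B ` KK" by (simp add: inj_image_mem_iff inj_fn)
    qed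
  next
    assume cl: "closed (B ` KK)"
    show "h2_closed_in (\<K> \<theta>) (T ` \<K> \<theta>)"
      unfolding h2_closed_in_def T model_space_eq
    proof (intro conjI allI impI)
      show "fn ` (B ` KK) \<subseteq> fn ` KK" using sub by blast
      fix u g assume u: "(\<forall>n. u n \<in> fn ` (B ` KK)) \<and> g \<in> fn ` KK \<and> (\<lambda>n. h2_norm (u n - g)) \<longlonglongrightarrow> 0"
      then have "\<forall>n. \<exists>x. x \<in> B ` KK \<and> u n = fn x" by (auto simp: image_iff)
      then obtain x where x: "\<forall>n. x n \<in> B ` KK \<and> u n = fn (x n)" unfolding choice_iff ..
      obtain y where y: "g = fn y" using u by blast
      have "(\<lambda>n. dist (x n) y) \<longlonglongrightarrow> 0" using u x unfolding y by (simp add: norm)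
      then have "x \<longlonglongrightarrow> y" using tendsto_dist_iff by blast
      then have "y \<in> B ` KK" using cl x unfolding closed_sequential_limits by blast
      then show "g \<in> fn ` (B ` KK)" unfolding y by blast
    qed
  qed
qed

lemma fredholm_iff:
  "fredholm (\<K> \<theta>) (minus_scalar (S_z \<theta>) c) \<longleftrightarrow> closed (A c ` KK) \<and>
    finite_dim (fn ` {f \<in> KK. A c f = 0}) \<and> finite_dim (fn ` {f \<in> KK. A_adj c f = 0})"
  unfolding fredholm_def
  by (subst h2_closed_in_eq[where B = "A c"], simp add: minus_scalar_eq, simp)
    (simp add: Ker_eq[where B = "A c"] Ker_eq[where B = "A_adj c"] minus_scalar_eq adj_minus_scalar_eq)

lemma fredholm_adj_iff:
  "fredholm (\<K> \<theta>) (adj (\<K> \<theta>) (minus_scalar (S_z \<theta>) c)) \<longleftrightarrow> closed (A_adj c ` KK) \<and>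
    finite_dim (fn ` {f \<in> KK. A_adj c f = 0}) \<and> finite_dim (fn ` {f \<in> KK. A c f = 0})"
  unfolding fredholm_def
  by (subst h2_closed_in_eq[where B = "A_adj c"], simp add: adj_minus_scalar_eq, simp)
    (simp add: Ker_eq[where B = "A c"] Ker_eq[where B = "A_adj c"] adj_adj_minus_scalar_eq adj_minus_scalar_eq)

lemma index_adj:
  "index (\<K> \<theta>) (adj (\<K> \<theta>) (minus_scalar (S_z \<theta>) c)) =
    int (cfun2.dim (fn ` {f \<in> KK. A_adj c f = 0})) - int (cfun2.dim (fn ` {f \<in> KK. A c f = 0}))"
  by (simp add: index_def Ker_eq[where B = "A c"] Ker_eq[where B = "A_adj c"] adj_adj_minus_scalar_eq adj_minus_scalar_eq)

lemma ker_A_adj_outside: "cmod c \<ge> 1 \<Longrightarrow> {f \<in> KK. A_adj c f = 0} = {0}"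
  using backshift_eigen_eq_0[of "Suc 0" 0 _ "cnj c"] by (auto simp: A_adj_eigen)

lemma ker_A_outside: "cmod c \<ge> 1 \<Longrightarrow> {f \<in> KK. A c f = 0} = {0}"
  using inj_A_outside[of c] by auto

lemma ker_A_inside: "cmod c < 1 \<Longrightarrow> cmod w < 1 \<Longrightarrow> \<theta> (c, w) \<noteq> 0 \<Longrightarrow> {f \<in> KK. A c f = 0} = {0}"
  using inj_A_inside[of c w] by auto

lemma fredholm_outside: "cmod c > 1 \<Longrightarrow> fredholm (\<K> \<theta>) (minus_scalar (S_z \<theta>) c)"
  by (simp add: fredholm_iff A_outside closed_KK ker_A_adj_outside ker_A_outside finite_dim_0)

text \<open>Surjectivity and injectivity give an inverse on \<open>KK\<close>, the lower bound |c| -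
  1 makes it bounded, and \<open>inv fn\<close> transports it to functions.\<close>

lemma not_in_spectrum_outside:
  assumes c: "cmod c > 1"
  shows "c \<notin> spectrum (\<K> \<theta>) (S_z \<theta>)"
proof -
  define R where "R = (\<lambda>x. SOME f. f \<in> KK \<and> A c f = x)"
  have R: "R x \<in> KK" "A c (R x) = x" if x: "x \<in> KK" for x
  proof -
    have "x \<in> A c ` KK" using A_outside(1)[OF c] x by simp
    then have "\<exists>f. f \<in> KK \<and> A c f = x" by blast
    from someI_ex[OF this] show "R x \<in> KK" "A c (R x) = x" unfolding R_def by blast+
  qed
  have RA: "R (A c f) = f" if f: "f \<in> KK" for f
  proof -
    have "A c (R (A c f) - f) = 0" by (simp add: R)
    then show ?thesis using inj_A_outside[of c "R (A c f) - f"] c f R by simp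
  qed
  have bd: "norm (R x) \<le> 1 / (cmod c - 1) * norm x" if x: "x \<in> KK" for x
    using A_outside(2)[OF c R(1)[OF x]] c by (simp add: R[OF x] field_simps)
  define R' where "R' = (\<lambda>g. fn (R (inv fn g)))"
  have R': "R' (fn x) = fn (R x)" for x by (simp add: R'_def inv_f_f inj_fn)
  have "invertible_on (\<K> \<theta>) (minus_scalar (S_z \<theta>) c)"
    unfolding invertible_on_def model_space_eq
    by (intro exI[of _ R'] exI[of _ "1 / (cmod c - 1)"]) (use R RA bd in \<open>auto simp: R' minus_scalar_eq\<close>)
  then show ?thesis by (simp add: spectrum_def)
qed

end

section \<open>Inner factors in the first variable, and orders of zeros\<close>

lemma AE_radial_limit:
  "inner_function \<theta> \<Longrightarrow> AE (s, u) in (lborel :: (real \<times> real) measure).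
        \<exists>l. ((\<lambda>r. \<theta> (of_real r * cis s, of_real r * cis u)) \<longlongrightarrow> l) (at_left 1) \<and> cmod l = 1"
  unfolding inner_function_def by blast

text \<open>Such a \<theta> is its own inner factor, with cofactor \<open>one\<close>.\<close>

lemma inner_factor_if_depends_only_on_z:
  assumes "inner_function \<theta>" "\<not> \<theta> constant_on \<D>\<^sup>2" "\<And>z w. cmod z < 1 \<Longrightarrow> cmod w < 1 \<Longrightarrow> \<theta> (z, w) = \<theta> (z, 0)"
  shows "has_inner_factor_in_z \<theta>"
proof -
  obtain t where t: "\<theta> = fn t" using assms(1) by (auto simp: inner_function_def H2_eq)
  have "\<theta> = \<theta> * fn one"
  proof
    fix p
    show "\<theta> p = (\<theta> * fn one) p"
    proof (cases "p \<in> \<D>\<^sup>2")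
      case True
      then show ?thesis by (cases p) (auto simp: fn_one)
    qed (simp add: t fn_outside)
  qed
  moreover have "\<exists>h. \<forall>z\<in>\<D>. \<forall>w\<in>\<D>. \<theta> (z, w) = h z"
  proof (intro exI[of _ "\<lambda>z. \<theta> (z, 0)"] ballI)
    fix z w :: complex assume "z \<in> \<D>" "w \<in> \<D>"
    then show "\<theta> (z, w) = \<theta> (z, 0)" by (intro assms(3)) simp_all
  qed
  ultimately show ?thesis
    unfolding has_inner_factor_in_z_def H2_eq
    using assms(1,2) by (intro exI[of _ \<theta>] exI[of _ "fn one"] conjI rangeI)
qed

lemma norm_Blaschke:
  assumes "cmod c < 1" "cmod z = 1"
  shows "cmod ((z - c) / (1 - cnj c * z)) = 1"
proof -
  have z: "z * cnj z = 1" using assms(2) by (simp add: complex_norm_square[symmetric])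
  have "z - c = z * cnj (1 - cnj c * z)" using z by (simp add: algebra_simps)
  then have "cmod (z - c) = cmod (1 - cnj c * z)" using assms(2) by (metis complex_mod_cnj mult_1 norm_mult)
  moreover have "cmod (z - c) \<noteq> 0" using assms by auto
  ultimately show ?thesis by (simp add: norm_divide)
qed

text \<open>The Blaschke factor of \<open>c\<close> splits off: z - c divides \<theta>, and
  multiplying the quotient by 1 - cnj c * z gives the cofactor.\<close>

lemma inner_factor_if_slice_zero:
  assumes "inner_function \<theta>" "cmod c < 1" "\<And>w. cmod w < 1 \<Longrightarrow> \<theta> (c, w) = 0"
  shows "has_inner_factor_in_z \<theta>"
proof -
  obtain t where t: "\<theta> = fn t" using assms(1) by (auto simp: inner_function_def H2_eq)
  obtain u where u: "t = Z u - cs c u" using divide_by_z_minus[OF assms(2), of t] assms(3) by (auto simp: t)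
  \<comment> \<open>The equation is b = cnj c * z * b + (z - c), so b = (z - c) / (1 - cnj c * z),
    obtained directly as an element of the Hardy space.\<close>
  obtain b where b: "cs (cnj c) (Z b) + (Z one - cs c one) = b"
    using ex1_resolvent[where V = Z and c = "cnj c" and h = "Z one - cs c one", OF shift_linear(2)] assms(2) by auto
  have den: "1 - cnj c * z \<noteq> 0" if "cmod z \<le> 1" for z
  proof
    assume "1 - cnj c * z = 0"
    then have "cmod c * cmod z = 1" by (metis complex_mod_cnj diff_eq_diff_eq diff_zero norm_mult norm_one right_minus_eq)
    moreover have "cmod c * cmod z \<le> cmod c * 1" using that by (intro mult_left_mono) auto
    ultimately show False using assms(2) by simp
  qed
  have fb: "fn b (z, w) = (z - c) / (1 - cnj c * z)" if "cmod z < 1" "cmod w < 1" for z w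
  proof -
    have "cnj c * (z * fn b (z, w)) + (z - c) = fn b (z, w)"
      using arg_cong[OF b, of "\<lambda>x. fn x (z, w)"] that by (simp add: fn_Z fn_one)
    then have "fn b (z, w) * (1 - cnj c * z) = z - c" by (simp add: algebra_simps)
    then show ?thesis using den[of z] that by (simp add: field_simps)
  qed
  have "inner_function (fn b)"
    unfolding inner_function_def H2_eq
  proof (intro conjI rangeI AE_I2, clarify)
    fix s v :: real
    have "((\<lambda>r. (of_real r * cis s - c) / (1 - cnj c * (of_real r * cis s))) \<longlongrightarrow>
       (of_real 1 * cis s - c) / (1 - cnj c * (of_real 1 * cis s))) (at_left 1)"
      by (intro tendsto_intros) (use den[of "cis s"] in simp)
    moreover have "\<forall>\<^sub>F r in at_left 1. (of_real r * cis s - c) / (1 - cnj c * (of_real r * cis s)) =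
        fn b (of_real r * cis s, of_real r * cis v)"
      by (rule eventually_mono[OF eventually_at_left_real[of 0 "1 :: real"]]) (auto simp: fb norm_mult)
    ultimately have "((\<lambda>r. fn b (of_real r * cis s, of_real r * cis v)) \<longlongrightarrow> (cis s - c) / (1 - cnj c * cis s)) (at_left 1)"
      by (simp add: filterlim_cong)
    then show "\<exists>l. ((\<lambda>r. fn b (of_real r * cis s, of_real r * cis v)) \<longlongrightarrow> l) (at_left 1) \<and> cmod l = 1"
      using norm_Blaschke[OF assms(2), of "cis s"] by auto
  qed
  moreover have "\<not> fn b constant_on \<D>\<^sup>2"
  proof
    assume "fn b constant_on \<D>\<^sup>2"
    then obtain k where k: "\<And>x. x \<in> \<D>\<^sup>2 \<Longrightarrow> fn b x = k" unfolding constant_on_def by blast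
    have "k = 0" using k[of "(c, 0)"] fb[of c 0] assms(2) by simp
    have "z = c" if "cmod z < 1" for z
      using k[of "(z, 0)"] fb[of z 0] den[of z] that \<open>k = 0\<close> by simp
    from this[of 0] this[of "1/2"] show False by (simp add: norm_divide)
  qed
  moreover have "\<exists>h. \<forall>z\<in>\<D>. \<forall>w\<in>\<D>. fn b (z, w) = h z"
    by (intro exI[of _ "\<lambda>z. (z - c) / (1 - cnj c * z)"]) (simp add: fb)
  moreover have "\<theta> = fn b * fn (u - cs (cnj c) (Z u))"
  proof
    fix p
    show "\<theta> p = (fn b * fn (u - cs (cnj c) (Z u))) p"
    proof (cases "p \<in> \<D>\<^sup>2")
      case True
      then obtain z w where p: "p = (z, w)" "cmod z < 1" "cmod w < 1" by auto
      have "fn (u - cs (cnj c) (Z u)) (z, w) = (1 - cnj c * z) * fn u (z, w)"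
        by (simp add: fn_Z algebra_simps)
      then have "(fn b * fn (u - cs (cnj c) (Z u))) p = (z - c) * fn u (z, w)"
        using den[of z] p by (simp add: fb)
      also have "\<dots> = \<theta> p" by (simp add: t u fn_Z p algebra_simps)
      finally show ?thesis ..
    qed (simp add: t fn_outside)
  qed
  ultimately show ?thesis
    unfolding has_inner_factor_in_z_def H2_eq
    by (intro exI[of _ "fn b"] exI[of _ "fn (u - cs (cnj c) (Z u))"] conjI rangeI)
qed

lemma zorder_quotient:
  fixes P Q :: "complex poly"
  assumes "open S" "z \<in> S" "Q \<noteq> 0" "\<And>w. w \<in> S \<Longrightarrow> poly P w \<noteq> 0"
    and f: "\<And>w. w \<in> S \<Longrightarrow> f w = poly Q w / poly P w"
  shows "zorder f z = int (order z Q)"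
proof -
  obtain R where R: "Q = [:-z, 1:] ^ order z Q * R" "\<not> [:-z, 1:] dvd R"
    using order_decomp[OF assms(3)] by blast
  show ?thesis
  proof (rule zorder_eqI[OF assms(1,2)])
    show "(\<lambda>w. poly R w / poly P w) holomorphic_on S"
      using assms(4) by (intro holomorphic_intros) auto
    show "poly R z / poly P z \<noteq> 0" using R(2) assms(2,4) by (simp add: poly_eq_0_iff_dvd)
    fix w assume w: "w \<in> S"
    have "poly Q w = (w - z) ^ order z Q * poly R w" by (subst R(1)) simp
    then show "f w = poly R w / poly P w * (w - z) powi int (order z Q)" by (simp add: f[OF w])
  qed
qed

lemma frontier_bidisc: "frontier \<D>\<^sup>2 = cball 0 1 \<times> cball 0 1 - \<D>\<^sup>2"
  by (simp add: frontier_def closure_Times interior_Times)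

lemma closed_orthogonal:
  assumes "closed K"
  shows "closed {x \<in> K. \<forall>f\<in>V. hinner x f = 0}"
  unfolding closed_sequential_limits
proof (intro allI impI)
  fix x l assume x: "(\<forall>n. x n \<in> {x \<in> K. \<forall>f\<in>V. hinner x f = 0}) \<and> x \<longlonglongrightarrow> l"
  have "l \<in> K" using assms x unfolding closed_sequential_limits by blast
  moreover have "hinner l f = 0" if "f \<in> V" for f
  proof (rule LIMSEQ_unique)
    show "(\<lambda>n. hinner (x n) f) \<longlonglongrightarrow> hinner l f" using x by (intro tendsto_hinner tendsto_const) blast
    have "hinner (x n) f = 0" for n using x that by blast
    then show "(\<lambda>n. hinner (x n) f) \<longlonglongrightarrow> 0" by simp
  qed
  ultimately show "l \<in> {x \<in> K. \<forall>f\<in>V. hinner x f = 0}" by blast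
qed

section \<open>Spectra and index for a rational inner function\<close>

text \<open>The last two assumptions are the form in which the absence of inner factors in z is
  used.\<close>

locale rational_model = model \<theta> M + rational_inner \<theta> M q p for \<theta> M q p +
  assumes ae: "AE (s, u) in (lborel :: (real \<times> real) measure).
        \<exists>l. ((\<lambda>r. \<theta> (of_real r * cis s, of_real r * cis u)) \<longlongrightarrow> l) (at_left 1) \<and> cmod l = 1"
    and slice_nz: "\<And>c. cmod c < 1 \<Longrightarrow> \<exists>w. cmod w < 1 \<and> \<theta> (c, w) \<noteq> 0"
    and depends_on_w: "\<exists>z w. cmod z < 1 \<and> cmod w < 1 \<and> \<theta> (z, w) \<noteq> \<theta> (z, 0)"
begin

lemma \<theta>_eq:
  assumes "cmod c < 1" "cmod w < 1"
  shows "\<theta> (c, w) = poly (slice c q) w / poly (slice c p) w"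
  using pq[OF assms] p_nonzero[of c w] assms by (simp add: poly_slice field_simps)

lemma slice_q_nonzero: "cmod c < 1 \<Longrightarrow> slice c q \<noteq> 0"
  using slice_nz[of c] \<theta>_eq[of c] by fastforce

text \<open>Gathers the conclusions of \<open>rational_slice\<close> for one \<open>c\<close>,
  hiding the factorisation of the slice behind the list of its inner zeros.\<close>

lemma inside:
  assumes c: "cmod c < 1"
  shows "\<exists>L. (\<forall>w. w \<in> set L \<longleftrightarrow> poly2 q (c, w) = 0 \<and> cmod w < 1) \<and>
    {f \<in> KK. A_adj c f = 0} = sol c L \<and>
    length L = (\<Sum>w | poly (slice c q) w = 0 \<and> cmod w < 1. order w (slice c q)) \<and>
    ((\<forall>w. cmod w = 1 \<longrightarrow> poly2 q (c, w) \<noteq> 0) \<longrightarrow> closed (A c ` KK) \<and> A_adj c ` KK = KK) \<and>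
    (\<forall>w. cmod w = 1 \<longrightarrow> poly2 q (c, w) = 0 \<longrightarrow> \<not> closed (A c ` KK))"
proof -
  obtain a Li Lo where F: "a \<noteq> 0" "slice c q = smult a (linprod Li * linprod Lo)"
    "\<And>w. w \<in> set Li \<longleftrightarrow> poly (slice c q) w = 0 \<and> cmod w < 1"
    "\<And>w. w \<in> set Lo \<longleftrightarrow> poly (slice c q) w = 0 \<and> cmod w \<ge> 1"
    "length Li = (\<Sum>w | poly (slice c q) w = 0 \<and> cmod w < 1. order w (slice c q))"
    by (rule poly_split_roots[OF slice_q_nonzero[OF c]]) (rule that; assumption)
  interpret rational_slice \<theta> M c "slice c p" "slice c q" a Li Lo
  proof
    show "cmod c < 1" by (rule c)
    show "poly (slice c p) w * \<theta> (c, w) = poly (slice c q) w" if "cmod w < 1" for w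
      unfolding poly_slice by (rule pq[OF c that])
    show "poly (slice c p) w \<noteq> 0" if "cmod w \<le> 1" for w
      unfolding poly_slice by (rule p_nonzero[OF c that])
  qed (fact F)+
  show ?thesis
  proof (intro exI[of _ Li] conjI allI impI)
    show "w \<in> set Li \<longleftrightarrow> poly2 q (c, w) = 0 \<and> cmod w < 1" for w using F(3)[of w] by (simp only: poly_slice)
    show "{f \<in> KK. A_adj c f = 0} = sol c Li" by (rule ker_A_adj_eq_sol)
    show "\<not> closed (A c ` KK)" if "cmod w = 1" "poly2 q (c, w) = 0" for w
      by (rule range_not_closed[OF that(1)]) (simp only: poly_slice that(2))
  next
    assume *: "\<forall>w. cmod w = 1 \<longrightarrow> poly2 q (c, w) \<noteq> 0"
    have nz: "poly (slice c q) w \<noteq> 0" if "cmod w = 1" for w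
      using *[rule_format, OF that] by (simp only: poly_slice not_False_eq_True)
    show "closed (A c ` KK)"
      by (subst range_A_eq) (use nz closed_orthogonal[OF closed_KK] in blast)+
    show "A_adj c ` KK = KK" by (rule range_A_adj[OF nz])
  qed (rule F(5))
qed

lemma ker_A_0: "{f \<in> KK. A c f = 0} = {0}"
proof (cases "cmod c < 1")
  case True
  then show ?thesis using slice_nz[OF True] ker_A_inside by blast
qed (simp add: ker_A_outside)

lemma fredholm_inside_iff:
  assumes c: "cmod c < 1"
  shows "fredholm (\<K> \<theta>) (minus_scalar (S_z \<theta>) c) \<longleftrightarrow> (\<forall>w. cmod w = 1 \<longrightarrow> poly2 q (c, w) \<noteq> 0)"
proof -
  obtain L where L: "\<forall>w. w \<in> set L \<longleftrightarrow> poly2 q (c, w) = 0 \<and> cmod w < 1"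
    "{f \<in> KK. A_adj c f = 0} = sol c L"
    "length L = (\<Sum>w | poly (slice c q) w = 0 \<and> cmod w < 1. order w (slice c q))"
    "(\<forall>w. cmod w = 1 \<longrightarrow> poly2 q (c, w) \<noteq> 0) \<longrightarrow> closed (A c ` KK) \<and> A_adj c ` KK = KK"
    "\<forall>w. cmod w = 1 \<longrightarrow> poly2 q (c, w) = 0 \<longrightarrow> \<not> closed (A c ` KK)"
    using inside[OF c] by (elim exE conjE) (rule that)
  have "finite_dim (fn ` {f \<in> KK. A_adj c f = 0})"
    unfolding L(2) by (rule dim_sol[OF c]) (use L(1) in blast)
  then show ?thesis unfolding fredholm_iff ker_A_0 using L(4,5) finite_dim_0 by auto
qed

lemma not_fredholm_on_circle:
  assumes c: "cmod c = 1"
  shows "\<not> fredholm (\<K> \<theta>) (minus_scalar (S_z \<theta>) c)"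
  using closed_range_on_circle[OF c] depends_on_w unfolding fredholm_iff by blast

lemma essential_spectrum_eq:
  "essential_spectrum (\<K> \<theta>) (S_z \<theta>) = \<T> \<union> fst ` (zero_set q \<inter> \<D> \<times> \<T>)"
proof (rule set_eqI)
  fix c
  consider "cmod c < 1" | "cmod c = 1" | "cmod c > 1" by linarith
  then show "c \<in> essential_spectrum (\<K> \<theta>) (S_z \<theta>) \<longleftrightarrow> c \<in> \<T> \<union> fst ` (zero_set q \<inter> \<D> \<times> \<T>)"
  proof cases
    case 1
    then have "c \<in> essential_spectrum (\<K> \<theta>) (S_z \<theta>) \<longleftrightarrow> (\<exists>w. cmod w = 1 \<and> poly2 q (c, w) = 0)"
      by (simp add: essential_spectrum_def fredholm_inside_iff)
    also have "\<dots> \<longleftrightarrow> c \<in> \<T> \<union> fst ` (zero_set q \<inter> \<D> \<times> \<T>)"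
      using 1 by (force simp: zero_set_def)
    finally show ?thesis .
  next
    case 2
    then show ?thesis using not_fredholm_on_circle by (simp add: essential_spectrum_def)
  next
    case 3
    then show ?thesis using fredholm_outside[of c] by (auto simp: essential_spectrum_def)
  qed
qed

text \<open>Over the open disc this is bookkeeping; over the circle it is
  \<open>zero_over_circle\<close>.\<close>

lemma zero_set_frontier:
  "\<T> \<union> fst ` (zero_set q \<inter> \<D> \<times> \<T>) = fst ` (zero_set q \<inter> frontier \<D>\<^sup>2)"
proof (intro equalityI subsetI)
  fix c assume "c \<in> \<T> \<union> fst ` (zero_set q \<inter> \<D> \<times> \<T>)"
  then consider "cmod c = 1" | w where "poly2 q (c, w) = 0" "cmod c < 1" "cmod w = 1"
    by (auto simp: zero_set_def)
  then show "c \<in> fst ` (zero_set q \<inter> frontier \<D>\<^sup>2)"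
  proof cases
    case 1
    have "\<exists>w. cmod w \<le> 1 \<and> poly2 q (c, w) = 0"
      using zero_over_circle[OF ae 1] depends_on_w by blast
    then show ?thesis using 1 by (force simp: frontier_bidisc zero_set_def)
  next
    case (2 w)
    then show ?thesis by (force simp: frontier_bidisc zero_set_def)
  qed
next
  fix c assume "c \<in> fst ` (zero_set q \<inter> frontier \<D>\<^sup>2)"
  then obtain w where "(c, w) \<in> zero_set q \<inter> frontier \<D>\<^sup>2" by auto
  then have w: "poly2 q (c, w) = 0" "cmod c \<le> 1" "cmod w \<le> 1" "\<not> (cmod c < 1 \<and> cmod w < 1)"
    by (auto simp: frontier_bidisc zero_set_def)
  show "c \<in> \<T> \<union> fst ` (zero_set q \<inter> \<D> \<times> \<T>)"
  proof (cases "cmod c = 1")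
    case False
    then have "cmod c < 1" "cmod w = 1" using w by auto
    then show ?thesis using w(1) by (force simp: zero_set_def)
  qed simp
qed

lemma point_spectrum_adj_eq:
  "point_spectrum (\<K> \<theta>) (adj (\<K> \<theta>) (S_z \<theta>)) = cnj ` fst ` (zero_set q \<inter> \<D>\<^sup>2)"
proof (rule set_eqI)
  fix d
  \<comment> \<open>\<open>A_adj c\<close> subtracts \<open>cnj c\<close>, so an eigenvalue
    \<open>d\<close> of the adjoint belongs to the slice over its conjugate.\<close>
  define c where "c = cnj d"
  have fn0: "fn f = 0 \<longleftrightarrow> f = 0" for f using fn_eq_iff[of f 0] by (simp only: fn_linear)
  have "d \<in> point_spectrum (\<K> \<theta>) (adj (\<K> \<theta>) (S_z \<theta>)) \<longleftrightarrow> (\<exists>f\<in>KK. f \<noteq> 0 \<and> A_adj c f = 0)"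
    unfolding point_spectrum_def model_space_eq[symmetric]
    unfolding point_spectrum_def model_space_eq
    by (auto simp: adj_S_z_eq[unfolded model_space_eq] fn0 A_adj_eigen c_def simp flip: fn_linear)
  also have "\<dots> \<longleftrightarrow> cmod c < 1 \<and> (\<exists>w. cmod w < 1 \<and> poly2 q (c, w) = 0)"
  proof (cases "cmod c < 1")
    case c: True
    obtain L where L: "\<forall>w. w \<in> set L \<longleftrightarrow> poly2 q (c, w) = 0 \<and> cmod w < 1"
      "{f \<in> KK. A_adj c f = 0} = sol c L"
      "length L = (\<Sum>w | poly (slice c q) w = 0 \<and> cmod w < 1. order w (slice c q))"
      "(\<forall>w. cmod w = 1 \<longrightarrow> poly2 q (c, w) \<noteq> 0) \<longrightarrow> closed (A c ` KK) \<and> A_adj c ` KK = KK"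
      "\<forall>w. cmod w = 1 \<longrightarrow> poly2 q (c, w) = 0 \<longrightarrow> \<not> closed (A c ` KK)"
      using inside[OF c] by (elim exE conjE) (rule that)
    have "(\<exists>f\<in>KK. f \<noteq> 0 \<and> A_adj c f = 0) \<longleftrightarrow> (\<exists>f\<in>sol c L. f \<noteq> 0)" unfolding L(2)[symmetric] by blast
    also have "\<dots> \<longleftrightarrow> set L \<noteq> {}"
    proof
      assume "\<exists>f\<in>sol c L. f \<noteq> 0"
      then show "set L \<noteq> {}" using sol_unique[of _ c L] by force
    next
      assume ne: "set L \<noteq> {}"
      \<comment> \<open>Prescribing 1 makes \<open>f\<close> nonzero, since a nonempty list puts the
        coefficient at (0, 0) among the prescribed ones.\<close>
      obtain f where f: "f \<in> sol c L" "\<forall>n<length L. coef f (0, n) = 1"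
        using ex_sol[OF c, of L "\<lambda>_. 1"] L(1) by blast
      then have "coef f (0, 0) = 1" using ne by auto
      then have "f \<noteq> 0" by auto
      then show "\<exists>f\<in>sol c L. f \<noteq> 0" using f(1) by blast
    qed
    also have "\<dots> \<longleftrightarrow> (\<exists>w. w \<in> set L)" by (rule ex_in_conv[symmetric])
    also have "\<dots> \<longleftrightarrow> (\<exists>w. cmod w < 1 \<and> poly2 q (c, w) = 0)"
      unfolding L(1)[rule_format] by (simp only: conj_commute)
    finally show ?thesis using c by (simp only: simp_thms)
  next
    case False
    then show ?thesis using ker_A_adj_outside[of c] by auto
  qed
  also have "\<dots> \<longleftrightarrow> d \<in> cnj ` fst ` (zero_set q \<inter> \<D>\<^sup>2)"
  proof
    assume "cmod c < 1 \<and> (\<exists>w. cmod w < 1 \<and> poly2 q (c, w) = 0)"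
    then obtain w where "(c, w) \<in> zero_set q \<inter> \<D>\<^sup>2" by (auto simp: zero_set_def)
    then have "cnj (fst (c, w)) \<in> cnj ` fst ` (zero_set q \<inter> \<D>\<^sup>2)" by (intro imageI)
    then show "d \<in> cnj ` fst ` (zero_set q \<inter> \<D>\<^sup>2)" by (simp add: c_def)
  qed (auto simp: zero_set_def c_def)
  finally show "d \<in> point_spectrum (\<K> \<theta>) (adj (\<K> \<theta>) (S_z \<theta>)) \<longleftrightarrow> d \<in> cnj ` fst ` (zero_set q \<inter> \<D>\<^sup>2)" .
qed

text \<open>Points beyond the circle are not in the spectrum and the circle is essential, so |c| < 1
  and the slice has no zero on the circle. As \<open>A c\<close> is injective, the index of the
  adjoint is the dimension of \<open>sol c L\<close>, the number of inner zeros.\<close>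

lemma fredholm_index:
  assumes "c \<in> spectrum (\<K> \<theta>) (S_z \<theta>) - essential_spectrum (\<K> \<theta>) (S_z \<theta>)"
  shows "fredholm (\<K> \<theta>) (adj (\<K> \<theta>) (minus_scalar (S_z \<theta>) c))" "finite (slice_zeros \<theta> c)"
    "index (\<K> \<theta>) (adj (\<K> \<theta>) (minus_scalar (S_z \<theta>) c)) = slice_zero_count \<theta> c"
proof -
  have fr: "fredholm (\<K> \<theta>) (minus_scalar (S_z \<theta>) c)" using assms by (simp add: essential_spectrum_def)
  have "\<not> cmod c > 1" using assms not_in_spectrum_outside by blast
  moreover have "cmod c \<noteq> 1" using fr not_fredholm_on_circle by blast
  ultimately have c: "cmod c < 1" by simp
  obtain L where L: "\<forall>w. w \<in> set L \<longleftrightarrow> poly2 q (c, w) = 0 \<and> cmod w < 1"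
    "{f \<in> KK. A_adj c f = 0} = sol c L"
    "length L = (\<Sum>w | poly (slice c q) w = 0 \<and> cmod w < 1. order w (slice c q))"
    "(\<forall>w. cmod w = 1 \<longrightarrow> poly2 q (c, w) \<noteq> 0) \<longrightarrow> closed (A c ` KK) \<and> A_adj c ` KK = KK"
    "\<forall>w. cmod w = 1 \<longrightarrow> poly2 q (c, w) = 0 \<longrightarrow> \<not> closed (A c ` KK)"
    using inside[OF c] by (elim exE conjE) (rule that)
  have nz: "poly2 q (c, w) \<noteq> 0" if "cmod w = 1" for w using fr fredholm_inside_iff[OF c] that by blast
  have L1: "cmod w < 1" if "w \<in> set L" for w using L(1) that by blast
  have "A_adj c ` KK = KK" using L(4) nz by blast
  then show "fredholm (\<K> \<theta>) (adj (\<K> \<theta>) (minus_scalar (S_z \<theta>) c))"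
    unfolding fredholm_adj_iff ker_A_0 L(2) using dim_sol(1)[OF c L1] closed_KK by (simp add: finite_dim_0)
  have zeros: "slice_zeros \<theta> c = {w. poly (slice c q) w = 0 \<and> cmod w < 1}"
    using p_nonzero[OF c] by (auto simp: slice_zeros_def \<theta>_eq[OF c] poly_slice)
  show "finite (slice_zeros \<theta> c)"
    unfolding zeros using poly_roots_finite[OF slice_q_nonzero[OF c]] by (rule rev_finite_subset) auto
  have "zorder (\<lambda>w. \<theta> (c, w)) w = int (order w (slice c q))" if "cmod w < 1" for w
    by (rule zorder_quotient[of \<D>, where P = "slice c p"])
      (use that slice_q_nonzero[OF c] p_nonzero[OF c] \<theta>_eq[OF c] in \<open>auto simp: poly_slice\<close>)
  then have "slice_zero_count \<theta> c = (\<Sum>w | poly (slice c q) w = 0 \<and> cmod w < 1. int (order w (slice c q)))"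
    unfolding slice_zero_count_def zeros by (intro sum.cong) auto
  also have "\<dots> = int (length L)" by (simp add: L(3))
  finally show "index (\<K> \<theta>) (adj (\<K> \<theta>) (minus_scalar (S_z \<theta>) c)) = slice_zero_count \<theta> c"
    unfolding index_adj ker_A_0 L(2) using dim_sol(2)[OF c L1] by (simp add: dim_0)
qed

end

theorem theorem2p7:
  fixes \<theta> :: "complex \<times> complex \<Rightarrow> complex"
  assumes "inner_function \<theta>"
    and "\<not> \<theta> constant_on \<D>\<^sup>2"
    and "\<not> has_inner_factor_in_z \<theta>"
  shows "point_spectrum (\<K> \<theta>) (S_z \<theta>) = {} \<and>
    \<T> \<subseteq> essential_spectrum (\<K> \<theta>) (S_z \<theta>) \<and>
    (\<forall>q p. reduced_fraction \<theta> q p \<longrightarrow>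
       point_spectrum (\<K> \<theta>) (adj (\<K> \<theta>) (S_z \<theta>)) = cnj ` fst ` (zero_set q \<inter> \<D>\<^sup>2) \<and>
       essential_spectrum (\<K> \<theta>) (S_z \<theta>) = \<T> \<union> fst ` (zero_set q \<inter> \<D> \<times> \<T>) \<and>
       \<T> \<union> fst ` (zero_set q \<inter> \<D> \<times> \<T>) = fst ` (zero_set q \<inter> frontier \<D>\<^sup>2) \<and>
       (\<forall>c \<in> spectrum (\<K> \<theta>) (S_z \<theta>) - essential_spectrum (\<K> \<theta>) (S_z \<theta>).
          fredholm (\<K> \<theta>) (adj (\<K> \<theta>) (minus_scalar (S_z \<theta>) c)) \<and>
          finite (slice_zeros \<theta> c) \<and>
          index (\<K> \<theta>) (adj (\<K> \<theta>) (minus_scalar (S_z \<theta>) c)) = slice_zero_count \<theta> c))"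
proof -
  obtain t where t: "\<theta> = fn t" using assms(1) by (auto simp: inner_function_def H2_eq)
  have "inner_elt t" using assms(1) unfolding t by (rule inner_function_imp_inner_elt)
  then have "\<forall>x. \<exists>y. (\<forall>z w. cmod z < 1 \<longrightarrow> cmod w < 1 \<longrightarrow> fn y (z, w) = fn t (z, w) * fn x (z, w)) \<and> norm y = norm x"
    using ex_mult_inner by blast
  then obtain M where M: "\<forall>x. (\<forall>z w. cmod z < 1 \<longrightarrow> cmod w < 1 \<longrightarrow> fn (M x) (z, w) = fn t (z, w) * fn x (z, w)) \<and> norm (M x) = norm x"
    unfolding choice_iff ..
  interpret model \<theta> M
    by unfold_locales (use M in \<open>auto simp: t fn_outside\<close>)
  have slice_nz: "\<exists>w. cmod w < 1 \<and> \<theta> (c, w) \<noteq> 0" if "cmod c < 1" for c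
    using inner_factor_if_slice_zero[OF assms(1) that] assms(3) by blast
  have dep: "\<exists>z w. cmod z < 1 \<and> cmod w < 1 \<and> \<theta> (z, w) \<noteq> \<theta> (z, 0)"
    using inner_factor_if_depends_only_on_z[OF assms(1,2)] assms(3) by blast
  have ps: "point_spectrum (\<K> \<theta>) (S_z \<theta>) = {}"
  proof (rule equals0I)
    fix c assume "c \<in> point_spectrum (\<K> \<theta>) (S_z \<theta>)"
    then obtain f where f: "f \<in> KK" "fn f \<noteq> 0" "S_z \<theta> (fn f) = cscale c (fn f)"
      by (auto simp: point_spectrum_def model_space_eq)
    have "pr (Z f) = cs c f" using f(3) by (simp add: S_z_eq flip: fn_linear)
    then have "A c f = 0" using f(1) by (simp add: A_def)
    moreover have "f \<noteq> 0" using f(2) fn_linear(4) by blast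
    ultimately show False
      using inj_A_outside[of c f] inj_A_inside[of c _ f] slice_nz[of c] f(1) by (meson not_less)
  qed
  have circ: "\<T> \<subseteq> essential_spectrum (\<K> \<theta>) (S_z \<theta>)"
  proof
    fix c :: complex assume "c \<in> \<T>"
    obtain z w where zw: "cmod z < 1" "cmod w < 1" "\<theta> (z, w) \<noteq> \<theta> (z, 0)" using dep by blast
    have "\<not> closed (A c ` KK)"
    proof
      assume "closed (A c ` KK)"
      with \<open>c \<in> \<T>\<close> have "\<theta> (z, w) = \<theta> (z, 0)" by (intro closed_range_on_circle[of c] zw) simp_all
      then show False using zw(3) by contradiction
    qed
    then show "c \<in> essential_spectrum (\<K> \<theta>) (S_z \<theta>)" by (simp add: essential_spectrum_def fredholm_iff)
  qed
  have rat: "point_spectrum (\<K> \<theta>) (adj (\<K> \<theta>) (S_z \<theta>)) = cnj ` fst ` (zero_set q \<inter> \<D>\<^sup>2) \<and>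
       essential_spectrum (\<K> \<theta>) (S_z \<theta>) = \<T> \<union> fst ` (zero_set q \<inter> \<D> \<times> \<T>) \<and>
       \<T> \<union> fst ` (zero_set q \<inter> \<D> \<times> \<T>) = fst ` (zero_set q \<inter> frontier \<D>\<^sup>2) \<and>
       (\<forall>c \<in> spectrum (\<K> \<theta>) (S_z \<theta>) - essential_spectrum (\<K> \<theta>) (S_z \<theta>).
          fredholm (\<K> \<theta>) (adj (\<K> \<theta>) (minus_scalar (S_z \<theta>) c)) \<and>
          finite (slice_zeros \<theta> c) \<and>
          index (\<K> \<theta>) (adj (\<K> \<theta>) (minus_scalar (S_z \<theta>) c)) = slice_zero_count \<theta> c)"
    if "reduced_fraction \<theta> q p" for q p
  proof -
    interpret rational_model \<theta> M q p
    proof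
      show "p \<noteq> 0" "coprime q p" using that unfolding reduced_fraction_def by blast+
      show "poly2 p (z, w) * \<theta> (z, w) = poly2 q (z, w)" if zw: "cmod z < 1" "cmod w < 1" for z w
        using \<open>reduced_fraction \<theta> q p\<close> zw unfolding reduced_fraction_def by simp
    qed (fact AE_radial_limit[OF assms(1)] slice_nz dep)+
    show ?thesis
      by (intro conjI ballI point_spectrum_adj_eq essential_spectrum_eq zero_set_frontier fredholm_index)
  qed
  show ?thesis by (rule conjI[OF ps conjI[OF circ]], intro allI impI, rule rat)
qed

end
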